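(* For every initial datum $U_0=\underline u^0\in\mathbb L^2(\mathcal T)$ there exists a unique solution $U(t):=e^{t\mathcal A}U_0\in C([0,+\infty),\mathbb L^2(\mathcal T))$ to the problem $U'=\mathcal A U$, $U(0)=U_0$. Moreover, the solution $\underline u=(u_1,\dots,u_N)$ satisfies the dissipation law $$E'(t)=-\Big(\alpha-\frac N2\Big)|u_1(t,0)|^2-\frac12\sum_{j=1}^N|\partial_xu_j(t,0)|^2\le 0,$$ where $E(t)=\frac12\sum_{j=1}^N\int_0^{\ell_j}|u_j(t,x)|^2\,dx$. Therefore the energy $E$ is decreasing (nonincreasing in $t$).
   Context: Let $N\ge1$ be an integer, $\ell_1,\dots,\ell_N\in(0,+\infty)$, and $\alpha>\frac N2$. The star-shaped network $\mathcal T$ consists of $N$ edges, the $j$-th one identified with $[0,\ell_j]$, all joined at the central node $x=0$. Functions are complex-valued. $\mathbb L^2(\mathcal T)=\prod_{j=1}^NL^2(0,\ell_j)$ with inner product $(\underline u,\underline v)=\sum_{j=1}^N\int_0^{\ell_j}u_j\overline{v_j}\,dx$. Let $\mathbb H^2_e(\mathcal T)$ be the set of $\underline u=(u_1,\dots,u_N)\in\prod_{j=1}^NH^2(0,\ell_j)$ with $u_j(\ell_j)=u_j'(\ell_j)=0$ for all $j$ and $u_j(0)=u_k(0)$ for all $j,k$. The operator $\mathcal A$ on $\mathbb L^2(\mathcal T)$ is defined by $\mathcal A\underline u=(-u_j'-u_j''')_{j=1,\dots,N}$ with domain $$\mathcal D(\mathcal A)=\Big\{\underline u\in\mathbb H^2_e(\mathcal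 T)\cap\prod_{j=1}^NH^3(0,\ell_j):\ \sum_{j=1}^Nu_j''(0)=-\alpha u_1(0)\Big\}.$$ $e^{t\mathcal A}$ denotes the strongly continuous semigroup generated by $\mathcal A$ (the solution is a mild solution in general, and a classical one when $U_0\in\mathcal D(\mathcal A)$). For general $U_0\in\mathbb L^2(\mathcal T)$ the traces $u_1(\cdot,0)$, $\partial_xu_j(\cdot,0)$ are the $L^2_{loc}$-limits of the traces of classical solutions with approximating initial data, and the dissipation law is understood for almost every $t$. *)

theory Defs
  imports "HOL-Analysis.Analysis"
begin

section \<open>The complex Hilbert space of square-integrable functions on the line\<close>

definition square_integrable :: "(real \<Rightarrow> complex) \<Rightarrow> bool" where
  "square_integrable f \<longleftrightarrow>
     f \<in> borel_measurable lebesgue \<and> integrable lebesgue (\<lambda>x. (cmod (f x))\<^sup>2)"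

definition L2_rel :: "(real \<Rightarrow> complex) \<Rightarrow> (real \<Rightarrow> complex) \<Rightarrow> bool" where
  "L2_rel f g \<longleftrightarrow>
     square_integrable f \<and> square_integrable g \<and> (AE x in lebesgue. f x = g x)"

lemma square_integrable_zero: "square_integrable (\<lambda>_. 0)"
  by (simp add: square_integrable_def)

lemma part_equivp_L2_rel: "part_equivp L2_rel"
proof (rule part_equivpI)
  show "\<exists>f. L2_rel f f"
    using square_integrable_zero by (auto simp: L2_rel_def)
  show "symp L2_rel"
    by (auto simp: symp_def L2_rel_def eq_commute)
  show "transp L2_rel"
    unfolding transp_def L2_rel_def by auto
qed

quotient_type L2 = "real \<Rightarrow> complex" / partial: L2_rel
  by (rule part_equivp_L2_rel)

lemma square_integrable_add:
  assumes "square_integrable f" "square_integrable g"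
  shows "square_integrable (\<lambda>x. f x + g x)"
proof -
  have [measurable]: "f \<in> borel_measurable lebesgue" "g \<in> borel_measurable lebesgue"
    using assms by (auto simp: square_integrable_def)
  have le: "(cmod (f x + g x))\<^sup>2 \<le> 2 * (cmod (f x))\<^sup>2 + 2 * (cmod (g x))\<^sup>2" for x
  proof -
    have "(cmod (f x + g x))\<^sup>2 \<le> (cmod (f x) + cmod (g x))\<^sup>2"
      by (intro power_mono norm_triangle_ineq) auto
    also have "\<dots> \<le> 2 * (cmod (f x))\<^sup>2 + 2 * (cmod (g x))\<^sup>2"
      using sum_squares_bound[of "cmod (f x)" "cmod (g x)"] by (simp add: power2_sum)
    finally show ?thesis .
  qed
  have "integrable lebesgue (\<lambda>x. 2 * (cmod (f x))\<^sup>2 + 2 * (cmod (g x))\<^sup>2)"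
    using assms by (auto simp: square_integrable_def)
  then have "integrable lebesgue (\<lambda>x. (cmod (f x + g x))\<^sup>2)"
    by (rule Bochner_Integration.integrable_bound) (use le in \<open>auto intro!: AE_I2\<close>)
  then show ?thesis by (simp add: square_integrable_def)
qed

lemma square_integrable_cmult:
  assumes "square_integrable f"
  shows "square_integrable (\<lambda>x. c * f x)"
proof -
  have [measurable]: "f \<in> borel_measurable lebesgue"
    using assms by (auto simp: square_integrable_def)
  show ?thesis
    using assms by (auto simp: square_integrable_def norm_mult power_mult_distrib)
qed

lemma integrable_inner_L2:
  assumes "square_integrable f" "square_integrable g"
  shows "integrable lebesgue (\<lambda>x. f x \<bullet> g x)"
proof -
  have [measurable]: "f \<in> borel_measurable lebesgue" "g \<in> borel_measurable lebesgue"
    using assms by (auto simp: square_integrable_def)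
  have le: "\<bar>f x \<bullet> g x\<bar> \<le> (cmod (f x))\<^sup>2 + (cmod (g x))\<^sup>2" for x
  proof -
    have "0 \<le> cmod (f x) * cmod (g x)" by simp
    then show ?thesis
      using Cauchy_Schwarz_ineq2[of "f x" "g x"] sum_squares_bound[of "cmod (f x)" "cmod (g x)"]
      by linarith
  qed
  have "integrable lebesgue (\<lambda>x. (cmod (f x))\<^sup>2 + (cmod (g x))\<^sup>2)"
    using assms by (auto simp: square_integrable_def)
  then show ?thesis
    by (rule Bochner_Integration.integrable_bound) (use le in \<open>auto intro!: AE_I2\<close>)
qed

instantiation L2 :: real_inner
begin

lift_definition zero_L2 :: L2 is "\<lambda>_. 0"
  by (simp add: L2_rel_def square_integrable_zero)

lift_definition plus_L2 :: "L2 \<Rightarrow> L2 \<Rightarrow> L2" is "\<lambda>f g x. f x + g x"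
  by (auto simp: L2_rel_def square_integrable_add)

lift_definition uminus_L2 :: "L2 \<Rightarrow> L2" is "\<lambda>f x. - f x"
  using square_integrable_cmult[of _ "-1"] by (auto simp: L2_rel_def)

definition minus_L2 :: "L2 \<Rightarrow> L2 \<Rightarrow> L2" where
  "minus_L2 f g = f + (- g)"

lift_definition scaleR_L2 :: "real \<Rightarrow> L2 \<Rightarrow> L2" is "\<lambda>r f x. complex_of_real r * f x"
  by (auto simp: L2_rel_def square_integrable_cmult)

text \<open>The pointwise product is \<open>Re (f x * cnj (g x))\<close>, so this is the real part of the
  Hermitian inner product; both induce the same norm.\<close>

lift_definition inner_L2 :: "L2 \<Rightarrow> L2 \<Rightarrow> real" is "\<lambda>f g. LINT x|lebesgue. f x \<bullet> g x"
proof -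
  fix f f' g g' assume *: "L2_rel f f'" "L2_rel g g'"
  then have [measurable]: "f \<in> borel_measurable lebesgue" "g \<in> borel_measurable lebesgue"
    "f' \<in> borel_measurable lebesgue" "g' \<in> borel_measurable lebesgue"
    by (auto simp: square_integrable_def L2_rel_def)
  show "(LINT x|lebesgue. f x \<bullet> g x) = (LINT x|lebesgue. f' x \<bullet> g' x)"
    by (rule integral_cong_AE) (use * in \<open>auto simp: L2_rel_def\<close>)
qed

definition norm_L2 :: "L2 \<Rightarrow> real" where "norm_L2 f = sqrt (f \<bullet> f)"

definition sgn_L2 :: "L2 \<Rightarrow> L2" where "sgn_L2 f = scaleR (inverse (norm f)) f"

definition dist_L2 :: "L2 \<Rightarrow> L2 \<Rightarrow> real" where "dist_L2 f g = norm (f - g)"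

definition uniformity_L2 :: "(L2 \<times> L2) filter" where
  "uniformity_L2 = (INF e\<in>{0<..}. principal {(f, g). dist f g < e})"

definition open_L2 :: "L2 set \<Rightarrow> bool" where
  "open_L2 S \<longleftrightarrow> (\<forall>f\<in>S. \<forall>\<^sub>F (f', g) in uniformity. f' = f \<longrightarrow> g \<in> S)"

instance
proof
  fix a b c f g h :: L2 and r s :: real and S :: "L2 set"
  show "a + b + c = a + (b + c)"
    by transfer (auto simp: L2_rel_def add.assoc intro!: square_integrable_add)
  show "a + b = b + a"
    by transfer (auto simp: L2_rel_def add.commute intro!: square_integrable_add)
  show "0 + a = a"
    by transfer (auto simp: L2_rel_def)
  show "- a + a = 0"
    by transfer (auto simp: L2_rel_def square_integrable_zero)
  show "a - b = a + - b"
    by (simp add: minus_L2_def)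
  show "r *\<^sub>R (a + b) = r *\<^sub>R a + r *\<^sub>R b"
    by transfer (auto simp: L2_rel_def distrib_left
        intro!: square_integrable_add square_integrable_cmult)
  show "(r + s) *\<^sub>R a = r *\<^sub>R a + s *\<^sub>R a"
    by transfer (auto simp: L2_rel_def distrib_right
        intro!: square_integrable_add square_integrable_cmult)
  show "r *\<^sub>R s *\<^sub>R a = (r * s) *\<^sub>R a"
    by transfer (auto simp: L2_rel_def mult.assoc intro!: square_integrable_cmult)
  show "1 *\<^sub>R a = a"
    by transfer (auto simp: L2_rel_def)
  show "dist f g = norm (f - g)"
    by (simp add: dist_L2_def)
  show "sgn f = scaleR (inverse (norm f)) f"
    by (simp add: sgn_L2_def)
  show "uniformity = (INF e\<in>{0<..}. principal {(f :: L2, g). dist f g < e})"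
    by (simp add: uniformity_L2_def)
  show "open S \<longleftrightarrow> (\<forall>f\<in>S. \<forall>\<^sub>F (f', g) in uniformity. f' = f \<longrightarrow> g \<in> S)"
    by (simp add: open_L2_def)
  show "f \<bullet> g = g \<bullet> f"
    by transfer (simp add: inner_commute)
  show "(f + g) \<bullet> h = f \<bullet> h + g \<bullet> h"
    by transfer (auto simp: L2_rel_def inner_add_left integrable_inner_L2)
  show "(r *\<^sub>R f) \<bullet> g = r * (f \<bullet> g)"
  proof transfer
    fix r and f g :: "real \<Rightarrow> complex"
    have "(complex_of_real r * f x) \<bullet> g x = r * (f x \<bullet> g x)" for x
      by (metis inner_scaleR_left scaleR_conv_of_real)
    then show "(LINT x|lebesgue. (complex_of_real r * f x) \<bullet> g x) = r * (LINT x|lebesgue. f x \<bullet> g x)"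
      by simp
  qed
  show "0 \<le> f \<bullet> f"
    by transfer (simp add: integral_nonneg_AE)
  show "f \<bullet> f = 0 \<longleftrightarrow> f = 0"
  proof transfer
    fix f assume f: "L2_rel f f"
    then have "integrable lebesgue (\<lambda>x. f x \<bullet> f x)"
      by (auto simp: L2_rel_def integrable_inner_L2)
    from integral_nonneg_eq_0_iff_AE[OF this]
    have "(LINT x|lebesgue. f x \<bullet> f x) = 0 \<longleftrightarrow> (AE x in lebesgue. f x = 0)"
      by simp
    then show "(LINT x|lebesgue. f x \<bullet> f x) = 0 \<longleftrightarrow> L2_rel f (\<lambda>_. 0)"
      using f by (simp add: L2_rel_def square_integrable_zero)
  qed
  show "norm f = sqrt (f \<bullet> f)"
    by (simp add: norm_L2_def)
qed

end

lift_definition scaleC :: "complex \<Rightarrow> L2 \<Rightarrow> L2" is "\<lambda>c f x. c * f x"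
  by (auto simp: L2_rel_def square_integrable_cmult)


section \<open>Sobolev spaces on an interval\<close>

text \<open>
  \<open>rep_L2 f\<close> is an arbitrarily chosen representative of the class \<open>f\<close>; everything
  below is insensitive to this choice. The space \<open>L\<^sup>2(0,l)\<close> is identified with the
  subspace of the classes that vanish outside \<open>(0,l)\<close>, by extending functions by zero.
  No regularity across the end points is implied: weak derivatives are tested on \<open>(0,l)\<close> only,
  and the weak derivative is again extended by zero.
\<close>

definition L2_on :: "real \<Rightarrow> L2 set" where
  "L2_on l = {f. AE x in lebesgue. x \<notin> {0<..<l} \<longrightarrow> rep_L2 f x = 0}"

text \<open>Test functions of class \<open>C\<^sup>1\<close> with compact support in the open interval \<open>(0,l)\<close>, as in
  the definition of \<open>W\<^sup>1\<^sup>,\<^sup>p\<close> of an interval in Brezis, Functional Analysis, Sobolev Spaces and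
  Partial Differential Equations, Chapter 8. Real-valued test functions suffice, by linearity.\<close>

definition test_function :: "real \<Rightarrow> (real \<Rightarrow> real) \<Rightarrow> (real \<Rightarrow> real) \<Rightarrow> bool" where
  "test_function l \<phi> \<phi>' \<longleftrightarrow>
     (\<forall>x. (\<phi> has_real_derivative \<phi>' x) (at x)) \<and> continuous_on UNIV \<phi>' \<and>
     (\<exists>a b. 0 < a \<and> b < l \<and> (\<forall>x. x \<notin> {a..b} \<longrightarrow> \<phi> x = 0))"

definition has_weak_deriv :: "real \<Rightarrow> L2 \<Rightarrow> L2 \<Rightarrow> bool" where
  "has_weak_deriv l f g \<longleftrightarrow>
     (\<forall>\<phi> \<phi>'. test_function l \<phi> \<phi>' \<longrightarrow>
        (LINT x:{0<..<l}|lebesgue. \<phi>' x *\<^sub>R rep_L2 f x) =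
        - (LINT x:{0<..<l}|lebesgue. \<phi> x *\<^sub>R rep_L2 g x))"

primrec sobolev :: "nat \<Rightarrow> real \<Rightarrow> L2 set" where
  "sobolev 0 l = L2_on l"
| "sobolev (Suc k) l = {f \<in> L2_on l. \<exists>g \<in> sobolev k l. has_weak_deriv l f g}"

definition weak_deriv :: "real \<Rightarrow> L2 \<Rightarrow> L2" where
  "weak_deriv l f = (THE g. g \<in> L2_on l \<and> has_weak_deriv l f g)"

text \<open>The value at \<open>x \<in> [0,l]\<close> of the continuous representative on \<open>[0,l]\<close>, which exists for
  functions in \<open>H\<^sup>1(0,l)\<close>.\<close>

definition pt_value :: "real \<Rightarrow> L2 \<Rightarrow> real \<Rightarrow> complex" where
  "pt_value l f x = (THE z. \<exists>g. continuous_on {0..l} g \<and>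
     (AE y in lebesgue. y \<in> {0<..<l} \<longrightarrow> rep_L2 f y = g y) \<and> z = g x)"


section \<open>The star-shaped network and its operator\<close>

text \<open>
  The edges are indexed by a finite type \<open>'n\<close>, so that \<open>N = CARD('n)\<close>; the norm on \<open>L2 ^ 'n\<close> is
  the one of the product Hilbert space. The parameter \<open>e1\<close> is the edge carrying the number 1.
\<close>

definition L2_net :: "('n::finite \<Rightarrow> real) \<Rightarrow> (L2 ^ 'n) set" where
  "L2_net \<l> = {u. \<forall>j. u $ j \<in> L2_on (\<l> j)}"

definition scaleC_net :: "complex \<Rightarrow> L2 ^ 'n::finite \<Rightarrow> L2 ^ 'n" where
  "scaleC_net c u = (\<chi> j. scaleC c (u $ j))"

definition H2e :: "('n::finite \<Rightarrow> real) \<Rightarrow> (L2 ^ 'n) set" where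
  "H2e \<l> = {u. (\<forall>j. u $ j \<in> sobolev 2 (\<l> j)) \<and>
     (\<forall>j. pt_value (\<l> j) (u $ j) (\<l> j) = 0 \<and> pt_value (\<l> j) (weak_deriv (\<l> j) (u $ j)) (\<l> j) = 0) \<and>
     (\<forall>j k. pt_value (\<l> j) (u $ j) 0 = pt_value (\<l> k) (u $ k) 0)}"

definition dom_A :: "('n::finite \<Rightarrow> real) \<Rightarrow> 'n \<Rightarrow> real \<Rightarrow> (L2 ^ 'n) set" where
  "dom_A \<l> e1 \<alpha> = {u \<in> H2e \<l>. (\<forall>j. u $ j \<in> sobolev 3 (\<l> j)) \<and>
     (\<Sum>j\<in>UNIV. pt_value (\<l> j) (weak_deriv (\<l> j) (weak_deriv (\<l> j) (u $ j))) 0)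
       = - of_real \<alpha> * pt_value (\<l> e1) (u $ e1) 0}"

definition op_A :: "('n::finite \<Rightarrow> real) \<Rightarrow> L2 ^ 'n \<Rightarrow> L2 ^ 'n" where
  "op_A \<l> u = (\<chi> j. - weak_deriv (\<l> j) (u $ j)
     - weak_deriv (\<l> j) (weak_deriv (\<l> j) (weak_deriv (\<l> j) (u $ j))))"

definition energy :: "('n::finite \<Rightarrow> real) \<Rightarrow> L2 ^ 'n \<Rightarrow> real" where
  "energy \<l> u = 1/2 * (\<Sum>j\<in>UNIV. LINT x:{0<..<\<l> j}|lebesgue. (cmod (rep_L2 (u $ j) x))\<^sup>2)"


section \<open>Semigroups and solutions\<close>

definition C0_semigroup :: "(L2 ^ 'n::finite) set \<Rightarrow> (real \<Rightarrow> L2 ^ 'n \<Rightarrow> L2 ^ 'n) \<Rightarrow> bool" where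
  "C0_semigroup X S \<longleftrightarrow>
     (\<forall>t\<ge>0. (\<forall>u\<in>X. S t u \<in> X) \<and>
        (\<forall>u\<in>X. \<forall>v\<in>X. S t (u + v) = S t u + S t v) \<and>
        (\<forall>c. \<forall>u\<in>X. S t (scaleC_net c u) = scaleC_net c (S t u)) \<and>
        (\<exists>C. \<forall>u\<in>X. norm (S t u) \<le> C * norm u)) \<and>
     (\<forall>u\<in>X. S 0 u = u) \<and>
     (\<forall>s\<ge>0. \<forall>t\<ge>0. \<forall>u\<in>X. S (s + t) u = S s (S t u)) \<and>
     (\<forall>u\<in>X. ((\<lambda>t. S t u) \<longlongrightarrow> u) (at_right 0))"

definition has_generator ::
  "(L2 ^ 'n::finite) set \<Rightarrow> (real \<Rightarrow> L2 ^ 'n \<Rightarrow> L2 ^ 'n) \<Rightarrow> (L2 ^ 'n) set \<Rightarrow> (L2 ^ 'n \<Rightarrow> L2 ^ 'n) \<Rightarrow> bool"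
where
  "has_generator X S D A \<longleftrightarrow>
     D = {u \<in> X. \<exists>w. ((\<lambda>h. (S h u - u) /\<^sub>R h) \<longlongrightarrow> w) (at_right 0)} \<and>
     (\<forall>u\<in>D. ((\<lambda>h. (S h u - u) /\<^sub>R h) \<longlongrightarrow> A u) (at_right 0))"

definition mild_solution ::
  "(L2 ^ 'n::finite) set \<Rightarrow> (L2 ^ 'n) set \<Rightarrow> (L2 ^ 'n \<Rightarrow> L2 ^ 'n) \<Rightarrow> L2 ^ 'n \<Rightarrow> (real \<Rightarrow> L2 ^ 'n) \<Rightarrow> bool"
where
  "mild_solution X D A u0 U \<longleftrightarrow>
     continuous_on {0..} U \<and> (\<forall>t\<ge>0. U t \<in> X) \<and>
     (\<forall>t\<ge>0. \<exists>W\<in>D. (U has_integral W) {0..t} \<and> U t = u0 + A W)"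

definition classical_solution ::
  "(L2 ^ 'n::finite) set \<Rightarrow> (L2 ^ 'n \<Rightarrow> L2 ^ 'n) \<Rightarrow> L2 ^ 'n \<Rightarrow> (real \<Rightarrow> L2 ^ 'n) \<Rightarrow> bool"
where
  "classical_solution D A u0 U \<longleftrightarrow>
     U 0 = u0 \<and> continuous_on {0..} (\<lambda>t. A (U t)) \<and>
     (\<forall>t\<ge>0. U t \<in> D \<and> (U has_vector_derivative A (U t)) (at t within {0..}))"


section \<open>Traces of solutions at the central node\<close>

definition L2_loc :: "(real \<Rightarrow> complex) \<Rightarrow> bool" where
  "L2_loc p \<longleftrightarrow> (\<forall>T>0. set_borel_measurable lebesgue {0..T} p \<and>
     set_integrable lebesgue {0..T} (\<lambda>t. (cmod (p t))\<^sup>2))"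

definition L2_loc_tendsto :: "(nat \<Rightarrow> real \<Rightarrow> complex) \<Rightarrow> (real \<Rightarrow> complex) \<Rightarrow> bool" where
  "L2_loc_tendsto P p \<longleftrightarrow> (\<forall>n. L2_loc (P n)) \<and> L2_loc p \<and>
     (\<forall>T>0. (\<lambda>n. LINT t:{0..T}|lebesgue. (cmod (P n t - p t))\<^sup>2) \<longlonglongrightarrow> 0)"

text \<open>
  \<open>p j\<close> and \<open>q j\<close> are the traces \<open>u\<^sub>j(\<cdot>,0)\<close> and \<open>\<partial>\<^sub>xu\<^sub>j(\<cdot>,0)\<close> of the solution \<open>S t u0\<close>, as limits
  in \<open>L\<^sup>2\<^sub>l\<^sub>o\<^sub>c([0,\<infinity>))\<close> along every sequence of classical solutions whose initial data
  approximate \<open>u0\<close>. The closure condition says that such sequences exist. The limits are unique up to null sets.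
\<close>

definition node_traces ::
  "('n::finite \<Rightarrow> real) \<Rightarrow> (L2 ^ 'n) set \<Rightarrow> (real \<Rightarrow> L2 ^ 'n \<Rightarrow> L2 ^ 'n) \<Rightarrow> L2 ^ 'n \<Rightarrow>
     ('n \<Rightarrow> real \<Rightarrow> complex) \<Rightarrow> ('n \<Rightarrow> real \<Rightarrow> complex) \<Rightarrow> bool"
where
  "node_traces \<l> D S u0 p q \<longleftrightarrow> u0 \<in> closure D \<and>
     (\<forall>v. (\<forall>n. v n \<in> D) \<and> v \<longlonglongrightarrow> u0 \<longrightarrow>
        (\<forall>j. L2_loc_tendsto (\<lambda>n t. pt_value (\<l> j) (S t (v n) $ j) 0) (p j) \<and>
             L2_loc_tendsto (\<lambda>n t. pt_value (\<l> j) (weak_deriv (\<l> j) (S t (v n) $ j)) 0) (q j)))"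

definition dissipation ::
  "'n::finite \<Rightarrow> real \<Rightarrow> ('n \<Rightarrow> complex) \<Rightarrow> ('n \<Rightarrow> complex) \<Rightarrow> real"
where
  "dissipation e1 \<alpha> z w =
     - (\<alpha> - real CARD('n) / 2) * (cmod (z e1))\<^sup>2 - 1/2 * (\<Sum>j\<in>UNIV. (cmod (w j))\<^sup>2)"

end

theory Submission
  imports Defs
begin

text \<open>
  Everything rests on one integration by parts. On an edge with \<open>u(l) = u'(l) = 0\<close> it gives
  \<open>Re (-u' - u''', u) = |u(0)|\<^sup>2/2 + Re (u''(0) cnj (u(0))) - |u'(0)|\<^sup>2/2\<close>, and summing over the edges, with the
  common value of the \<open>u\<^sub>j(0)\<close> and the prescribed sum of the \<open>u\<^sub>j''(0)\<close>, yields
  \<open>Re (A u, u) = -(\<alpha> - N/2) |u\<^sub>1(0)|\<^sup>2 - 1/2 (\<Sum>j. |u\<^sub>j'(0)|\<^sup>2)\<close> on the domain (\<open>op_A_dissipation\<close>).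
  So \<open>A\<close> is dissipative, and two things follow from the size of the right-hand side: a contraction
  semigroup, and control of the traces at the node.

  Maximality (\<open>op_A_range\<close>). On each edge, \<open>u - h A u = f\<close> is a linear third-order equation with constant
  coefficients; factoring its characteristic polynomial reduces it to three first-order equations, each
  solved from the outer end point. The solutions with \<open>u(l) = u'(l) = 0\<close> are \<open>P + s Q\<close> with \<open>Q\<close> a homogeneous
  solution, and the integration by parts above, applied to \<open>Q\<close> alone, shows \<open>Q(0) \<noteq> 0\<close> and
  \<open>Re (Q''(0)/Q(0)) \<ge> -1/2\<close>. The node conditions then become one scalar equation for the common value
  at the node, with coefficient \<open>\<alpha> + (\<Sum>j. Q\<^sub>j''(0)/Q\<^sub>j(0))\<close>, whose real part is at least \<open>\<alpha> - N/2 > 0\<close>.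

  The semigroup. In a Hilbert space a dissipative operator with this range property generates contractions.
  Let \<open>J h\<close> be the inverse of \<open>1 - h A\<close>. Dissipativity makes the norm of \<open>J h f - f\<close> decrease with \<open>h\<close> and bounds the distance
  between two such differences by the decrease, so \<open>J h f\<close> converges as \<open>h\<close> tends to 0; the limit is \<open>f\<close> (\<open>J_tendsto\<close>),
  and the domain is dense. \<open>S t u\<close> is the limit of the implicit Euler schemes with
  step \<open>2\<^sup>-\<^sup>n\<close>: halving the step changes one step by a multiple of its square (\<open>norm_J_halving\<close>), and contractivity
  only adds these errors up. Uniqueness of mild solutions is dissipativity again, applied to the primitive of the
  difference of two solutions.

  The dissipation law. For initial data in the domain it is the formula for \<open>Re (A u, u)\<close>. Integrated in
  time, it bounds the \<open>L\<^sup>2\<close> norms of the traces by the norm of the initial datum, so the traces extend by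
  continuity to all data (\<open>traces_exist\<close>), and \<open>E(t) - E(0)\<close> is the integral of the dissipation rate for all
  data (\<open>energy_identity\<close>). The law holds for almost every \<open>t\<close> because an indefinite integral is
  differentiable almost everywhere, which is proved with Henstock's lemma and a Vitali covering.

  The weak derivatives that define the domain are turned into primitives by the lemma of du Bois-Reymond, so that
  a function of class \<open>H\<^sup>3\<close> becomes a classical function with two continuous derivatives and an integrable third one
  (\<open>H3_rep\<close>); all the calculus is done on that side.
\<close>

section \<open>Maximal dissipative operators and their resolvents\<close>

text \<open>The range condition is required for every step \<open>h\<close>, since the Euler schemes use the steps \<open>2\<^sup>-\<^sup>n\<close>.\<close>

locale maximal_dissipative =
  fixes X D :: "'a::{real_inner,banach} set" and A :: "'a \<Rightarrow> 'a"
  assumes closed_X: "closed X" and subspace_X: "subspace X"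
    and D_subset: "D \<subseteq> X" and subspace_D: "subspace D"
    and A_in: "u \<in> D \<Longrightarrow> A u \<in> X"
    and A_add: "u \<in> D \<Longrightarrow> v \<in> D \<Longrightarrow> A (u + v) = A u + A v"
    and A_scale: "u \<in> D \<Longrightarrow> A (c *\<^sub>R u) = c *\<^sub>R A u"
    and dissipative: "u \<in> D \<Longrightarrow> A u \<bullet> u \<le> 0"
    and resolvent_range: "0 < h \<Longrightarrow> f \<in> X \<Longrightarrow> \<exists>u\<in>D. u - h *\<^sub>R A u = f"
begin

lemma D_in_X: "u \<in> D \<Longrightarrow> u \<in> X"
  using D_subset by auto

lemmas X_intros = subspace_add[OF subspace_X] subspace_diff[OF subspace_X]
  subspace_scale[OF subspace_X] subspace_0[OF subspace_X] subspace_neg[OF subspace_X]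
lemmas D_intros = subspace_add[OF subspace_D] subspace_diff[OF subspace_D]
  subspace_scale[OF subspace_D] subspace_0[OF subspace_D] subspace_neg[OF subspace_D]

lemma A_minus: "u \<in> D \<Longrightarrow> A (- u) = - A u"
  using A_scale[of u "-1"] by simp

lemma A_diff: "u \<in> D \<Longrightarrow> v \<in> D \<Longrightarrow> A (u - v) = A u - A v"
  using A_add[of u "- v"] A_minus[of v] D_intros(5)[of v] by simp

lemma A_zero: "A 0 = 0"
  using A_diff[of 0 0] D_intros(4) by simp

text \<open>Pairing \<open>u - h A u\<close> with \<open>u\<close> and using dissipativity: this gives at once the injectivity of \<open>1 - h A\<close> and
  the contractivity of its inverse.\<close>

lemma norm_le_resolvent:
  assumes "0 \<le> h" "u \<in> D"
  shows "norm u \<le> norm (u - h *\<^sub>R A u)"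
proof (cases "u = 0")
  case False
  have "(norm u)\<^sup>2 \<le> (norm u)\<^sup>2 - h * (A u \<bullet> u)"
    using mult_nonneg_nonpos[OF assms(1) dissipative[OF assms(2)]] by simp
  also have "\<dots> = (u - h *\<^sub>R A u) \<bullet> u"
    by (simp add: inner_diff_left power2_norm_eq_inner)
  also have "\<dots> \<le> norm (u - h *\<^sub>R A u) * norm u"
    by (rule norm_cauchy_schwarz)
  finally show ?thesis
    using False by (simp add: power2_eq_square)
qed simp

definition J :: "real \<Rightarrow> 'a \<Rightarrow> 'a" where
  "J h f = (THE u. u \<in> D \<and> u - h *\<^sub>R A u = f)"

lemma resolvent_unique:
  assumes "0 < h" "u \<in> D" "v \<in> D" "u - h *\<^sub>R A u = v - h *\<^sub>R A v"
  shows "u = v"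
proof -
  have "(u - v) - h *\<^sub>R A (u - v) = 0"
    using assms by (simp add: A_diff algebra_simps)
  then show ?thesis
    using norm_le_resolvent[of h "u - v"] assms D_intros(2) by simp
qed

lemma J_props:
  assumes "0 < h" "f \<in> X"
  shows "J h f \<in> D" "J h f - h *\<^sub>R A (J h f) = f"
proof -
  have "\<exists>!u. u \<in> D \<and> u - h *\<^sub>R A u = f"
    using resolvent_range[OF assms] resolvent_unique[OF assms(1)] by metis
  from theI'[OF this] show "J h f \<in> D" "J h f - h *\<^sub>R A (J h f) = f"
    unfolding J_def by auto
qed

lemma J_in_X: "0 < h \<Longrightarrow> f \<in> X \<Longrightarrow> J h f \<in> X"
  using J_props(1) D_in_X by blast

lemma J_eqI:
  assumes "0 < h" "u \<in> D" "u - h *\<^sub>R A u = f"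
  shows "J h f = u"
proof -
  have "f \<in> X" using assms A_in D_in_X X_intros by metis
  then show ?thesis
    using resolvent_unique[OF assms(1) J_props(1)[OF assms(1)] assms(2)] J_props(2)[OF assms(1)] assms by auto
qed

lemma A_J: "0 < h \<Longrightarrow> f \<in> X \<Longrightarrow> A (J h f) = (1 / h) *\<^sub>R (J h f - f)"
proof -
  assume *: "0 < h" "f \<in> X"
  have "h *\<^sub>R A (J h f) = J h f - f" using J_props(2)[OF *] by (simp add: algebra_simps)
  then have "(1 / h) *\<^sub>R h *\<^sub>R A (J h f) = (1 / h) *\<^sub>R (J h f - f)" by simp
  then show ?thesis using * by simp
qed

lemma J_diff:
  assumes "0 < h" "f \<in> X" "g \<in> X"
  shows "J h (f - g) = J h f - J h g"
  using assms
  by (intro J_eqI) (auto intro: D_intros J_props simp: A_diff J_props A_J algebra_simps)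

lemma J_scale:
  assumes "0 < h" "f \<in> X"
  shows "J h (c *\<^sub>R f) = c *\<^sub>R J h f"
  using assms
  by (intro J_eqI) (auto intro: D_intros J_props simp: A_scale J_props A_J algebra_simps)

lemma norm_J_le: "0 < h \<Longrightarrow> f \<in> X \<Longrightarrow> norm (J h f) \<le> norm f"
  using norm_le_resolvent[OF _ J_props(1), of h h f] J_props(2)[of h f] by auto

lemma J_A:
  assumes "0 < h" "u \<in> D"
  shows "J h (A u) = A (J h u)"
proof -
  have u: "u \<in> X" "A u \<in> X" "h *\<^sub>R A u \<in> X" using assms A_in D_in_X X_intros by auto
  have "u = J h (u - h *\<^sub>R A u)" using J_eqI[OF assms] by simp
  also have "\<dots> = J h u - h *\<^sub>R J h (A u)"
    using assms u by (simp add: J_diff J_scale)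
  finally have "h *\<^sub>R J h (A u) = J h u - u" by (simp add: algebra_simps)
  then have "(1 / h) *\<^sub>R h *\<^sub>R J h (A u) = (1 / h) *\<^sub>R (J h u - u)" by simp
  then show ?thesis using assms u A_J by simp
qed

lemma J_commute:
  assumes "0 < h" "0 < k" "f \<in> X"
  shows "J h (J k f) = J k (J h f)"
proof -
  have 1: "J k f \<in> D" "J k f \<in> X" "A (J k f) \<in> X" "k *\<^sub>R A (J k f) \<in> X"
    using J_props(1)[OF assms(2,3)] D_in_X A_in X_intros(3) by blast+
  have "J h (J k f) - k *\<^sub>R A (J h (J k f)) = J h (J k f - k *\<^sub>R A (J k f))"
    unfolding J_A[OF assms(1) 1(1), symmetric] J_diff[OF assms(1) 1(2,4)] J_scale[OF assms(1) 1(3)] ..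
  also have "\<dots> = J h f" unfolding J_props(2)[OF assms(2,3)] ..
  finally show ?thesis
    by (rule J_eqI[OF assms(2) J_props(1)[OF assms(1) 1(2)], symmetric])
qed

lemma norm_J_diff_le:
  assumes "0 < h" "u \<in> D"
  shows "norm (J h u - u) \<le> h * norm (A u)"
proof -
  have "J h u - u = h *\<^sub>R A (J h u)"
    using assms(1) A_J[OF assms(1) D_in_X[OF assms(2)]] by simp
  then have "norm (J h u - u) = h * norm (J h (A u))"
    using assms(1) J_A[OF assms] by simp
  also have "\<dots> \<le> h * norm (A u)"
    using norm_J_le[OF assms(1) A_in[OF assms(2)]] assms(1) by simp
  finally show ?thesis .
qed

text \<open>Here \<open>w n\<close> equals \<open>A (J (1/n) f) / n\<close>, so dissipativity applied to the difference of two resolvents is an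
  inequality between the Gram matrix entries of \<open>w m\<close> and \<open>w n\<close>. It says more than monotonicity of the norms:
  the drop of the squared norm bounds the distance.\<close>

lemma resolvent_sequence_monotone:
  assumes "0 < m" "m < n" "f \<in> X"
  defines "w \<equiv> \<lambda>n. J (1 / n) f - f"
  shows "(norm (w n - w m))\<^sup>2 \<le> (norm (w m))\<^sup>2 - (norm (w n))\<^sup>2"
proof -
  let ?a = "(norm (w n))\<^sup>2" and ?b = "(norm (w m))\<^sup>2" and ?d = "(norm (w n - w m))\<^sup>2"
  let ?c = "w n \<bullet> w m"
  have n: "0 < 1 / n" "0 < 1 / m" using assms by auto
  have AJ: "A (J (1 / n) f) = n *\<^sub>R w n" "A (J (1 / m) f) = m *\<^sub>R w m"
    unfolding w_def using n assms A_J by auto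
  have D: "J (1 / n) f \<in> D" "J (1 / m) f \<in> D" using n assms J_props by auto
  have "A (J (1 / n) f - J (1 / m) f) \<bullet> (J (1 / n) f - J (1 / m) f) \<le> 0"
    using dissipative D D_intros by blast
  then have "(n *\<^sub>R w n - m *\<^sub>R w m) \<bullet> (w n - w m) \<le> 0"
    using D by (simp add: A_diff AJ) (simp add: w_def)
  then have 1: "n * ?a + m * ?b \<le> (n + m) * ?c"
    by (simp add: inner_diff_left inner_diff_right inner_commute power2_norm_eq_inner algebra_simps)
  have 2: "?d = ?a + ?b - 2 * ?c"
    by (simp add: inner_diff_left inner_diff_right inner_commute power2_norm_eq_inner)
  have "(n + m) * ?d = (n + m) * ?a + (n + m) * ?b - 2 * ((n + m) * ?c)"
    unfolding 2 by (simp add: algebra_simps)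
  also have "\<dots> \<le> (n + m) * ?a + (n + m) * ?b - 2 * (n * ?a + m * ?b)"
    using 1 by (intro diff_left_mono mult_left_mono) auto
  also have "\<dots> = (n - m) * (?b - ?a)" by (simp add: algebra_simps)
  finally have 3: "(n + m) * ?d \<le> (n - m) * (?b - ?a)" .
  have "0 \<le> (n + m) * ?d" using assms by simp
  with 3 have "0 \<le> (n - m) * (?b - ?a)" by linarith
  then have "0 \<le> ?b - ?a" using assms by (simp add: zero_le_mult_iff)
  then have "(n - m) * (?b - ?a) \<le> (n + m) * (?b - ?a)"
    using assms by (intro mult_right_mono) auto
  with 3 have "(n + m) * ?d \<le> (n + m) * (?b - ?a)" by linarith
  then show ?thesis using assms by simp
qed

text \<open>The squared norms of \<open>w n\<close> decrease, hence converge, and their differences bound the distances, so \<open>w\<close> is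
  a Cauchy sequence. Its limit is 0 because \<open>J 1\<close> annihilates it and is injective.\<close>

lemma J_tendsto:
  assumes f: "f \<in> X"
  shows "(\<lambda>n. J (1 / real (Suc n)) f) \<longlonglongrightarrow> f"
proof -
  define w where "w n = J (1 / real (Suc n)) f - f" for n
  have mono: "(norm (w n - w m))\<^sup>2 \<le> (norm (w m))\<^sup>2 - (norm (w n))\<^sup>2" if "m \<le> n" for m n
    using resolvent_sequence_monotone[of "real (Suc m)" "real (Suc n)" f] f that
    by (cases "m = n") (auto simp: w_def)
  have "convergent (\<lambda>n. (norm (w n))\<^sup>2)"
  proof -
    have "decseq (\<lambda>n. (norm (w n))\<^sup>2)"
    proof (rule decseq_SucI)
      show "(norm (w (Suc n)))\<^sup>2 \<le> (norm (w n))\<^sup>2" for n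
        using mono[of n "Suc n"] zero_le_power2[of "norm (w (Suc n) - w n)"] by linarith
    qed
    then show ?thesis
      using decseq_convergent[of "\<lambda>n. (norm (w n))\<^sup>2" 0] by (auto simp: convergent_def)
  qed
  then have "Cauchy (\<lambda>n. (norm (w n))\<^sup>2)" by (rule convergent_Cauchy)
  then have "Cauchy w"
  proof (intro CauchyI)
    fix e :: real assume e: "0 < e"
    from CauchyD[OF \<open>Cauchy (\<lambda>n. (norm (w n))\<^sup>2)\<close>, of "e\<^sup>2"] e
    obtain M where M: "\<And>m n. m \<ge> M \<Longrightarrow> n \<ge> M \<Longrightarrow> \<bar>(norm (w m))\<^sup>2 - (norm (w n))\<^sup>2\<bar> < e\<^sup>2"
      by (metis real_norm_def zero_less_power)
    have le: "norm (w m - w n) < e" if "m \<ge> M" "n \<ge> M" "n \<le> m" for m n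
    proof -
      have "(norm (w m - w n))\<^sup>2 < e\<^sup>2" using mono[OF that(3)] M[OF that(1,2)] by linarith
      then show ?thesis using e by (simp add: power2_less_imp_less)
    qed
    have "norm (w m - w n) < e" if "m \<ge> M" "n \<ge> M" for m n
      using le[of m n] le[of n m] that by (cases "n \<le> m") (auto simp: norm_minus_commute)
    then show "\<exists>M. \<forall>m\<ge>M. \<forall>n\<ge>M. norm (w m - w n) < e" by blast
  qed
  then obtain w0 where w0: "w \<longlonglongrightarrow> w0" using Cauchy_convergent_iff convergent_def by blast
  have wX: "w n \<in> X" for n unfolding w_def using f by (intro X_intros J_in_X) auto
  then have w0X: "w0 \<in> X" using closed_X w0 closed_sequentially by blast
  define g where "g = J 1 f"
  have g: "g \<in> D" using f J_props g_def by simp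
  have Jw: "J 1 (w n) = J (1 / real (Suc n)) g - g" for n
    unfolding w_def g_def using f by (subst J_diff) (auto intro: J_in_X J_commute)
  \<comment> \<open>Moving \<open>J 1\<close> inside replaces \<open>f\<close> by \<open>g\<close>, which lies in the domain, and there the convergence has a rate.\<close>
  have "(\<lambda>n. J 1 (w n)) \<longlonglongrightarrow> 0"
  proof (rule Lim_null_comparison)
    show "\<forall>\<^sub>F n in sequentially. norm (J 1 (w n)) \<le> 1 / real (Suc n) * norm (A g)"
    proof (intro always_eventually allI)
      show "norm (J 1 (w n)) \<le> 1 / real (Suc n) * norm (A g)" for n
        unfolding Jw by (rule norm_J_diff_le[OF _ g]) simp
    qed
    show "(\<lambda>n. 1 / real (Suc n) * norm (A g)) \<longlonglongrightarrow> 0"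
      using tendsto_mult_left_zero[OF LIMSEQ_inverse_real_of_nat, of "norm (A g)"]
      by (simp add: inverse_eq_divide)
  qed
  moreover have "(\<lambda>n. J 1 (w n)) \<longlonglongrightarrow> J 1 w0"
  proof (rule LIM_zero_cancel, rule Lim_null_comparison)
    show "\<forall>\<^sub>F n in sequentially. norm (J 1 (w n) - J 1 w0) \<le> norm (w n - w0)"
    proof (intro always_eventually allI)
      show "norm (J 1 (w n) - J 1 w0) \<le> norm (w n - w0)" for n
        using norm_J_le[of 1 "w n - w0"] wX w0X by (simp add: J_diff X_intros)
    qed
    show "(\<lambda>n. norm (w n - w0)) \<longlonglongrightarrow> 0" using w0 by (simp add: LIM_zero tendsto_norm_zero)
  qed
  ultimately have "J 1 w0 = 0" using LIMSEQ_unique by blast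
  then have "0 - A 0 = w0" using J_props(2)[of 1 w0] w0X by simp
  then have "w0 = 0" by (simp add: A_zero)
  have "(\<lambda>n. w n + f) \<longlonglongrightarrow> 0 + f"
    using w0 unfolding \<open>w0 = 0\<close> by (intro tendsto_add tendsto_const)
  then show ?thesis unfolding w_def by simp
qed

text \<open>The domain of the square of \<open>A\<close>, on which the Euler schemes converge at a rate.\<close>

definition D2 :: "'a set" where "D2 = {u. u \<in> D \<and> A u \<in> D}"

lemma J_in_D2: "0 < h \<Longrightarrow> u \<in> D \<Longrightarrow> J h u \<in> D2"
proof -
  assume h: "0 < h" and u: "u \<in> D"
  have "J h u \<in> D" by (rule J_props(1)[OF h D_in_X[OF u]])
  moreover have "A (J h u) \<in> D" unfolding J_A[OF h u, symmetric] by (rule J_props(1)[OF h A_in[OF u]])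
  ultimately show ?thesis unfolding D2_def by blast
qed

lemma J_small:
  assumes "f \<in> X" "0 < e"
  obtains h where "0 < h" "norm (J h f - f) < e"
proof -
  obtain n where "\<forall>m\<ge>n. norm (J (1 / real (Suc m)) f - f) < e"
    by (rule exE[OF LIMSEQ_D[OF J_tendsto[OF assms(1)] assms(2)]])
  then have "norm (J (1 / real (Suc n)) f - f) < e" by blast
  moreover have "0 < 1 / real (Suc n)" by simp
  ultimately show thesis by (intro that)
qed

lemma dense_D:
  assumes "f \<in> X" "0 < e"
  obtains u where "u \<in> D" "norm (u - f) < e"
proof -
  obtain h where h: "0 < h" "norm (J h f - f) < e" by (rule J_small[OF assms])
  then show thesis using that[OF J_props(1)[OF h(1) assms(1)]] by blast
qed

lemma dense_D2:
  assumes "f \<in> X" "0 < e"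
  obtains u where "u \<in> D2" "norm (u - f) < e"
proof -
  have e: "0 < e / 2" using assms by simp
  obtain v where v: "v \<in> D" "norm (v - f) < e / 2" by (rule dense_D[OF assms(1) e])
  obtain h where h: "0 < h" "norm (J h v - v) < e / 2" by (rule J_small[OF D_in_X[OF v(1)] e])
  have "norm (J h v - f) < e"
    using norm_triangle_ineq[of "J h v - v" "v - f"] h v by simp
  then show thesis using that[OF J_in_D2[OF h(1) v(1)]] by blast
qed

lemma D_subset_closure: "X \<subseteq> closure D"
proof
  fix f assume f: "f \<in> X"
  have "\<exists>u\<in>D. dist u f < e" if "0 < e" for e
    using dense_D[OF f that] unfolding dist_norm by metis
  then show "f \<in> closure D" unfolding closure_approachable by blast
qed

lemma Jn_in_X: "0 < h \<Longrightarrow> u \<in> X \<Longrightarrow> (J h ^^ m) u \<in> X"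
  by (induction m) (auto intro: J_in_X)

lemma Jn_in_D: "0 < h \<Longrightarrow> u \<in> D \<Longrightarrow> (J h ^^ m) u \<in> D"
  by (induction m) (auto intro: J_props D_in_X)

lemma Jn_diff: "0 < h \<Longrightarrow> u \<in> X \<Longrightarrow> v \<in> X \<Longrightarrow> (J h ^^ m) (u - v) = (J h ^^ m) u - (J h ^^ m) v"
  by (induction m) (auto simp: J_diff Jn_in_X)

lemma norm_Jn_le: "0 < h \<Longrightarrow> u \<in> X \<Longrightarrow> norm ((J h ^^ m) u) \<le> norm u"
  by (induction m) (auto intro: order_trans[OF norm_J_le] Jn_in_X)

lemma Jn_A: "0 < h \<Longrightarrow> u \<in> D \<Longrightarrow> (J h ^^ m) (A u) = A ((J h ^^ m) u)"
  by (induction m) (auto simp: J_A Jn_in_D)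

lemma Jn_J: "0 < h \<Longrightarrow> 0 < k \<Longrightarrow> u \<in> X \<Longrightarrow> (J h ^^ m) (J k u) = J k ((J h ^^ m) u)"
  by (induction m) (auto simp: J_commute Jn_in_X)

lemma norm_J_Jn_diff_le:
  assumes "0 < h" "u \<in> D"
  shows "norm (J h ((J h ^^ m) u) - (J h ^^ m) u) \<le> h * norm (A u)"
proof -
  have "J h ((J h ^^ m) u) - (J h ^^ m) u = (J h ^^ m) (J h u - u)"
    using assms by (simp add: Jn_diff Jn_J J_in_X D_in_X)
  then show ?thesis
    using norm_Jn_le[OF assms(1), of "J h u - u" m] norm_J_diff_le[OF assms] assms
    by (simp add: X_intros J_in_X D_in_X)
qed

lemma norm_Jn_diff_le:
  assumes "0 < h" "u \<in> D"
  shows "norm ((J h ^^ m) u - u) \<le> (real m * h) * norm (A u)"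
proof (induction m)
  case (Suc m)
  have "norm ((J h ^^ Suc m) u - u) \<le> norm (J h ((J h ^^ m) u) - (J h ^^ m) u) + norm ((J h ^^ m) u - u)"
    using norm_triangle_ineq[of "J h ((J h ^^ m) u) - (J h ^^ m) u" "(J h ^^ m) u - u"] by simp
  then show ?case using Suc norm_J_Jn_diff_le[OF assms, of m] by (simp add: algebra_simps)
qed simp

lemma norm_Jn_diff_le_X:
  assumes "0 < h" "v \<in> X" "w \<in> D" "real m * h \<le> t"
  shows "norm ((J h ^^ m) v - v) \<le> 2 * norm (v - w) + t * norm (A w)"
proof -
  have "(J h ^^ m) v - v = ((J h ^^ m) (v - w) - (v - w)) + ((J h ^^ m) w - w)"
    using assms by (simp add: Jn_diff D_in_X)
  also have "norm \<dots> \<le> norm ((J h ^^ m) (v - w)) + norm (v - w) + norm ((J h ^^ m) w - w)"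
    by (meson norm_triangle_ineq norm_triangle_ineq4 order_trans add_mono order_refl)
  also have "\<dots> \<le> norm (v - w) + norm (v - w) + t * norm (A w)"
    using assms norm_Jn_le[of h "v - w" m] order_trans[OF norm_Jn_diff_le[of h w m] mult_right_mono[OF assms(4)]]
    by (intro add_mono) (auto intro: X_intros D_in_X)
  finally show ?thesis by simp
qed

text \<open>Summing \<open>J h v - v = h A (J h v)\<close> along the scheme, only the oscillation of the iterates of \<open>A u\<close> enters.
  The free element \<open>w\<close> of the domain approximates \<open>A u\<close>, so that no second power of \<open>A\<close> is applied to \<open>u\<close>.\<close>

lemma norm_Jn_taylor:
  assumes "0 < h" "u \<in> D" "w \<in> D" "real m * h \<le> t"
  shows "norm ((J h ^^ m) u - u - (real m * h) *\<^sub>R A u) \<le> (real m * h) * (2 * norm (A u - w) + t * norm (A w))"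
  using assms(4)
proof (induction m)
  case (Suc m)
  have m: "real m * h \<le> t" using Suc.prems assms(1) by (simp add: algebra_simps)
  have "J h ((J h ^^ m) u) - (J h ^^ m) u = h *\<^sub>R A (J h ((J h ^^ m) u))"
    using assms by (simp add: A_J Jn_in_X D_in_X)
  also have "\<dots> = h *\<^sub>R (J h ^^ Suc m) (A u)"
    using Jn_A[OF assms(1,2), of "Suc m"] by simp
  finally have eq: "(J h ^^ Suc m) u - u - (real (Suc m) * h) *\<^sub>R A u
      = ((J h ^^ m) u - u - (real m * h) *\<^sub>R A u) + h *\<^sub>R ((J h ^^ Suc m) (A u) - A u)"
    by (simp add: algebra_simps)
  have "norm (h *\<^sub>R ((J h ^^ Suc m) (A u) - A u)) \<le> h * (2 * norm (A u - w) + t * norm (A w))"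
    using norm_Jn_diff_le_X[OF assms(1) A_in[OF assms(2)] assms(3) Suc.prems] assms(1)
    by (simp del: funpow.simps)
  with Suc.IH[OF m] show ?case
    unfolding eq
    by (intro order_trans[OF norm_triangle_ineq]) (simp add: algebra_simps del: funpow.simps)
qed simp

text \<open>With \<open>w = J k (J k u)\<close>, the identity \<open>(1 - k A)\<^sup>2 w = u\<close> differs from \<open>(1 - 2 k A) w = u\<close> by \<open>k\<^sup>2 A\<^sup>2 w\<close> only.\<close>

lemma norm_J_halving:
  assumes "0 < k" "u \<in> D2"
  shows "norm (J (2 * k) u - J k (J k u)) \<le> k\<^sup>2 * norm (A (A u))"
proof -
  have u: "u \<in> D" "A u \<in> D" "u \<in> X" "A u \<in> X" "A (A u) \<in> X"
    using assms A_in D_in_X unfolding D2_def by auto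
  define w where "w = J k (J k u)"
  have wD: "w \<in> D" "w \<in> X" unfolding w_def using u assms by (auto intro: J_props J_in_X)
  have Aw: "A w = J k (J k (A u))" "A w \<in> D" "A (A w) = J k (J k (A (A u)))" "A (A w) \<in> X"
    unfolding w_def using u assms by (auto simp: J_A[symmetric] J_props D_in_X J_in_X)
  have 1: "J k u = w - k *\<^sub>R A w" unfolding w_def using u assms J_props(2)[of k "J k u"] by (simp add: J_in_X)
  have "u = J k u - k *\<^sub>R A (J k u)" using u assms J_props(2)[of k u] by simp
  also have "\<dots> = w - (2 * k) *\<^sub>R A w + k\<^sup>2 *\<^sub>R A (A w)"
    unfolding 1 using wD Aw by (simp add: A_diff A_scale D_intros algebra_simps power2_eq_square scaleR_2 flip: scaleR_scaleR)
  finally have "w - (2 * k) *\<^sub>R A w = u - k\<^sup>2 *\<^sub>R A (A w)" by simp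
  then have "J (2 * k) (u - k\<^sup>2 *\<^sub>R A (A w)) = w"
    using J_eqI[of "2 * k" w] wD assms by simp
  then have "J (2 * k) u - w = k\<^sup>2 *\<^sub>R J (2 * k) (A (A w))"
    using assms u Aw by (simp add: J_diff J_scale X_intros algebra_simps)
  moreover have "norm (J (2 * k) (A (A w))) \<le> norm (A (A u))"
    using norm_J_le[of "2 * k" "A (A w)"] norm_J_le[of k "J k (A (A u))"] norm_J_le[of k "A (A u)"] u assms Aw
    by (simp add: J_in_X)
  ultimately show ?thesis unfolding w_def by (simp add: mult_left_mono)
qed

text \<open>The resolvents commute and are contractions, so the errors of the single steps add up.\<close>

lemma norm_Jn_halving:
  assumes "0 < k" "u \<in> D2"
  shows "norm ((J (2 * k) ^^ m) u - (J k ^^ (2 * m)) u) \<le> real m * (k\<^sup>2 * norm (A (A u)))"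
proof (induction m)
  case (Suc m)
  have u: "u \<in> X" using assms D_in_X unfolding D2_def by auto
  have k2: "0 < 2 * k" using assms by simp
  have eq: "(J (2 * k) ^^ Suc m) u - (J k ^^ (2 * Suc m)) u
      = (J (2 * k) ^^ m) (J (2 * k) u - J k (J k u)) + J k (J k ((J (2 * k) ^^ m) u - (J k ^^ (2 * m)) u))"
    using assms u k2
    by (simp add: Jn_diff J_diff Jn_J J_in_X Jn_in_X)
  have "norm ((J (2 * k) ^^ m) (J (2 * k) u - J k (J k u))) \<le> norm (J (2 * k) u - J k (J k u))"
    using assms u k2 by (intro norm_Jn_le X_intros J_in_X)
  moreover have "norm (J k (J k ((J (2 * k) ^^ m) u - (J k ^^ (2 * m)) u))) \<le> norm ((J (2 * k) ^^ m) u - (J k ^^ (2 * m)) u)"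
    using assms u k2 by (intro order_trans[OF norm_J_le norm_J_le] X_intros J_in_X Jn_in_X)
  ultimately show ?case
    using Suc norm_J_halving[OF assms] unfolding eq
    by (intro order_trans[OF norm_triangle_ineq]) (simp add: algebra_simps)
qed simp

end

section \<open>The semigroup as a limit of implicit Euler schemes\<close>

lemma step_pos: "0 < 1 / (2::real) ^ n" by simp

lemma steps_le:
  fixes t :: real
  assumes "0 \<le> t"
  shows "real (nat \<lfloor>t * 2 ^ n\<rfloor>) * (1 / 2 ^ n) \<le> t" "t - 1 / 2 ^ n \<le> real (nat \<lfloor>t * 2 ^ n\<rfloor>) * (1 / 2 ^ n)"
proof -
  have r: "real (nat \<lfloor>t * 2 ^ n\<rfloor>) = of_int \<lfloor>t * 2 ^ n\<rfloor>" using assms by simp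
  show "real (nat \<lfloor>t * 2 ^ n\<rfloor>) * (1 / 2 ^ n) \<le> t"
    unfolding r using of_int_floor_le[of "t * 2 ^ n"] by (simp add: field_simps)
  have "t * 2 ^ n - 1 \<le> of_int \<lfloor>t * 2 ^ n\<rfloor>" by linarith
  then show "t - 1 / 2 ^ n \<le> real (nat \<lfloor>t * 2 ^ n\<rfloor>) * (1 / 2 ^ n)"
    unfolding r using divide_right_mono[of "t * 2 ^ n - 1" "of_int \<lfloor>t * 2 ^ n\<rfloor>" "2 ^ n"]
    by (simp add: diff_divide_distrib)
qed

lemma steps_tendsto:
  fixes t :: real
  assumes "0 \<le> t"
  shows "(\<lambda>n. real (nat \<lfloor>t * 2 ^ n\<rfloor>) * (1 / 2 ^ n)) \<longlonglongrightarrow> t"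
proof (rule tendsto_sandwich)
  have "(\<lambda>n. (1 / 2) ^ n) \<longlonglongrightarrow> (0::real)" by (rule LIMSEQ_realpow_zero) auto
  then have "(\<lambda>n. t - (1 / 2) ^ n) \<longlonglongrightarrow> t - 0" by (intro tendsto_diff tendsto_const)
  then show "(\<lambda>n. t - 1 / 2 ^ n) \<longlonglongrightarrow> t" by (simp add: power_one_over)
qed (use steps_le[OF assms] in auto)

lemma small_multiple:
  fixes c e :: real
  assumes "0 \<le> c" "0 < e"
  obtains d where "0 < d" "\<And>t. t < d \<Longrightarrow> t * c \<le> e"
proof (rule that)
  show "0 < e / (c + 1)" using assms by simp
  show "t * c \<le> e" if "t < e / (c + 1)" for t
  proof -
    have "t * (c + 1) < e" using that assms by (simp add: pos_less_divide_eq)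
    then show ?thesis
      using assms mult_nonpos_nonneg[of t c] by (cases "0 \<le> t") (auto simp: algebra_simps)
  qed
qed

context maximal_dissipative
begin

definition euler :: "nat \<Rightarrow> real \<Rightarrow> 'a \<Rightarrow> 'a" where
  "euler n t u = (J (1 / 2 ^ n) ^^ nat \<lfloor>t * 2 ^ n\<rfloor>) u"

definition S :: "real \<Rightarrow> 'a \<Rightarrow> 'a" where
  "S t u = lim (\<lambda>n. euler n t u)"

lemma euler_in_X: "u \<in> X \<Longrightarrow> euler n t u \<in> X"
  unfolding euler_def by (rule Jn_in_X[OF step_pos])

lemma euler_diff: "u \<in> X \<Longrightarrow> v \<in> X \<Longrightarrow> euler n t (u - v) = euler n t u - euler n t v"
  unfolding euler_def by (rule Jn_diff[OF step_pos])

lemma norm_euler_le: "u \<in> X \<Longrightarrow> norm (euler n t u) \<le> norm u"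
  unfolding euler_def by (rule norm_Jn_le[OF step_pos])

lemma norm_euler_diff_le: "u \<in> X \<Longrightarrow> v \<in> X \<Longrightarrow> norm (euler n t u - euler n t v) \<le> norm (u - v)"
  using norm_euler_le[of "u - v" n t] by (simp add: euler_diff X_intros)

text \<open>The number of steps of length \<open>2\<^sup>-\<^sup>n\<^sup>-\<^sup>1\<close> up to time \<open>t\<close> is twice the number of the longer ones, or one more.
  The additional step costs at most its length times \<open>norm (A u)\<close>.\<close>

lemma norm_euler_step:
  assumes "0 \<le> t" "u \<in> D2"
  shows "norm (euler (Suc n) t u - euler n t u) \<le> (t * norm (A (A u)) + norm (A u)) * (1 / 2) ^ n"
proof -
  define k :: real where "k = 1 / 2 ^ Suc n"
  define m where "m = nat \<lfloor>t * 2 ^ n\<rfloor>"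
  have k: "0 < k" "2 * k = 1 / 2 ^ n" unfolding k_def by auto
  have u: "u \<in> D" "u \<in> X" using assms D_in_X unfolding D2_def by auto
  have "0 \<le> \<lfloor>t * 2 ^ n\<rfloor>" using assms by simp
  moreover have "\<lfloor>t * 2 ^ Suc n\<rfloor> = 2 * \<lfloor>t * 2 ^ n\<rfloor> \<or> \<lfloor>t * 2 ^ Suc n\<rfloor> = 2 * \<lfloor>t * 2 ^ n\<rfloor> + 1"
  proof -
    have "t * 2 ^ Suc n = 2 * (t * 2 ^ n)" by simp
    then show ?thesis by linarith
  qed
  ultimately have m': "nat \<lfloor>t * 2 ^ Suc n\<rfloor> = 2 * m \<or> nat \<lfloor>t * 2 ^ Suc n\<rfloor> = Suc (2 * m)"
    unfolding m_def by (auto simp del: power_Suc zero_le_floor)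
  have 1: "norm (euler (Suc n) t u - (J k ^^ (2 * m)) u) \<le> k * norm (A u)"
    using m'
  proof
    assume "nat \<lfloor>t * 2 ^ Suc n\<rfloor> = 2 * m"
    then have "euler (Suc n) t u = (J k ^^ (2 * m)) u" unfolding euler_def k_def by metis
    then show ?thesis using k by simp
  next
    assume "nat \<lfloor>t * 2 ^ Suc n\<rfloor> = Suc (2 * m)"
    then have "euler (Suc n) t u = (J k ^^ Suc (2 * m)) u" unfolding euler_def k_def by metis
    then show ?thesis using norm_J_Jn_diff_le[OF k(1) u(1), of "2 * m"] by simp
  qed
  have "euler n t u = (J (2 * k) ^^ m) u" unfolding euler_def m_def k(2) ..
  then have 2: "norm ((J k ^^ (2 * m)) u - euler n t u) \<le> real m * (k\<^sup>2 * norm (A (A u)))"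
    using norm_Jn_halving[OF k(1) assms(2), of m] by (simp add: norm_minus_commute)
  have "real m * (2 * k) \<le> t" using steps_le(1)[OF assms(1), of n] unfolding m_def k(2) .
  then have "(real m * (2 * k)) * (k * norm (A (A u))) \<le> t * (k * norm (A (A u)))"
    using k by (intro mult_right_mono) auto
  moreover have "0 \<le> real m * (k\<^sup>2 * norm (A (A u)))" by simp
  ultimately have 3: "real m * (k\<^sup>2 * norm (A (A u))) \<le> t * (k * norm (A (A u)))"
    by (simp add: power2_eq_square algebra_simps)
  have "norm (euler (Suc n) t u - euler n t u)
      \<le> norm (euler (Suc n) t u - (J k ^^ (2 * m)) u) + norm ((J k ^^ (2 * m)) u - euler n t u)"
    using norm_triangle_ineq[of "euler (Suc n) t u - (J k ^^ (2 * m)) u" "(J k ^^ (2 * m)) u - euler n t u"] by simp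
  also have "\<dots> \<le> k * (t * norm (A (A u)) + norm (A u))"
    using 1 2 3 by (simp add: algebra_simps)
  also have "\<dots> \<le> (2 * k) * (t * norm (A (A u)) + norm (A u))"
    using k assms by (intro mult_right_mono) auto
  finally show ?thesis unfolding k(2) by (simp add: power_one_over mult.commute)
qed

lemma euler_convergent_D2:
  assumes "0 \<le> t" "u \<in> D2"
  shows "convergent (\<lambda>n. euler n t u)"
proof -
  have "summable (\<lambda>n. euler (Suc n) t u - euler n t u)"
  proof (rule summable_comparison_test')
    show "summable (\<lambda>n. (t * norm (A (A u)) + norm (A u)) * (1 / 2) ^ n)"
      by (intro summable_mult summable_geometric) simp
    show "norm (euler (Suc n) t u - euler n t u) \<le> (t * norm (A (A u)) + norm (A u)) * (1 / 2) ^ n"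
      if "0 \<le> n" for n
      by (rule norm_euler_step[OF assms])
  qed
  then have "convergent (\<lambda>n. \<Sum>i<n. euler (Suc i) t u - euler i t u)"
    by (simp add: summable_iff_convergent)
  then have "convergent (\<lambda>n. euler n t u - euler 0 t u)"
    by (simp only: sum_lessThan_telescope[of "\<lambda>n. euler n t u"])
  then have "convergent (\<lambda>n. (euler n t u - euler 0 t u) + euler 0 t u)"
    by (intro convergent_add convergent_const)
  then show ?thesis by simp
qed

lemma euler_tendsto:
  assumes "0 \<le> t" "u \<in> X"
  shows "(\<lambda>n. euler n t u) \<longlonglongrightarrow> S t u"
proof -
  have "Cauchy (\<lambda>n. euler n t u)"
  proof (rule CauchyI)
    fix e :: real assume "0 < e"
    then have e: "0 < e / 3" by simp
    obtain w where w: "w \<in> D2" "norm (w - u) < e / 3" by (rule dense_D2[OF assms(2) e])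
    have wX: "w \<in> X" using w D_in_X unfolding D2_def by auto
    obtain M where M: "\<forall>m\<ge>M. \<forall>n\<ge>M. norm (euler m t w - euler n t w) < e / 3"
      using CauchyD[OF convergent_Cauchy[OF euler_convergent_D2[OF assms(1) w(1)]] e] by blast
    have d: "norm (euler n t w - euler n t u) < e / 3" for n
      using norm_euler_diff_le[OF wX assms(2), of n t] w(2) by linarith
    have "norm (euler m t u - euler n t u) < e" if "m \<ge> M" "n \<ge> M" for m n
    proof -
      have "euler m t u - euler n t u = (euler m t w - euler n t w) - (euler m t w - euler m t u) + (euler n t w - euler n t u)" by simp
      also have "norm \<dots> \<le> norm (euler m t w - euler n t w) + norm (euler m t w - euler m t u) + norm (euler n t w - euler n t u)"
        by (meson norm_triangle_ineq norm_triangle_ineq4 order_trans add_mono order_refl)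
      also have "\<dots> < e" using M that d[of m] d[of n] by fastforce
      finally show ?thesis .
    qed
    then show "\<exists>M. \<forall>m\<ge>M. \<forall>n\<ge>M. norm (euler m t u - euler n t u) < e" by blast
  qed
  then show ?thesis
    unfolding S_def by (simp add: Cauchy_convergent_iff convergent_LIMSEQ_iff)
qed

lemma S_in_X: "0 \<le> t \<Longrightarrow> u \<in> X \<Longrightarrow> S t u \<in> X"
  by (rule closed_sequentially[OF closed_X _ euler_tendsto]) (auto intro: euler_in_X)

lemma S_zero:
  assumes "u \<in> X" shows "S 0 u = u"
  unfolding S_def euler_def by (simp add: limI)

lemma S_diff:
  assumes "0 \<le> t" "u \<in> X" "v \<in> X" shows "S t (u - v) = S t u - S t v"
proof (rule LIMSEQ_unique[OF euler_tendsto])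
  show "(\<lambda>n. euler n t (u - v)) \<longlonglongrightarrow> S t u - S t v"
    unfolding euler_diff[OF assms(2,3)] using assms by (intro tendsto_diff euler_tendsto)
qed (use assms X_intros in auto)

lemma S_add:
  assumes "0 \<le> t" "u \<in> X" "v \<in> X" shows "S t (u + v) = S t u + S t v"
  using S_diff[OF assms(1) X_intros(1)[OF assms(2,3)] assms(3)] by (simp add: algebra_simps)

lemma norm_S_le:
  assumes "0 \<le> t" "u \<in> X" shows "norm (S t u) \<le> norm u"
  by (rule LIMSEQ_le_const2[OF tendsto_norm[OF euler_tendsto[OF assms]]])
     (use norm_euler_le[OF assms(2)] in auto)

text \<open>Used for \<open>M = J h\<close>, which gives the invariance of the domain, and for multiplication by scalars, in
  particular complex ones, of which the abstract setting over the reals knows nothing.\<close>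

lemma S_commute_operator:
  assumes M: "\<And>u. u \<in> X \<Longrightarrow> M u \<in> X" "\<And>u v. u \<in> X \<Longrightarrow> v \<in> X \<Longrightarrow> M (u - v) = M u - M v"
    "\<And>u. u \<in> X \<Longrightarrow> norm (M u) \<le> C * norm u"
    and comm: "\<And>h u. 0 < h \<Longrightarrow> u \<in> X \<Longrightarrow> J h (M u) = M (J h u)"
    and t: "0 \<le> t" "u \<in> X"
  shows "S t (M u) = M (S t u)"
proof (rule LIMSEQ_unique[OF euler_tendsto])
  have Jn: "(J h ^^ m) (M u) = M ((J h ^^ m) u)" if "0 < h" for h m
    using that t by (induction m) (auto simp: comm Jn_in_X)
  have "(\<lambda>n. M (euler n t u)) \<longlonglongrightarrow> M (S t u)"
  proof (rule LIM_zero_cancel, rule Lim_null_comparison)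
    show "\<forall>\<^sub>F n in sequentially. norm (M (euler n t u) - M (S t u)) \<le> C * norm (euler n t u - S t u)"
    proof (intro always_eventually allI)
      show "norm (M (euler n t u) - M (S t u)) \<le> C * norm (euler n t u - S t u)" for n
        using M(3)[of "euler n t u - S t u"] M(2)[of "euler n t u" "S t u"] t
        by (simp add: euler_in_X S_in_X X_intros)
    qed
    have "(\<lambda>n. euler n t u - S t u) \<longlonglongrightarrow> 0" using euler_tendsto[OF t] by (simp add: LIM_zero)
    then show "(\<lambda>n. C * norm (euler n t u - S t u)) \<longlonglongrightarrow> 0"
      by (intro tendsto_mult_right_zero tendsto_norm_zero)
  qed
  then show "(\<lambda>n. euler n t (M u)) \<longlonglongrightarrow> M (S t u)"
    unfolding euler_def by (subst Jn) auto
qed (use t M in auto)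

lemma S_J:
  assumes "0 < h" "0 \<le> t" "u \<in> X" shows "S t (J h u) = J h (S t u)"
  by (rule S_commute_operator[where C = 1])
     (use assms in \<open>auto intro: J_in_X J_diff norm_J_le J_commute\<close>)

text \<open>Since \<open>u = J 1 (u - A u)\<close> and \<open>S t\<close> commutes with \<open>J 1\<close>.\<close>

lemma S_in_D:
  assumes "0 \<le> t" "u \<in> D"
  shows "S t u \<in> D" "A (S t u) = S t (A u)"
proof -
  define f where "f = u - A u"
  have fX: "f \<in> X" "u \<in> X" "A u \<in> X" unfolding f_def using assms A_in D_in_X X_intros by auto
  have "u = J 1 f" using J_eqI[of 1 u f] assms by (simp add: f_def)
  then have *: "S t u = J 1 (S t f)" using S_J[of 1 t f] assms fX by simp
  show "S t u \<in> D" unfolding * using S_in_X[OF assms(1) fX(1)] by (intro J_props) auto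
  have "A (S t u) = S t u - S t f"
    unfolding * using A_J[of 1 "S t f"] S_in_X[OF assms(1) fX(1)] by simp
  also have "\<dots> = S t (u - f)" using S_diff[OF assms(1) fX(2,1)] ..
  finally show "A (S t u) = S t (A u)" by (simp add: f_def)
qed

lemma norm_euler_diff_self_le:
  assumes "0 \<le> t" "u \<in> X" "w \<in> D"
  shows "norm (euler n t u - u) \<le> 2 * norm (u - w) + t * norm (A w)"
  unfolding euler_def by (rule norm_Jn_diff_le_X[OF step_pos assms(2,3) steps_le(1)[OF assms(1)]])

lemma norm_S_diff_self_le:
  assumes "0 \<le> t" "u \<in> X" "w \<in> D"
  shows "norm (S t u - u) \<le> 2 * norm (u - w) + t * norm (A w)"
proof (rule LIMSEQ_le_const2)
  show "(\<lambda>n. norm (euler n t u - u)) \<longlonglongrightarrow> norm (S t u - u)"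
    using assms by (intro tendsto_intros euler_tendsto)
qed (use norm_euler_diff_self_le[OF assms] in auto)

text \<open>Rounding \<open>s\<close> and \<open>t\<close> separately to multiples of the step may lose one step compared with \<open>s + t\<close>.\<close>

lemma norm_euler_semigroup:
  assumes "0 \<le> s" "0 \<le> t" "u \<in> D"
  shows "norm (euler n (s + t) u - euler n s (euler n t u)) \<le> (1 / 2 ^ n) * norm (A u)"
proof -
  define a where "a = nat \<lfloor>s * 2 ^ n\<rfloor>"
  define b where "b = nat \<lfloor>t * 2 ^ n\<rfloor>"
  define h :: real where "h = 1 / 2 ^ n"
  have nn: "0 \<le> \<lfloor>s * 2 ^ n\<rfloor>" "0 \<le> \<lfloor>t * 2 ^ n\<rfloor>" using assms by auto
  have "\<lfloor>(s + t) * 2 ^ n\<rfloor> = \<lfloor>s * 2 ^ n\<rfloor> + \<lfloor>t * 2 ^ n\<rfloor> \<or> \<lfloor>(s + t) * 2 ^ n\<rfloor> = \<lfloor>s * 2 ^ n\<rfloor> + \<lfloor>t * 2 ^ n\<rfloor> + 1"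
  proof -
    have "(s + t) * 2 ^ n = s * 2 ^ n + t * 2 ^ n" by (simp add: algebra_simps)
    then show ?thesis by linarith
  qed
  then have "nat \<lfloor>(s + t) * 2 ^ n\<rfloor> = a + b \<or> nat \<lfloor>(s + t) * 2 ^ n\<rfloor> = Suc (a + b)"
    using nn unfolding a_def b_def by linarith
  then have "euler n (s + t) u = (J h ^^ (a + b)) u \<or> euler n (s + t) u = J h ((J h ^^ (a + b)) u)"
    unfolding euler_def h_def by auto
  moreover have "euler n s (euler n t u) = (J h ^^ (a + b)) u"
    unfolding euler_def a_def b_def h_def by (simp add: funpow_add)
  ultimately show ?thesis
    using norm_J_Jn_diff_le[OF step_pos[of n] assms(3), of "a + b"] unfolding h_def by auto
qed

lemma S_semigroup_D:
  assumes "0 \<le> s" "0 \<le> t" "u \<in> D"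
  shows "S (s + t) u = S s (S t u)"
proof -
  have u: "u \<in> X" "S t u \<in> X" using assms D_in_X S_in_X by auto
  have 1: "(\<lambda>n. euler n (s + t) u - euler n s (euler n t u)) \<longlonglongrightarrow> 0"
  proof (rule Lim_null_comparison)
    show "\<forall>\<^sub>F n in sequentially. norm (euler n (s + t) u - euler n s (euler n t u)) \<le> (1 / 2) ^ n * norm (A u)"
      using norm_euler_semigroup[OF assms] by (simp add: power_one_over)
    show "(\<lambda>n. (1 / 2) ^ n * norm (A u)) \<longlonglongrightarrow> 0"
      by (intro tendsto_mult_left_zero LIMSEQ_realpow_zero) auto
  qed
  have 2: "(\<lambda>n. euler n s (euler n t u) - euler n s (S t u)) \<longlonglongrightarrow> 0"
  proof (rule Lim_null_comparison)
    show "\<forall>\<^sub>F n in sequentially. norm (euler n s (euler n t u) - euler n s (S t u)) \<le> norm (euler n t u - S t u)"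
      using norm_euler_diff_le u euler_in_X by simp
    show "(\<lambda>n. norm (euler n t u - S t u)) \<longlonglongrightarrow> 0"
      using euler_tendsto[OF assms(2) u(1)] by (intro tendsto_norm_zero LIM_zero)
  qed
  have "(\<lambda>n. (euler n (s + t) u - euler n s (euler n t u)) + (euler n s (euler n t u) - euler n s (S t u)) + euler n s (S t u))
      \<longlonglongrightarrow> 0 + 0 + S s (S t u)"
    by (intro tendsto_add 1 2 euler_tendsto assms u)
  then have "(\<lambda>n. euler n (s + t) u) \<longlonglongrightarrow> S s (S t u)" by simp
  then show ?thesis using euler_tendsto[of "s + t" u] assms u LIMSEQ_unique by fastforce
qed

lemma norm_S_diff_le: "0 \<le> t \<Longrightarrow> u \<in> X \<Longrightarrow> v \<in> X \<Longrightarrow> norm (S t u - S t v) \<le> norm (u - v)"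
  using norm_S_le[of t "u - v"] by (simp add: S_diff X_intros)

lemma S_semigroup:
  assumes "0 \<le> s" "0 \<le> t" "u \<in> X"
  shows "S (s + t) u = S s (S t u)"
proof -
  have "norm (S (s + t) u - S s (S t u)) \<le> 0 + e" if "0 < e" for e
  proof -
    have e: "0 < e / 2" using that by simp
    obtain w where w: "w \<in> D" "norm (w - u) < e / 2" by (rule dense_D[OF assms(3) e])
    note wX = D_in_X[OF w(1)]
    have "norm (S (s + t) u - S (s + t) w) \<le> norm (u - w)"
      using assms wX by (intro norm_S_diff_le) auto
    moreover have "norm (S s (S t w) - S s (S t u)) \<le> norm (w - u)"
      using assms wX S_in_X by (intro order_trans[OF norm_S_diff_le norm_S_diff_le]) auto
    moreover have "S (s + t) u - S s (S t u) = (S (s + t) u - S (s + t) w) + (S s (S t w) - S s (S t u))"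
      using S_semigroup_D[OF assms(1,2) w(1)] by simp
    ultimately show ?thesis
      using w(2) norm_triangle_ineq[of "S (s + t) u - S (s + t) w" "S s (S t w) - S s (S t u)"]
      by (simp add: norm_minus_commute)
  qed
  then have "norm (S (s + t) u - S s (S t u)) \<le> 0" by (rule field_le_epsilon)
  then show ?thesis by simp
qed

lemma S_modulus:
  assumes "u \<in> X" "0 < e"
  obtains d where "0 < d" "\<And>t. 0 \<le> t \<Longrightarrow> t < d \<Longrightarrow> norm (S t u - u) \<le> e"
proof -
  have e: "0 < e / 4" using assms by simp
  obtain w where w: "w \<in> D" "norm (w - u) < e / 4" by (rule dense_D[OF assms(1) e])
  obtain d where d: "0 < d" "\<And>t. t < d \<Longrightarrow> t * norm (A w) \<le> e / 2"
    by (rule small_multiple[of "norm (A w)" "e / 2"]) (use assms in auto)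
  show thesis
  proof (rule that[OF d(1)])
    fix t :: real assume t: "0 \<le> t" "t < d"
    note d(2)[OF t(2)]
    then show "norm (S t u - u) \<le> e"
      using norm_S_diff_self_le[OF t(1) assms(1) w(1)] w(2) by (simp add: norm_minus_commute)
  qed
qed

lemma norm_S_shift_le:
  assumes "0 \<le> s" "0 \<le> t" "u \<in> X"
  shows "norm (S s u - S t u) \<le> norm (S \<bar>s - t\<bar> u - u)"
proof -
  have *: "norm (S (a + b) u - S a u) \<le> norm (S b u - u)" if "0 \<le> a" "0 \<le> b" for a b
    unfolding S_semigroup[OF that assms(3)]
    using that assms(3) by (intro norm_S_diff_le S_in_X) auto
  show ?thesis
    using *[of t "s - t"] *[of s "t - s"] assms by (cases "s \<le> t") (auto simp: norm_minus_commute)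
qed

lemma continuous_on_S:
  assumes "u \<in> X" shows "continuous_on {0..} (\<lambda>t. S t u)"
  unfolding continuous_on_iff
proof (intro ballI allI impI)
  fix t e :: real assume t: "t \<in> {0..}" and e: "0 < e"
  have e2: "0 < e / 2" using e by simp
  obtain d where d: "0 < d" "\<And>t. 0 \<le> t \<Longrightarrow> t < d \<Longrightarrow> norm (S t u - u) \<le> e / 2"
    using S_modulus[OF assms e2] by blast
  have "dist (S s u) (S t u) < e" if "s \<in> {0..}" "dist s t < d" for s
    using norm_S_shift_le[of s t u] d(2)[of "\<bar>s - t\<bar>"] that t assms e by (simp add: dist_norm)
  then show "\<exists>d>0. \<forall>s\<in>{0..}. dist s t < d \<longrightarrow> dist (S s u) (S t u) < e" using d(1) by blast
qed

lemma norm_S_taylor: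
  assumes "0 \<le> t" "u \<in> D" "w \<in> D"
  shows "norm (S t u - u - t *\<^sub>R A u) \<le> t * (2 * norm (A u - w) + t * norm (A w))"
proof (rule LIMSEQ_le)
  let ?m = "\<lambda>n. real (nat \<lfloor>t * 2 ^ n\<rfloor>) * (1 / 2 ^ n)"
  show "(\<lambda>n. norm (euler n t u - u - ?m n *\<^sub>R A u)) \<longlonglongrightarrow> norm (S t u - u - t *\<^sub>R A u)"
    using assms D_in_X by (intro tendsto_intros euler_tendsto steps_tendsto) auto
  show "(\<lambda>n. ?m n * (2 * norm (A u - w) + t * norm (A w))) \<longlonglongrightarrow> t * (2 * norm (A u - w) + t * norm (A w))"
    using assms by (intro tendsto_intros steps_tendsto)
  have "norm (euler n t u - u - ?m n *\<^sub>R A u) \<le> ?m n * (2 * norm (A u - w) + t * norm (A w))" for n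
    unfolding euler_def by (rule norm_Jn_taylor[OF step_pos assms(2,3) steps_le(1)[OF assms(1)]])
  then show "\<exists>N. \<forall>n\<ge>N. norm (euler n t u - u - ?m n *\<^sub>R A u) \<le> ?m n * (2 * norm (A u - w) + t * norm (A w))"
    by blast
qed

lemma S_taylor:
  assumes "u \<in> D" "0 < e"
  obtains d where "0 < d" "\<And>t. 0 \<le> t \<Longrightarrow> t < d \<Longrightarrow> norm (S t u - u - t *\<^sub>R A u) \<le> e * t"
proof -
  have e: "0 < e / 4" using assms by simp
  obtain w where w: "w \<in> D" "norm (w - A u) < e / 4" by (rule dense_D[OF A_in[OF assms(1)] e])
  obtain d where d: "0 < d" "\<And>t. t < d \<Longrightarrow> t * norm (A w) \<le> e / 2"
    by (rule small_multiple[of "norm (A w)" "e / 2"]) (use assms in auto)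
  show thesis
  proof (rule that[OF d(1)])
    fix t :: real assume t: "0 \<le> t" "t < d"
    note d(2)[OF t(2)]
    then have "2 * norm (A u - w) + t * norm (A w) \<le> e"
      using w(2) by (simp add: norm_minus_commute)
    then have "t * (2 * norm (A u - w) + t * norm (A w)) \<le> e * t"
      using t(1) mult_left_mono[of _ e t] by (simp only: mult.commute[of e t])
    then show "norm (S t u - u - t *\<^sub>R A u) \<le> e * t"
      using norm_S_taylor[OF t(1) assms(1) w(1)] by linarith
  qed
qed

end

section \<open>Generator, mild solutions and uniqueness\<close>

text \<open>Riemann sums stay in the subspace.\<close>

lemma has_integral_in_closed_subspace:
  fixes f :: "real \<Rightarrow> 'b::banach"
  assumes "closed X" "subspace X" and f: "\<And>x. x \<in> {a..b} \<Longrightarrow> f x \<in> X" and i: "(f has_integral i) {a..b}"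
  shows "i \<in> X"
proof -
  have "\<exists>y\<in>X. dist y i < e" if "0 < e" for e
  proof -
    from i have "(f has_integral i) (cbox a b)" by simp
    from has_integralD[OF this that]
    obtain g where g: "gauge g" "\<And>p. p tagged_division_of (cbox a b) \<Longrightarrow> g fine p \<Longrightarrow>
        norm ((\<Sum>(x,k)\<in>p. measure lborel k *\<^sub>R f x) - i) < e" by blast
    obtain p where p: "p tagged_division_of (cbox a b)" "g fine p"
      using fine_division_exists[OF g(1)] by blast
    have "(\<Sum>(x,k)\<in>p. measure lborel k *\<^sub>R f x) \<in> X"
    proof (rule subspace_sum[OF assms(2)])
      fix xk assume xk: "xk \<in> p"
      obtain x k where eq: "xk = (x, k)" by force
      have "x \<in> {a..b}" using p(1) xk unfolding eq by (auto dest!: tag_in_interval)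
      then show "(case xk of (x, k) \<Rightarrow> measure lborel k *\<^sub>R f x) \<in> X"
        unfolding eq using f subspace_scale[OF assms(2)] by simp
    qed
    then show ?thesis using g(2)[OF p] unfolding dist_norm by blast
  qed
  then have "i \<in> closure X" unfolding closure_approachable by blast
  then show ?thesis using assms(1) by simp
qed

context maximal_dissipative
begin

lemma S_has_vector_derivative:
  assumes "0 \<le> t" "u \<in> D"
  shows "((\<lambda>t. S t u) has_vector_derivative A (S t u)) (at t within {0..})"
  unfolding has_vector_derivative_def has_derivative_within_alt
proof (intro conjI allI impI)
  show "bounded_linear (\<lambda>x. x *\<^sub>R A (S t u))" by (rule bounded_linear_scaleR_left)
  fix e :: real assume "0 < e"
  then have e: "0 < e / 2" by simp
  note u = D_in_X[OF assms(2)] A_in[OF assms(2)]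
  obtain d1 where d1: "0 < d1" "\<And>t. 0 \<le> t \<Longrightarrow> t < d1 \<Longrightarrow> norm (S t u - u - t *\<^sub>R A u) \<le> (e / 2) * t"
    using S_taylor[OF assms(2) e] by blast
  obtain d2 where d2: "0 < d2" "\<And>t. 0 \<le> t \<Longrightarrow> t < d2 \<Longrightarrow> norm (S t (A u) - A u) \<le> e / 2"
    using S_modulus[OF u(2) e] by blast
  \<comment> \<open>The expansion at time 0 is transported to time \<open>a\<close> by \<open>S a\<close>; backward increments are forward ones from an earlier time.\<close>
  have fwd: "norm (S (a + b) u - S a u - b *\<^sub>R A (S a u)) \<le> (e / 2) * b"
    if "0 \<le> a" "0 \<le> b" "b < d1" for a b
  proof -
    have "b *\<^sub>R A (S a u) = S a (b *\<^sub>R A u)"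
    proof -
      have "S a (b *\<^sub>R A u) = b *\<^sub>R S a (A u)"
        by (rule S_commute_operator[where C = "\<bar>b\<bar>"])
           (use that u in \<open>auto intro!: X_intros simp: J_scale algebra_simps\<close>)
      then show ?thesis using S_in_D(2)[OF that(1) assms(2)] by simp
    qed
    then have "S (a + b) u - S a u - b *\<^sub>R A (S a u) = S a (S b u - u - b *\<^sub>R A u)"
      using that u by (simp add: S_semigroup S_diff X_intros S_in_X)
    also have "norm \<dots> \<le> norm (S b u - u - b *\<^sub>R A u)"
      using that u by (intro norm_S_le X_intros S_in_X)
    also have "\<dots> \<le> (e / 2) * b" using d1 that by blast
    finally show ?thesis .
  qed
  have "norm (S y u - S t u - (y - t) *\<^sub>R A (S t u)) \<le> e * norm (y - t)"
    if y: "0 \<le> y" "norm (y - t) < min d1 d2" for y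
  proof (cases "t \<le> y")
    case True
    then show ?thesis using fwd[of t "y - t"] assms y \<open>0 < e\<close>
      by (smt (verit) mult_right_mono real_norm_def field_sum_of_halves)
  next
    case False
    define b where "b = t - y"
    have b: "0 \<le> b" "b < d1" "b < d2" using False y b_def by auto
    have "A (S t u) - A (S y u) = S t (A u) - S y (A u)" using S_in_D assms y by simp
    then have "norm (A (S t u) - A (S y u)) \<le> e / 2"
      using norm_S_shift_le[of t y "A u"] d2(2)[of b] assms y u b b_def by simp
    then have 1: "norm (b *\<^sub>R (A (S t u) - A (S y u))) \<le> (e / 2) * b"
      using mult_left_mono[OF \<open>norm (A (S t u) - A (S y u)) \<le> e / 2\<close> b(1)] b(1)
      by (simp add: mult.commute)
    have "S y u - S t u - (y - t) *\<^sub>R A (S t u)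
        = b *\<^sub>R (A (S t u) - A (S y u)) - (S (y + b) u - S y u - b *\<^sub>R A (S y u))"
      unfolding b_def by (simp add: algebra_simps)
    also have "norm \<dots> \<le> (e / 2) * b + (e / 2) * b"
      by (rule order_trans[OF norm_triangle_ineq4 add_mono[OF 1 fwd[OF y(1) b(1,2)]]])
    finally show ?thesis using b(1) unfolding b_def by (simp add: algebra_simps)
  qed
  then show "\<exists>d>0. \<forall>y\<in>{0..}. norm (y - t) < d \<longrightarrow>
      norm (S y u - S t u - (y - t) *\<^sub>R A (S t u)) \<le> e * norm (y - t)"
    using d1(1) d2(1) by (intro exI[of _ "min d1 d2"]) auto
qed

lemma S_difference_quotient:
  assumes "u \<in> D"
  shows "((\<lambda>h. (S h u - u) /\<^sub>R h) \<longlongrightarrow> A u) (at_right 0)"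
  unfolding tendsto_iff eventually_at_right_field
proof (intro allI impI)
  fix e :: real assume e: "0 < e"
  then have e2: "0 < e / 2" by simp
  obtain d where d: "0 < d" "\<And>t. 0 \<le> t \<Longrightarrow> t < d \<Longrightarrow> norm (S t u - u - t *\<^sub>R A u) \<le> (e / 2) * t"
    using S_taylor[OF assms e2] by blast
  have "dist ((S h u - u) /\<^sub>R h) (A u) < e" if "0 < h" "h < d" for h
  proof -
    have "(S h u - u) /\<^sub>R h - A u = (S h u - u - h *\<^sub>R A u) /\<^sub>R h"
      using that by (simp add: scaleR_diff_right)
    also have "norm \<dots> = norm (S h u - u - h *\<^sub>R A u) / h"
      using that(1) by (simp add: divide_inverse_commute)
    also have "\<dots> \<le> ((e / 2) * h) / h"
      using that d(2)[of h] by (intro divide_right_mono) auto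
    also have "\<dots> < e" using that(1) e by simp
    finally show ?thesis unfolding dist_norm .
  qed
  then show "\<exists>b>0. \<forall>y>0. y < b \<longrightarrow> dist ((S y u - u) /\<^sub>R y) (A u) < e"
    using d(1) by blast
qed

text \<open>The generator of a contraction semigroup is dissipative, and a dissipative extension of \<open>A\<close> is \<open>A\<close>: the
  difference \<open>z\<close> between \<open>u\<close> and the solution \<open>v\<close> of \<open>v - A v = u - w\<close> is fixed by the generator, hence 0.\<close>

lemma difference_quotient_imp_D:
  assumes u: "u \<in> X" and lim: "((\<lambda>h. (S h u - u) /\<^sub>R h) \<longlongrightarrow> w) (at_right 0)"
  shows "u \<in> D"
proof -
  have "w \<in> X"
  proof (rule Lim_in_closed_set[OF closed_X _ _ lim])
    show "\<forall>\<^sub>F h in at_right 0. (S h u - u) /\<^sub>R h \<in> X"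
      using u by (intro eventually_at_rightI[of 0 1]) (auto intro!: X_intros S_in_X)
  qed simp
  define v where "v = J 1 (u - w)"
  have f: "u - w \<in> X" using u \<open>w \<in> X\<close> X_intros by blast
  have v: "v \<in> D" "v - A v = u - w"
    unfolding v_def using J_props[OF _ f, of 1] by auto
  note vX = D_in_X[OF v(1)]
  define z where "z = u - v"
  have zX: "z \<in> X" unfolding z_def using u vX X_intros by blast
  have zeq: "w - A v = z" unfolding z_def using v(2) by (simp add: algebra_simps)
  have "((\<lambda>h. (S h u - u) /\<^sub>R h - (S h v - v) /\<^sub>R h) \<longlongrightarrow> z) (at_right 0)"
    unfolding zeq[symmetric] by (intro tendsto_diff lim S_difference_quotient v)
  moreover have "\<forall>\<^sub>F h in at_right 0. (S h u - u) /\<^sub>R h - (S h v - v) /\<^sub>R h = (S h z - z) /\<^sub>R h"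
    unfolding z_def using u vX
    by (intro eventually_at_rightI[of 0 1]) (auto simp: S_diff scaleR_diff_right algebra_simps)
  ultimately have "((\<lambda>h. (S h z - z) /\<^sub>R h) \<longlongrightarrow> z) (at_right 0)"
    using tendsto_cong by fastforce
  then have l: "((\<lambda>h. ((S h z - z) /\<^sub>R h) \<bullet> z) \<longlongrightarrow> z \<bullet> z) (at_right 0)"
    by (intro tendsto_inner tendsto_const)
  have "z \<bullet> z \<le> 0"
  proof (rule tendsto_upperbound[OF l])
    show "\<forall>\<^sub>F h in at_right 0. ((S h z - z) /\<^sub>R h) \<bullet> z \<le> 0"
    proof (rule eventually_at_rightI[of 0 1])
      fix h :: real assume "h \<in> {0<..<1}"
      then have h: "0 < h" by simp
      have "S h z \<bullet> z \<le> norm (S h z) * norm z" by (rule norm_cauchy_schwarz)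
      also have "\<dots> \<le> norm z * norm z" using norm_S_le[OF less_imp_le[OF h] zX] by (intro mult_right_mono) auto
      also have "\<dots> = z \<bullet> z" by (simp add: power2_norm_eq_inner flip: power2_eq_square)
      finally have "(S h z - z) \<bullet> z \<le> 0" by (simp add: inner_diff_left)
      then show "((S h z - z) /\<^sub>R h) \<bullet> z \<le> 0"
        using h by (simp add: mult_nonneg_nonpos)
    qed simp
  qed simp
  then have "z \<bullet> z = 0" using inner_ge_zero[of z] by linarith
  then have "u = v" unfolding z_def inner_eq_zero_iff by simp
  then show ?thesis using v(1) by simp
qed

text \<open>On the graph \<open>w = J 1 (w - A w)\<close>, which passes to the limit.\<close>

lemma graph_closed: "closed {(w, A w) |w. w \<in> D}"
  unfolding closed_sequential_limits
proof (intro allI impI)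
  fix x l assume xl: "(\<forall>n. x n \<in> {(w, A w) |w. w \<in> D}) \<and> x \<longlonglongrightarrow> l"
  have x: "fst (x n) \<in> D" "snd (x n) = A (fst (x n))" for n
  proof -
    have "x n \<in> {(w, A w) |w. w \<in> D}" using xl by blast
    then obtain w where "x n = (w, A w)" "w \<in> D" by blast
    then show "fst (x n) \<in> D" "snd (x n) = A (fst (x n))" by simp_all
  qed
  have l: "(\<lambda>n. fst (x n)) \<longlonglongrightarrow> fst l" "(\<lambda>n. snd (x n)) \<longlonglongrightarrow> snd l"
    using tendsto_fst[OF conjunct2[OF xl]] tendsto_snd[OF conjunct2[OF xl]] .
  have lX: "fst l \<in> X" "snd l \<in> X"
    using closed_sequentially[OF closed_X _ l(1)] closed_sequentially[OF closed_X _ l(2)] x A_in D_in_X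
    by auto
  have d: "fst l - snd l \<in> X" using lX X_intros by blast
  have "(\<lambda>n. fst (x n) - J 1 (fst l - snd l)) \<longlonglongrightarrow> 0"
  proof (rule Lim_null_comparison)
    show "\<forall>\<^sub>F n in sequentially. norm (fst (x n) - J 1 (fst l - snd l))
        \<le> norm ((fst (x n) - snd (x n)) - (fst l - snd l))"
    proof (intro always_eventually allI)
      fix n
      have "fst (x n) = J 1 (fst (x n) - snd (x n))"
        using J_eqI[OF zero_less_one x(1)[of n] refl] x(2) by simp
      moreover have dn: "fst (x n) - snd (x n) \<in> X" using x A_in D_in_X X_intros by metis
      ultimately have "fst (x n) - J 1 (fst l - snd l) = J 1 ((fst (x n) - snd (x n)) - (fst l - snd l))"
        using J_diff[OF zero_less_one dn d] by simp
      then show "norm (fst (x n) - J 1 (fst l - snd l)) \<le> norm ((fst (x n) - snd (x n)) - (fst l - snd l))"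
        using norm_J_le[OF zero_less_one X_intros(2)[OF dn d]] by simp
    qed
    show "(\<lambda>n. norm ((fst (x n) - snd (x n)) - (fst l - snd l))) \<longlonglongrightarrow> 0"
      by (intro tendsto_norm_zero LIM_zero tendsto_diff l)
  qed
  then have "(\<lambda>n. fst (x n)) \<longlonglongrightarrow> J 1 (fst l - snd l)" by (rule LIM_zero_cancel)
  then have eq: "fst l = J 1 (fst l - snd l)" using l(1) LIMSEQ_unique by blast
  have "fst l \<in> D" by (subst eq) (rule J_props(1)[OF zero_less_one d])
  moreover have "A (fst l) = snd l"
    using J_props(2)[OF zero_less_one d] unfolding eq[symmetric] by simp
  ultimately show "l \<in> {(w, A w) |w. w \<in> D}"
    by (metis (mono_tags, lifting) mem_Collect_eq prod.collapse)
qed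

lemma graph_subspace: "subspace {(w, A w) |w. w \<in> D}"
  unfolding subspace_def
proof (intro conjI ballI allI)
  show "0 \<in> {(w, A w) |w. w \<in> D}" using D_intros(4) A_zero by (auto simp: zero_prod_def)
  show "x + y \<in> {(w, A w) |w. w \<in> D}" if "x \<in> {(w, A w) |w. w \<in> D}" "y \<in> {(w, A w) |w. w \<in> D}" for x y
    using that D_intros(1) A_add by fastforce
  show "c *\<^sub>R x \<in> {(w, A w) |w. w \<in> D}" if "x \<in> {(w, A w) |w. w \<in> D}" for c x
    using that D_intros(3) A_scale by fastforce
qed

lemma S_integrable: "0 \<le> t \<Longrightarrow> u \<in> X \<Longrightarrow> (\<lambda>s. S s u) integrable_on {0..t}"
  by (rule integrable_continuous_real) (rule continuous_on_subset[OF continuous_on_S], auto)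

lemma A_S_has_integral:
  assumes "0 \<le> t" "u \<in> D"
  shows "((\<lambda>s. A (S s u)) has_integral (S t u - u)) {0..t}"
proof -
  have "((\<lambda>s. A (S s u)) has_integral (S t u - S 0 u)) {0..t}"
  proof (rule fundamental_theorem_of_calculus[OF assms(1)])
    fix x assume "x \<in> {0..t}"
    then show "((\<lambda>s. S s u) has_vector_derivative A (S x u)) (at x within {0..t})"
      using assms by (intro has_vector_derivative_within_subset[OF S_has_vector_derivative]) auto
  qed
  then show ?thesis using S_zero[OF D_in_X[OF assms(2)]] by simp
qed

text \<open>The curve \<open>(S s u, A (S s u))\<close> lies in the graph of \<open>A\<close>, a closed subspace, hence so does its integral.\<close>

lemma integral_S_in_D:
  assumes "0 \<le> t" "u \<in> D"
  shows "integral {0..t} (\<lambda>s. S s u) \<in> D" "A (integral {0..t} (\<lambda>s. S s u)) = S t u - u"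
proof -
  have 1: "((\<lambda>s. S s u) has_integral integral {0..t} (\<lambda>s. S s u)) {0..t}"
    using S_integrable[OF assms(1) D_in_X[OF assms(2)]] by (rule integrable_integral)
  have "((\<lambda>s. (S s u, 0) + (0, A (S s u))) has_integral
      ((integral {0..t} (\<lambda>s. S s u), 0) + (0, S t u - u))) {0..t}"
    using has_integral_linear[OF 1 bounded_linear_Pair[OF bounded_linear_ident bounded_linear_zero]]
      has_integral_linear[OF A_S_has_integral[OF assms] bounded_linear_Pair[OF bounded_linear_zero bounded_linear_ident]]
    by (intro has_integral_add) (simp_all add: o_def)
  then have "((\<lambda>s. (S s u, A (S s u))) has_integral (integral {0..t} (\<lambda>s. S s u), S t u - u)) {0..t}"
    by simp
  from has_integral_in_closed_subspace[OF graph_closed graph_subspace _ this]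
  have "(integral {0..t} (\<lambda>s. S s u), S t u - u) \<in> {(w, A w) |w. w \<in> D}"
    using S_in_D(1) assms by auto
  then show "integral {0..t} (\<lambda>s. S s u) \<in> D" "A (integral {0..t} (\<lambda>s. S s u)) = S t u - u"
    by auto
qed

text \<open>For \<open>u\<close> outside the domain, write \<open>u = w - A w\<close> with \<open>w\<close> in the domain, so that \<open>S s u = S s w - A (S s w)\<close>; the integral
  of the second term is \<open>S t w - w\<close>, again in the domain.\<close>

lemma S_mild:
  assumes "0 \<le> t" "u \<in> X"
  shows "\<exists>W\<in>D. ((\<lambda>s. S s u) has_integral W) {0..t} \<and> S t u = u + A W"
proof -
  define w where "w = J 1 u"
  have w: "w \<in> D" "w - A w = u" unfolding w_def using J_props[OF _ assms(2), of 1] by auto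
  note wX = D_in_X[OF w(1)] A_in[OF w(1)]
  define I where "I = integral {0..t} (\<lambda>s. S s w)"
  note I = integral_S_in_D[OF assms(1) w(1), folded I_def]
  have eq: "S s u = S s w - A (S s w)" if "0 \<le> s" for s
    using S_diff[OF that wX] S_in_D(2)[OF that w(1)] w(2) by simp
  have "((\<lambda>s. S s w - A (S s w)) has_integral (I - (S t w - w))) {0..t}"
    unfolding I_def
    by (intro has_integral_diff integrable_integral S_integrable A_S_has_integral assms w wX)
  then have 1: "((\<lambda>s. S s u) has_integral (I - (S t w - w))) {0..t}"
    by (rule has_integral_eq[rotated]) (use eq in auto)
  have D: "S t w \<in> D" "S t w - w \<in> D" "I - (S t w - w) \<in> D"
    using S_in_D(1)[OF assms(1) w(1)] I(1) w(1) D_intros(2) by auto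
  have "A (I - (S t w - w)) = (S t w - A (S t w)) - (w - A w)"
    unfolding A_diff[OF I(1) D(2)] A_diff[OF D(1) w(1)] I(2) by simp
  also have "\<dots> = S t u - u" unfolding w(2) using eq[OF assms(1)] by simp
  finally show ?thesis using 1 D(3) by (intro bexI[of _ "I - (S t w - w)"]) auto
qed

text \<open>The primitive \<open>W\<close> of the difference \<open>w\<close> of two mild solutions satisfies \<open>W' = A W\<close> and \<open>W 0 = 0\<close>, so its
  norm cannot grow.\<close>

lemma mild_unique:
  assumes V: "continuous_on {0..} V"
    "\<And>t. 0 \<le> t \<Longrightarrow> \<exists>W\<in>D. (V has_integral W) {0..t} \<and> V t = u + A W"
    and u: "u \<in> X" and t: "0 \<le> t"
  shows "V t = S t u"
proof -
  define w where "w s = V s - S s u" for s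
  define W where "W s = integral {0..s} w" for s
  have cw: "continuous_on {0..} w"
    unfolding w_def by (intro continuous_intros V continuous_on_S u)
  have W: "W s \<in> D" "w s = A (W s)" if s: "0 \<le> s" for s
  proof -
    obtain W1 where W1: "W1 \<in> D" "(V has_integral W1) {0..s}" "V s = u + A W1"
      using V(2)[OF s] by blast
    obtain W2 where W2: "W2 \<in> D" "((\<lambda>s. S s u) has_integral W2) {0..s}" "S s u = u + A W2"
      using S_mild[OF s u] by blast
    have "(w has_integral (W1 - W2)) {0..s}"
      unfolding w_def[abs_def] by (intro has_integral_diff W1 W2)
    then have eq: "W s = W1 - W2" unfolding W_def by (rule integral_unique)
    show "W s \<in> D" unfolding eq by (rule D_intros(2)[OF W1(1) W2(1)])
    show "w s = A (W s)" unfolding eq A_diff[OF W1(1) W2(1)] w_def W1(3) W2(3) by simp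
  qed
  have dW: "(W has_vector_derivative w s) (at s)" if "0 < s" for s
  proof -
    have "continuous_on {0..s + 1} w" by (rule continuous_on_subset[OF cw]) auto
    from integral_has_vector_derivative[OF this, of s] that
    have "(W has_vector_derivative w s) (at s within {0..s + 1})"
      unfolding W_def by simp
    then have "(W has_vector_derivative w s) (at s within {0<..<s + 1})"
      by (rule has_vector_derivative_within_subset) auto
    then show ?thesis
      using at_within_open[of s "{0<..<s + 1}"] that by simp
  qed
  have "(norm (W t))\<^sup>2 \<le> (norm (W 0))\<^sup>2"
  proof (rule DERIV_nonpos_imp_decreasing_open[OF t])
    fix s assume s: "0 < s" "s < t"
    have "((\<lambda>s. W s \<bullet> W s) has_derivative (\<lambda>h. W s \<bullet> (h *\<^sub>R w s) + (h *\<^sub>R w s) \<bullet> W s)) (at s)"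
      using dW[OF s(1)] unfolding has_vector_derivative_def by (intro has_derivative_inner)
    then have "((\<lambda>s. (norm (W s))\<^sup>2) has_real_derivative 2 * (w s \<bullet> W s)) (at s)"
      unfolding has_field_derivative_def power2_norm_eq_inner
      by (rule has_derivative_eq_rhs) (auto simp: inner_commute algebra_simps)
    moreover have "2 * (w s \<bullet> W s) \<le> 0" using W[of s] dissipative s by simp
    ultimately show "\<exists>y. ((\<lambda>s. (norm (W s))\<^sup>2) has_real_derivative y) (at s) \<and> y \<le> 0" by blast
  next
    have "continuous_on {0..t} w" by (rule continuous_on_subset[OF cw]) auto
    then have "continuous_on {0..t} W"
      unfolding W_def by (intro indefinite_integral_continuous_1 integrable_continuous_real)
    then show "continuous_on {0..t} (\<lambda>s. (norm (W s))\<^sup>2)" by (intro continuous_intros)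
  qed
  then have "W t = 0" unfolding W_def by simp
  then have "w t = 0" using W(2)[OF t] A_zero by simp
  then show ?thesis unfolding w_def by simp
qed

lemma norm_S_has_derivative:
  assumes "0 \<le> t" "u \<in> D"
  shows "((\<lambda>s. (norm (S s u))\<^sup>2 / 2) has_real_derivative (A (S t u) \<bullet> S t u)) (at t within {0..})"
proof -
  have "((\<lambda>s. S s u \<bullet> S s u) has_derivative (\<lambda>h. S t u \<bullet> (h *\<^sub>R A (S t u)) + (h *\<^sub>R A (S t u)) \<bullet> S t u))
     (at t within {0..})"
    using S_has_vector_derivative[OF assms] unfolding has_vector_derivative_def by (intro has_derivative_inner)
  then have "((\<lambda>s. (norm (S s u))\<^sup>2) has_real_derivative 2 * (A (S t u) \<bullet> S t u)) (at t within {0..})"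
    unfolding has_field_derivative_def power2_norm_eq_inner
    by (rule has_derivative_eq_rhs) (auto simp: inner_commute algebra_simps)
  from DERIV_cdivide[OF this, of 2] show ?thesis by simp
qed

lemma dissipation_has_integral:
  assumes "0 \<le> t" "u \<in> D"
  shows "((\<lambda>s. A (S s u) \<bullet> S s u) has_integral ((norm (S t u))\<^sup>2 / 2 - (norm u)\<^sup>2 / 2)) {0..t}"
proof -
  have "((\<lambda>s. A (S s u) \<bullet> S s u) has_integral ((norm (S t u))\<^sup>2 / 2 - (norm (S 0 u))\<^sup>2 / 2)) {0..t}"
  proof (rule fundamental_theorem_of_calculus[OF assms(1)])
    fix x assume "x \<in> {0..t}"
    then show "((\<lambda>s. (norm (S s u))\<^sup>2 / 2) has_vector_derivative A (S x u) \<bullet> S x u) (at x within {0..t})"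
      unfolding has_real_derivative_iff_has_vector_derivative[symmetric]
      by (intro DERIV_subset[OF norm_S_has_derivative[OF _ assms(2)]]) auto
  qed
  then show ?thesis using S_zero[OF D_in_X[OF assms(2)]] by simp
qed

lemma norm_S_antimono:
  assumes "0 \<le> s" "s \<le> t" "u \<in> X"
  shows "norm (S t u) \<le> norm (S s u)"
proof -
  have "S t u = S (t - s) (S s u)" using S_semigroup[of "t - s" s u] assms by simp
  then show ?thesis using norm_S_le[OF _ S_in_X[OF assms(1,3)], of "t - s"] assms(2) by simp
qed

end

section \<open>Almost everywhere differentiability of indefinite integrals\<close>

text \<open>The points \<open>x\<close> at which arbitrarily short intervals around \<open>x\<close> have a mean of \<open>f\<close> that differs from \<open>f x\<close> by more
  than \<open>e\<close>.\<close>

definition bad_points :: "(real \<Rightarrow> 'b::euclidean_space) \<Rightarrow> real \<Rightarrow> real \<Rightarrow> real \<Rightarrow> real set" where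
  "bad_points f a b e = {x. \<forall>\<delta>>0. \<exists>c d. a \<le> c \<and> c \<le> x \<and> x \<le> d \<and> d \<le> b \<and> c < d \<and> d - c < \<delta> \<and>
     e * (d - c) < norm ((d - c) *\<^sub>R f x - integral {c..d} f)}"

text \<open>Choose for every bad point a bad interval that is fine for the gauge of Henstock's lemma. A disjoint family of
  them is a partial tagged division, so its total length is small; by the Vitali covering lemma the fivefold
  enlargements of a suitable disjoint family cover all bad points.\<close>

lemma negligible_bad_points:
  fixes f :: "real \<Rightarrow> 'b::euclidean_space"
  assumes f: "f integrable_on {a..b}" and e: "0 < e"
  shows "negligible (bad_points f a b e)"
  unfolding negligible_outer_le
proof (intro allI impI)
  fix \<eta> :: real assume \<eta>: "0 < \<eta>"
  have f': "f integrable_on cbox a b" using f by simp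
  have "0 < e * \<eta> / 5" using e \<eta> by simp
  from Henstock_lemma[OF f' this] obtain \<gamma> where \<gamma>: "gauge \<gamma>"
    "\<And>p. p tagged_partial_division_of (cbox a b) \<Longrightarrow> \<gamma> fine p \<Longrightarrow>
       (\<Sum>(x,k)\<in>p. norm (measure lborel k *\<^sub>R f x - integral k f)) < e * \<eta> / 5" by blast
  have "\<exists>c d. a \<le> c \<and> c \<le> x \<and> x \<le> d \<and> d \<le> b \<and> c < d \<and> {c..d} \<subseteq> \<gamma> x \<and>
      e * (d - c) < norm ((d - c) *\<^sub>R f x - integral {c..d} f)" if "x \<in> bad_points f a b e" for x
  proof -
    from \<gamma>(1) obtain \<delta> where \<delta>: "0 < \<delta>" "ball x \<delta> \<subseteq> \<gamma> x"
      unfolding gauge_def by (meson open_contains_ball)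
    from that \<delta>(1) obtain c d where cd: "a \<le> c" "c \<le> x" "x \<le> d" "d \<le> b" "c < d" "d - c < \<delta>"
      "e * (d - c) < norm ((d - c) *\<^sub>R f x - integral {c..d} f)"
      unfolding bad_points_def by blast
    have "{c..d} \<subseteq> ball x \<delta>" using cd by (auto simp: dist_real_def)
    with cd \<delta>(2) show ?thesis by blast
  qed
  then obtain c d where cd: "\<And>x. x \<in> bad_points f a b e \<Longrightarrow> a \<le> c x \<and> c x \<le> x \<and> x \<le> d x \<and> d x \<le> b \<and>
      c x < d x \<and> {c x..d x} \<subseteq> \<gamma> x \<and> e * (d x - c x) < norm ((d x - c x) *\<^sub>R f x - integral {c x..d x} f)"
    by metis
  define m where "m x = (c x + d x) / 2" for x
  define r where "r x = (d x - c x) / 2" for x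
  have cball: "cball (m x) (r x) = {c x..d x}" for x
    unfolding cball_eq_atLeastAtMost m_def r_def by (simp add: field_simps)
  have "bad_points f a b e \<subseteq> (\<Union>x\<in>bad_points f a b e. cball (m x) (r x))"
    unfolding cball using cd by force
  moreover have "0 < r x \<and> r x \<le> b - a" if "x \<in> bad_points f a b e" for x
    using cd[OF that] unfolding r_def by auto
  ultimately obtain C where C: "countable C" "C \<subseteq> bad_points f a b e"
     "pairwise (\<lambda>i j. disjnt (cball (m i) (r i)) (cball (m j) (r j))) C"
     "bad_points f a b e \<subseteq> (\<Union>i\<in>C. cball (m i) (5 * r i))"
    by (rule Vitali_covering_lemma_cballs)
  have bound: "measure lebesgue (\<Union>i\<in>C'. cball (m i) (5 * r i)) \<le> \<eta>" if C': "C' \<subseteq> C" "finite C'" for C'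
  proof -
    have cdC: "a \<le> c x" "c x \<le> x" "x \<le> d x" "d x \<le> b" "c x < d x" "{c x..d x} \<subseteq> \<gamma> x"
      "e * (d x - c x) < norm ((d x - c x) *\<^sub>R f x - integral {c x..d x} f)" if "x \<in> C'" for x
      using cd C' C(2) that by blast+
    have dis: "{c x..d x} \<inter> {c y..d y} = {}" if "x \<in> C'" "y \<in> C'" "x \<noteq> y" for x y
      using C(3) C'(1) that unfolding pairwise_def cball disjnt_def by blast
    define p where "p = (\<lambda>x. (x, {c x..d x})) ` C'"
    have "p tagged_partial_division_of (cbox a b)"
      unfolding tagged_partial_division_of_def
    proof (intro conjI allI impI)
      show "finite p" unfolding p_def using C'(2) by simp
      fix x K assume "(x, K) \<in> p"
      then have x: "x \<in> C'" "K = {c x..d x}" unfolding p_def by auto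
      show "x \<in> K" unfolding x(2) using cdC(2,3)[OF x(1)] by simp
      show "K \<subseteq> cbox a b" unfolding x(2) using cdC(1,4)[OF x(1)] by simp
      show "\<exists>a b. K = cbox a b" unfolding x(2) by (rule exI[of _ "c x"], rule exI[of _ "d x"]) simp
    next
      fix x1 K1 x2 K2 assume *: "(x1, K1) \<in> p \<and> (x2, K2) \<in> p \<and> (x1, K1) \<noteq> (x2, K2)"
      have "K1 = {c x1..d x1} \<and> x1 \<in> C'" "K2 = {c x2..d x2} \<and> x2 \<in> C'"
        using conjunct1[OF *] conjunct1[OF conjunct2[OF *]] unfolding p_def by (simp_all add: image_iff)
      moreover from this have "x1 \<noteq> x2" using * by auto
      ultimately have "K1 \<inter> K2 = {}" using dis[of x1 x2] by simp
      then show "interior K1 \<inter> interior K2 = {}" using interior_subset by blast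
    qed
    moreover have "\<gamma> fine p"
      unfolding fine_def p_def using cdC(6) by auto
    ultimately have 1: "(\<Sum>(x,k)\<in>p. norm (measure lborel k *\<^sub>R f x - integral k f)) < e * \<eta> / 5"
      by (rule \<gamma>(2))
    have "(\<Sum>(x,k)\<in>p. norm (measure lborel k *\<^sub>R f x - integral k f))
        = (\<Sum>x\<in>C'. norm ((d x - c x) *\<^sub>R f x - integral {c x..d x} f))"
    proof -
      have "inj_on (\<lambda>x. (x, {c x..d x})) C'" by (simp add: inj_on_def)
      then have "(\<Sum>(x,k)\<in>p. norm (measure lborel k *\<^sub>R f x - integral k f))
          = (\<Sum>x\<in>C'. norm (measure lborel {c x..d x} *\<^sub>R f x - integral {c x..d x} f))"
        unfolding p_def by (simp add: sum.reindex)
      also have "\<dots> = (\<Sum>x\<in>C'. norm ((d x - c x) *\<^sub>R f x - integral {c x..d x} f))"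
        by (rule sum.cong) (use cdC(5) in \<open>auto simp: less_imp_le\<close>)
      finally show ?thesis .
    qed
    moreover have "(\<Sum>x\<in>C'. e * (d x - c x)) \<le> (\<Sum>x\<in>C'. norm ((d x - c x) *\<^sub>R f x - integral {c x..d x} f))"
      using cdC(7) by (intro sum_mono less_imp_le)
    ultimately have "e * (\<Sum>x\<in>C'. d x - c x) \<le> e * (\<eta> / 5)"
      using 1 by (simp add: sum_distrib_left)
    then have 2: "(\<Sum>x\<in>C'. d x - c x) \<le> \<eta> / 5" using e by simp
    have "measure lebesgue (\<Union>i\<in>C'. cball (m i) (5 * r i)) \<le> (\<Sum>i\<in>C'. measure lebesgue (cball (m i) (5 * r i)))"
      using C'(2) by (intro measure_UNION_le) auto
    also have "\<dots> = (\<Sum>x\<in>C'. 5 * (d x - c x))"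
    proof (rule sum.cong[OF refl])
      fix x assume "x \<in> C'"
      then show "measure lebesgue (cball (m x) (5 * r x)) = 5 * (d x - c x)"
        using cdC(5)[of x] unfolding r_def cball_eq_atLeastAtMost by (simp add: content_real field_simps)
    qed
    also have "\<dots> = 5 * (\<Sum>x\<in>C'. d x - c x)" by (simp only: sum_distrib_left)
    also have "\<dots> \<le> \<eta>" using 2 by simp
    finally show ?thesis .
  qed
  show "\<exists>T. bad_points f a b e \<subseteq> T \<and> T \<in> lmeasurable \<and> measure lebesgue T \<le> \<eta>"
  proof (rule exI[of _ "\<Union>i\<in>C. cball (m i) (5 * r i)"], intro conjI)
    show "bad_points f a b e \<subseteq> (\<Union>i\<in>C. cball (m i) (5 * r i))" by (rule C(4))
    show "(\<Union>i\<in>C. cball (m i) (5 * r i)) \<in> lmeasurable"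
      by (rule fmeasurable_UN_bound[OF C(1) _ bound]) simp_all
    show "measure lebesgue (\<Union>i\<in>C. cball (m i) (5 * r i)) \<le> \<eta>"
      by (rule measure_UN_bound[OF C(1) _ bound]) simp_all
  qed
qed

theorem indefinite_integral_ae_differentiable:
  fixes f :: "real \<Rightarrow> 'b::euclidean_space"
  assumes f: "f integrable_on {a..b}"
  obtains N where "negligible N"
    "\<And>x. a < x \<Longrightarrow> x < b \<Longrightarrow> x \<notin> N \<Longrightarrow> ((\<lambda>x. integral {a..x} f) has_vector_derivative f x) (at x)"
proof -
  let ?N = "\<Union>k. bad_points f a b (1 / real (Suc k))"
  have "negligible (bad_points f a b (1 / real (Suc k)))" for k
    by (rule negligible_bad_points[OF f]) simp
  then have "negligible ?N" by (intro negligible_countable_Union) auto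
  moreover have "((\<lambda>x. integral {a..x} f) has_vector_derivative f x) (at x)"
    if x: "a < x" "x < b" "x \<notin> ?N" for x
  proof -
  let ?F = "\<lambda>x. integral {a..x} f"
  have F: "integral {s..t} f = ?F t - ?F s" if "a \<le> s" "s \<le> t" "t \<le> b" for s t
  proof -
    have "f integrable_on {a..t}" by (rule integrable_on_subinterval[OF f]) (use that in auto)
    then show ?thesis using Henstock_Kurzweil_Integration.integral_combine[OF that(1,2)] by (simp add: algebra_simps)
  qed
  have "(?F has_vector_derivative f x) (at x)"
    unfolding has_vector_derivative_def has_derivative_at_alt
  proof (intro conjI allI impI)
    show "bounded_linear (\<lambda>h. h *\<^sub>R f x)" by (rule bounded_linear_scaleR_left)
    fix e :: real assume "0 < e"
    then obtain k where k: "1 / real (Suc k) < e" using reals_Archimedean[of e] by (auto simp: inverse_eq_divide)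
    have "x \<notin> bad_points f a b (1 / real (Suc k))" using x(3) by blast
    then obtain \<delta> where \<delta>: "0 < \<delta>" "\<not> (\<exists>c d. a \<le> c \<and> c \<le> x \<and> x \<le> d \<and> d \<le> b \<and> c < d \<and> d - c < \<delta> \<and>
        1 / real (Suc k) * (d - c) < norm ((d - c) *\<^sub>R f x - integral {c..d} f))"
      unfolding bad_points_def by blast
    have \<delta>': "norm ((d - c) *\<^sub>R f x - integral {c..d} f) \<le> e * (d - c)"
      if "a \<le> c" "c \<le> x" "x \<le> d" "d \<le> b" "c < d" "d - c < \<delta>" for c d
    proof -
      have "1 / real (Suc k) * (d - c) \<le> e * (d - c)" using k that by (intro mult_right_mono) auto
      moreover have "norm ((d - c) *\<^sub>R f x - integral {c..d} f) \<le> 1 / real (Suc k) * (d - c)"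
        using \<delta>(2) that by (meson not_less)
      ultimately show ?thesis by linarith
    qed
    have "norm (?F y - ?F x - (y - x) *\<^sub>R f x) \<le> e * norm (y - x)"
      if y: "norm (y - x) < min \<delta> (min (x - a) (b - x))" for y
    proof -
      consider "y = x" | "x < y" | "y < x" by linarith
      then show ?thesis
      proof cases
        case 2
        then have "norm ((y - x) *\<^sub>R f x - integral {x..y} f) \<le> e * (y - x)"
          using y x by (intro \<delta>') auto
        then show ?thesis using F[of x y] 2 y x by (simp add: norm_minus_commute)
      next
        case 3
        then have "norm ((x - y) *\<^sub>R f x - integral {y..x} f) \<le> e * (x - y)"
          using y x by (intro \<delta>') auto
        moreover have "?F y - ?F x - (y - x) *\<^sub>R f x = (x - y) *\<^sub>R f x - integral {y..x} f"
          using F[of y x] 3 y x by (simp add: algebra_simps)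
        ultimately show ?thesis using 3 by simp
      qed simp
    qed
    then show "\<exists>d>0. \<forall>y. norm (y - x) < d \<longrightarrow> norm (?F y - ?F x - (y - x) *\<^sub>R f x) \<le> e * norm (y - x)"
      using \<delta>(1) x by (intro exI[of _ "min \<delta> (min (x - a) (b - x))"]) auto
  qed
  then show ?thesis .
  qed
  ultimately show thesis by (rule that)
qed

section \<open>Completeness of the space of square-integrable functions\<close>

lemma L2_rel_rep: "L2_rel (rep_L2 f) (rep_L2 f)"
  by (rule Quotient3_rep_reflp[OF Quotient3_L2])

lemma square_integrable_rep: "square_integrable (rep_L2 f)"
  using L2_rel_rep[of f] by (simp add: L2_rel_def)

lemma measurable_rep[measurable]: "rep_L2 f \<in> borel_measurable lebesgue"
  using square_integrable_rep[of f] by (simp add: square_integrable_def)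

lemma rep_abs_L2:
  assumes "square_integrable f"
  shows "AE x in lebesgue. rep_L2 (abs_L2 f) x = f x"
proof -
  have "L2_rel f f" using assms by (simp add: L2_rel_def)
  then have "L2_rel (rep_L2 (abs_L2 f)) f"
    using rep_abs_rsp_left[OF Quotient3_L2] by blast
  then show ?thesis by (simp add: L2_rel_def)
qed

lemma abs_L2_eqI:
  assumes "square_integrable f" "square_integrable g" "AE x in lebesgue. f x = g x"
  shows "abs_L2 f = abs_L2 g"
  using assms by (intro Quotient3_rel_abs[OF Quotient3_L2]) (simp add: L2_rel_def)

lemma abs_rep_L2: "abs_L2 (rep_L2 f) = f"
  by (rule Quotient3_abs_rep[OF Quotient3_L2])

lemma L2_eqI:
  assumes "AE x in lebesgue. rep_L2 f x = rep_L2 g x" shows "f = g"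
  using abs_L2_eqI[OF square_integrable_rep square_integrable_rep assms] by (simp add: abs_rep_L2)

lemma rep_plus: "AE x in lebesgue. rep_L2 (f + g) x = rep_L2 f x + rep_L2 g x"
proof -
  have "f + g = abs_L2 (\<lambda>x. rep_L2 f x + rep_L2 g x)"
    unfolding plus_L2_def by (simp add: map_fun_def)
  then show ?thesis
    using rep_abs_L2[OF square_integrable_add[OF square_integrable_rep square_integrable_rep, of f g]] by simp
qed

lemma rep_scaleC: "AE x in lebesgue. rep_L2 (scaleC c f) x = c * rep_L2 f x"
proof -
  have "scaleC c f = abs_L2 (\<lambda>x. c * rep_L2 f x)"
    unfolding scaleC_def by (simp add: map_fun_def)
  then show ?thesis
    using rep_abs_L2[OF square_integrable_cmult[OF square_integrable_rep, of c f]] by simp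
qed

lemma scaleR_scaleC: "r *\<^sub>R f = scaleC (complex_of_real r) (f :: L2)"
  unfolding scaleR_L2_def scaleC_def by (simp add: map_fun_def)

lemma uminus_scaleC: "- f = scaleC (- 1) (f :: L2)"
  using scaleR_scaleC[of "-1" f] by simp

lemma rep_uminus: "AE x in lebesgue. rep_L2 (- f) x = - rep_L2 f x"
  using rep_scaleC[of "-1" f] by (simp add: uminus_scaleC)

lemma rep_minus: "AE x in lebesgue. rep_L2 (f - g) x = rep_L2 f x - rep_L2 g x"
  using rep_plus[of f "- g"] rep_uminus[of g] unfolding diff_conv_add_uminus
  by eventually_elim simp

lemma rep_zero: "AE x in lebesgue. rep_L2 0 x = 0"
  using rep_abs_L2[OF square_integrable_zero] by (simp add: zero_L2_def)

lemma inner_L2_eq: "f \<bullet> g = (LINT x|lebesgue. rep_L2 f x \<bullet> rep_L2 g x)" for f g :: L2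
  unfolding inner_L2_def by (simp add: map_fun_def)

lemma norm_L2_sq: "(norm f)\<^sup>2 = (LINT x|lebesgue. (cmod (rep_L2 f x))\<^sup>2)" for f :: L2
  unfolding power2_norm_eq_inner inner_L2_eq by (simp add: power2_norm_eq_inner)

lemma norm_abs_L2_sq:
  assumes "square_integrable f"
  shows "(norm (abs_L2 f))\<^sup>2 = (LINT x|lebesgue. (cmod (f x))\<^sup>2)"
proof -
  have [measurable]: "f \<in> borel_measurable lebesgue" using assms by (simp add: square_integrable_def)
  show ?thesis
    unfolding norm_L2_sq by (rule integral_cong_AE) (use rep_abs_L2[OF assms] in auto)
qed

lemma abs_L2_diff:
  assumes "square_integrable f" "square_integrable g"
  shows "abs_L2 f - abs_L2 g = abs_L2 (\<lambda>x. f x - g x)"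
proof (rule L2_eqI)
  have "square_integrable (\<lambda>x. f x - g x)"
    using square_integrable_add[OF assms(1) square_integrable_cmult[OF assms(2), of "-1"]] by simp
  from rep_abs_L2[OF this] rep_abs_L2[OF assms(1)] rep_abs_L2[OF assms(2)] rep_minus[of "abs_L2 f" "abs_L2 g"]
  show "AE x in lebesgue. rep_L2 (abs_L2 f - abs_L2 g) x = rep_L2 (abs_L2 (\<lambda>x. f x - g x)) x"
    by eventually_elim simp
qed

lemma nn_norm_L2_diff:
  "(\<integral>\<^sup>+x. ennreal ((cmod (rep_L2 f x - rep_L2 g x))\<^sup>2) \<partial>lebesgue) = ennreal ((norm (f - g))\<^sup>2)"
proof -
  have "(\<integral>\<^sup>+x. ennreal ((cmod (rep_L2 f x - rep_L2 g x))\<^sup>2) \<partial>lebesgue)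
      = (\<integral>\<^sup>+x. ennreal ((cmod (rep_L2 (f - g) x))\<^sup>2) \<partial>lebesgue)"
    by (rule nn_integral_cong_AE) (use rep_minus[of f g] in auto)
  also have "\<dots> = ennreal ((norm (f - g))\<^sup>2)"
    unfolding norm_L2_sq using square_integrable_rep[of "f - g"]
    by (intro nn_integral_eq_integral) (auto simp: square_integrable_def)
  finally show ?thesis .
qed

text \<open>Finiteness of the weighted sum bounds the increments by a multiple of \<open>2\<^sup>-\<^sup>k\<close>. Weights are needed because on
  the whole line square-integrability of the increments does not control their integrals.\<close>

lemma convergent_if_weighted_squares_summable:
  fixes h :: "nat \<Rightarrow> complex"
  assumes "(\<Sum>k. ennreal (4 ^ k * (cmod (h (Suc k) - h k))\<^sup>2)) \<noteq> \<infinity>"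
  shows "convergent h"
proof -
  have s: "summable (\<lambda>k. 4 ^ k * (cmod (h (Suc k) - h k))\<^sup>2)"
    by (rule summable_suminf_not_top) (use assms in auto)
  from summable_imp_bounded[OF this] obtain B where B: "\<And>k. norm (4 ^ k * (cmod (h (Suc k) - h k))\<^sup>2) \<le> B"
    unfolding bounded_iff by blast
  have "summable (\<lambda>k. h (Suc k) - h k)"
  proof (rule summable_comparison_test')
    show "summable (\<lambda>k. sqrt B * (1 / 2) ^ k)"
      by (intro summable_mult summable_geometric) simp
    fix k :: nat
    have "(2 ^ k * cmod (h (Suc k) - h k))\<^sup>2 \<le> B"
      using B[of k] power_mult_distrib[of "2::real" 2 k] by (simp add: power2_eq_square mult_ac)
    then have "2 ^ k * cmod (h (Suc k) - h k) \<le> sqrt B" by (rule real_le_rsqrt)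
    then show "norm (h (Suc k) - h k) \<le> sqrt B * (1 / 2) ^ k" by (simp add: field_simps)
  qed
  then have "convergent (\<lambda>n. \<Sum>i<n. h (Suc i) - h i)"
    by (simp add: summable_iff_convergent)
  then have "convergent (\<lambda>n. (h n - h 0) + h 0)"
    unfolding sum_lessThan_telescope[of h] by (intro convergent_add convergent_const)
  then show ?thesis by simp
qed

text \<open>With squared norms of the increments below \<open>8\<^sup>-\<^sup>k\<close>, the weights \<open>4\<^sup>k\<close> still leave the summable bound \<open>2\<^sup>-\<^sup>k\<close>. So the representatives converge almost
  everywhere; Fatou's lemma identifies the pointwise limit as the limit in norm.\<close>

lemma L2_fast_Cauchy_convergent:
  fixes X :: "nat \<Rightarrow> L2"
  assumes fast: "\<And>k m n. k \<le> m \<Longrightarrow> k \<le> n \<Longrightarrow> (norm (X m - X n))\<^sup>2 \<le> (1 / 8) ^ k"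
  shows "convergent X"
proof -
  define h where "h k x = rep_L2 (X k) x" for k x
  have [measurable]: "h k \<in> borel_measurable lebesgue" for k unfolding h_def by measurable
  have "(\<integral>\<^sup>+x. (\<Sum>k. ennreal (4 ^ k * (cmod (h (Suc k) x - h k x))\<^sup>2)) \<partial>lebesgue)
      = (\<Sum>k. \<integral>\<^sup>+x. ennreal (4 ^ k * (cmod (h (Suc k) x - h k x))\<^sup>2) \<partial>lebesgue)"
    by (rule nn_integral_suminf) measurable
  also have "\<dots> \<le> (\<Sum>k. ennreal ((1 / 2) ^ k))"
  proof (intro suminf_le allI)
    fix k
    have "(\<integral>\<^sup>+x. ennreal (4 ^ k * (cmod (h (Suc k) x - h k x))\<^sup>2) \<partial>lebesgue)
        = ennreal (4 ^ k) * (\<integral>\<^sup>+x. ennreal ((cmod (h (Suc k) x - h k x))\<^sup>2) \<partial>lebesgue)"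
      by (subst nn_integral_cmult[symmetric]) (auto simp: ennreal_mult)
    also have "\<dots> = ennreal (4 ^ k * (norm (X (Suc k) - X k))\<^sup>2)"
      unfolding h_def nn_norm_L2_diff by (simp add: ennreal_mult)
    also have "\<dots> \<le> ennreal (4 ^ k * (1 / 8) ^ k)"
      using fast[of k "Suc k" k] by (intro ennreal_leI mult_left_mono) auto
    also have "4 ^ k * (1 / 8) ^ k = (1 / 2 :: real) ^ k" by (simp flip: power_mult_distrib)
    finally show "(\<integral>\<^sup>+x. ennreal (4 ^ k * (cmod (h (Suc k) x - h k x))\<^sup>2) \<partial>lebesgue) \<le> ennreal ((1 / 2) ^ k)" .
  qed auto
  also have "\<dots> = ennreal (\<Sum>k. (1 / 2) ^ k)"
    by (rule suminf_ennreal2) (auto intro: summable_geometric)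
  also have "\<dots> < \<infinity>" by simp
  finally have "AE x in lebesgue. (\<Sum>k. ennreal (4 ^ k * (cmod (h (Suc k) x - h k x))\<^sup>2)) \<noteq> \<infinity>"
    by (intro nn_integral_PInf_AE) auto
  then have conv: "AE x in lebesgue. convergent (\<lambda>k. h k x)"
    by eventually_elim (rule convergent_if_weighted_squares_summable)
  define f where "f x = lim (\<lambda>k. h k x)" for x
  have [measurable]: "f \<in> borel_measurable lebesgue"
    unfolding f_def by measurable
  have lim: "AE x in lebesgue. (\<lambda>k. h k x) \<longlonglongrightarrow> f x"
    using conv by eventually_elim (simp add: f_def convergent_LIMSEQ_iff)
  have est: "(\<integral>\<^sup>+x. ennreal ((cmod (f x - h k x))\<^sup>2) \<partial>lebesgue) \<le> ennreal ((1 / 8) ^ k)" for k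
  proof -
    have "(\<integral>\<^sup>+x. ennreal ((cmod (f x - h k x))\<^sup>2) \<partial>lebesgue)
        = (\<integral>\<^sup>+x. liminf (\<lambda>m. ennreal ((cmod (h m x - h k x))\<^sup>2)) \<partial>lebesgue)"
    proof (rule nn_integral_cong_AE, use lim in eventually_elim)
      fix x assume "(\<lambda>k. h k x) \<longlonglongrightarrow> f x"
      then have "(\<lambda>m. ennreal ((cmod (h m x - h k x))\<^sup>2)) \<longlonglongrightarrow> ennreal ((cmod (f x - h k x))\<^sup>2)"
        by (intro tendsto_intros tendsto_ennrealI)
      then show "ennreal ((cmod (f x - h k x))\<^sup>2) = liminf (\<lambda>m. ennreal ((cmod (h m x - h k x))\<^sup>2))"
        by (rule lim_imp_Liminf[OF sequentially_bot, symmetric])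
    qed
    also have "\<dots> \<le> liminf (\<lambda>m. \<integral>\<^sup>+x. ennreal ((cmod (h m x - h k x))\<^sup>2) \<partial>lebesgue)"
      by (rule nn_integral_liminf) measurable
    also have "\<dots> \<le> ennreal ((1 / 8) ^ k)"
    proof -
      have "\<forall>\<^sub>F m in sequentially. (\<integral>\<^sup>+x. ennreal ((cmod (h m x - h k x))\<^sup>2) \<partial>lebesgue) \<le> ennreal ((1 / 8) ^ k)"
        unfolding h_def nn_norm_L2_diff using fast by (intro eventually_sequentiallyI[of k] ennreal_leI) auto
      from Liminf_mono[OF this] show ?thesis by (simp add: Liminf_const)
    qed
    finally show ?thesis .
  qed
  have d: "square_integrable (\<lambda>x. f x - h k x)" for k
    unfolding square_integrable_def
  proof
    show "integrable lebesgue (\<lambda>x. (cmod (f x - h k x))\<^sup>2)"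
      by (rule integrableI_nonneg) (use est[of k] in \<open>auto simp: order.strict_trans1\<close>)
  qed measurable
  have "square_integrable (\<lambda>x. (f x - h 0 x) + h 0 x)"
    by (rule square_integrable_add[OF d]) (simp add: h_def square_integrable_rep)
  then have f: "square_integrable f" by simp
  have "X \<longlonglongrightarrow> abs_L2 f"
  proof (rule LIM_zero_cancel, rule Lim_null_comparison, intro always_eventually allI)
    fix k
    have "abs_L2 f - X k = abs_L2 (\<lambda>x. f x - h k x)"
      using abs_L2_diff[OF f square_integrable_rep, of "X k"] by (simp add: abs_rep_L2 h_def)
    then have "ennreal ((norm (abs_L2 f - X k))\<^sup>2) = (\<integral>\<^sup>+x. ennreal ((cmod (f x - h k x))\<^sup>2) \<partial>lebesgue)"
      using norm_abs_L2_sq[OF d, of k] d[of k]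
      by (subst nn_integral_eq_integral) (auto simp: square_integrable_def)
    then have "ennreal ((norm (abs_L2 f - X k))\<^sup>2) \<le> ennreal ((1 / 8) ^ k)" using est[of k] by simp
    then have "(norm (X k - abs_L2 f))\<^sup>2 \<le> (1 / 8) ^ k"
      by (simp add: norm_minus_commute)
    then have "norm (X k - abs_L2 f) \<le> sqrt ((1 / 8) ^ k)" by (rule real_le_rsqrt)
    then show "norm (X k - abs_L2 f) \<le> sqrt (1 / 8) ^ k" by (simp only: real_sqrt_power)
  next
    show "(\<lambda>k. sqrt (1 / 8) ^ k) \<longlonglongrightarrow> 0" by (rule LIMSEQ_realpow_zero) auto
  qed
  then show ?thesis by (auto simp: convergent_def)
qed

text \<open>The Riesz-Fischer theorem: every Cauchy sequence has a subsequence to which \<open>L2_fast_Cauchy_convergent\<close> applies.\<close>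

instance L2 :: banach
proof
  fix X :: "nat \<Rightarrow> L2" assume C: "Cauchy X"
  have "\<exists>M. \<forall>m\<ge>M. \<forall>n\<ge>M. (norm (X m - X n))\<^sup>2 \<le> (1 / 8) ^ k" for k
  proof -
    have "0 < sqrt ((1 / 8 :: real) ^ k)" by simp
    from CauchyD[OF C this] obtain M where M: "\<And>m n. m \<ge> M \<Longrightarrow> n \<ge> M \<Longrightarrow> norm (X m - X n) < sqrt ((1 / 8) ^ k)"
      by blast
    have "(norm (X m - X n))\<^sup>2 \<le> (1 / 8) ^ k" if "m \<ge> M" "n \<ge> M" for m n
      using M[OF that] power_mono[of "norm (X m - X n)" "sqrt ((1 / 8) ^ k)" 2] by simp
    then show ?thesis by blast
  qed
  then obtain M where M: "\<And>k m n. M k \<le> m \<Longrightarrow> M k \<le> n \<Longrightarrow> (norm (X m - X n))\<^sup>2 \<le> (1 / 8) ^ k" by metis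
  \<comment> \<open>The summand \<open>k\<close> makes the sequence of indices strictly increasing.\<close>
  define r where "r k = k + (\<Sum>i\<le>k. M i)" for k
  have r: "strict_mono r" unfolding strict_mono_Suc_iff r_def by simp
  have rM: "M k \<le> r m" if "k \<le> m" for k m
  proof -
    have "M k \<le> (\<Sum>i\<le>m. M i)" using that by (intro member_le_sum) auto
    then show ?thesis unfolding r_def by simp
  qed
  have "convergent (X \<circ> r)"
    by (rule L2_fast_Cauchy_convergent) (auto intro!: M rM)
  then obtain L where "(X \<circ> r) \<longlonglongrightarrow> L" by (auto simp: convergent_def)
  from Cauchy_converges_subseq[OF C r this] show "convergent X" by (auto simp: convergent_def)
qed

section \<open>Boundary traces controlled by the dissipation\<close>

lemma L2_loc_square_integrable:
  assumes "L2_loc f" "0 < T"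
  shows "square_integrable (\<lambda>t. indicat_real {0..T} t *\<^sub>R f t)"
    "(LINT t|lebesgue. (cmod (indicat_real {0..T} t *\<^sub>R f t))\<^sup>2) = (LINT t:{0..T}|lebesgue. (cmod (f t))\<^sup>2)"
proof -
  have eq: "(\<lambda>t. (cmod (indicat_real {0..T} t *\<^sub>R f t))\<^sup>2) = (\<lambda>t. indicat_real {0..T} t *\<^sub>R (cmod (f t))\<^sup>2)"
    by (auto simp: indicator_def)
  show "square_integrable (\<lambda>t. indicat_real {0..T} t *\<^sub>R f t)"
    using assms unfolding square_integrable_def eq L2_loc_def set_borel_measurable_def set_integrable_def by blast
  show "(LINT t|lebesgue. (cmod (indicat_real {0..T} t *\<^sub>R f t))\<^sup>2) = (LINT t:{0..T}|lebesgue. (cmod (f t))\<^sup>2)"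
    unfolding eq set_lebesgue_integral_def ..
qed

lemma L2_loc_absolutely_integrable:
  assumes "L2_loc f" "0 < T"
  shows "(\<lambda>t. (cmod (f t))\<^sup>2) absolutely_integrable_on {0..T}"
  using assms unfolding L2_loc_def by blast

lemma square_integrable_diff:
  assumes "square_integrable f" "square_integrable g"
  shows "square_integrable (\<lambda>x. f x - g x)"
  using square_integrable_add[OF assms(1) square_integrable_cmult[OF assms(2), of "-1"]] by simp

lemma L2_loc_tendsto_imp_energy_tendsto:
  assumes "L2_loc_tendsto P p" "0 < T"
  shows "(\<lambda>n. integral {0..T} (\<lambda>t. (cmod (P n t))\<^sup>2)) \<longlonglongrightarrow> integral {0..T} (\<lambda>t. (cmod (p t))\<^sup>2)"
proof -
  define R where "R f = abs_L2 (\<lambda>t. indicat_real {0..T} t *\<^sub>R f t)" for f :: "real \<Rightarrow> complex"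
  have loc: "L2_loc (P n)" "L2_loc p" for n using assms(1) unfolding L2_loc_tendsto_def by blast+
  have sq: "(norm (R f))\<^sup>2 = integral {0..T} (\<lambda>t. (cmod (f t))\<^sup>2)" if "L2_loc f" for f
    unfolding R_def norm_abs_L2_sq[OF L2_loc_square_integrable(1)[OF that assms(2)]]
      L2_loc_square_integrable(2)[OF that assms(2)]
    by (rule set_lebesgue_integral_eq_integral(2)[OF L2_loc_absolutely_integrable[OF that assms(2)]])
  have "(norm (R (P n) - R p))\<^sup>2 = (LINT t:{0..T}|lebesgue. (cmod (P n t - p t))\<^sup>2)" for n
  proof -
    note s = L2_loc_square_integrable(1)[OF loc(1)[of n] assms(2)] L2_loc_square_integrable(1)[OF loc(2) assms(2)]
    have "R (P n) - R p = abs_L2 (\<lambda>t. indicat_real {0..T} t *\<^sub>R P n t - indicat_real {0..T} t *\<^sub>R p t)"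
      unfolding R_def by (rule abs_L2_diff[OF s])
    then have "(norm (R (P n) - R p))\<^sup>2
        = (LINT t|lebesgue. (cmod (indicat_real {0..T} t *\<^sub>R P n t - indicat_real {0..T} t *\<^sub>R p t))\<^sup>2)"
      by (simp only: norm_abs_L2_sq[OF square_integrable_diff[OF s]])
    also have "(\<lambda>t. (cmod (indicat_real {0..T} t *\<^sub>R P n t - indicat_real {0..T} t *\<^sub>R p t))\<^sup>2)
        = (\<lambda>t. indicat_real {0..T} t *\<^sub>R (cmod (P n t - p t))\<^sup>2)"
      by (auto simp: indicator_def)
    finally show ?thesis unfolding set_lebesgue_integral_def .
  qed
  then have "(\<lambda>n. (norm (R (P n) - R p))\<^sup>2) \<longlonglongrightarrow> 0"
    using assms unfolding L2_loc_tendsto_def by simp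
  then have "(\<lambda>n. sqrt ((norm (R (P n) - R p))\<^sup>2)) \<longlonglongrightarrow> sqrt 0" by (rule tendsto_real_sqrt)
  then have "(\<lambda>n. norm (R (P n) - R p)) \<longlonglongrightarrow> 0"
    by (simp only: real_sqrt_abs abs_norm_cancel real_sqrt_zero)
  then have "(\<lambda>n. R (P n) - R p) \<longlonglongrightarrow> 0" by (rule tendsto_norm_zero_cancel)
  then have "(\<lambda>n. R (P n)) \<longlonglongrightarrow> R p" by (rule LIM_zero_cancel)
  then have "(\<lambda>n. (norm (R (P n)))\<^sup>2) \<longlonglongrightarrow> (norm (R p))\<^sup>2" by (intro tendsto_intros)
  then show ?thesis unfolding sq[OF loc(1)] sq[OF loc(2)] .
qed

text \<open>The bounded intervals \<open>(0, m)\<close> with natural \<open>m\<close> contribute countably many exceptional sets.\<close>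

lemma ae_derivative_of_integral:
  fixes g E :: "real \<Rightarrow> real"
  assumes g: "\<And>T. 0 < T \<Longrightarrow> g integrable_on {0..T}" and E: "\<And>t. 0 \<le> t \<Longrightarrow> E t = c + integral {0..t} g"
  shows "AE t in lebesgue. 0 < t \<longrightarrow> (E has_real_derivative g t) (at t)"
proof -
  have "\<exists>N. negligible N \<and> (\<forall>t. 0 < t \<longrightarrow> t < real (Suc m) \<longrightarrow> t \<notin> N \<longrightarrow> ((\<lambda>t. integral {0..t} g) has_vector_derivative g t) (at t))" for m
    using indefinite_integral_ae_differentiable[OF g[of "real (Suc m)"]] by (metis of_nat_0_less_iff zero_less_Suc)
  then obtain N where N: "\<And>m. negligible (N m)"
    "\<And>m t. 0 < t \<Longrightarrow> t < real (Suc m) \<Longrightarrow> t \<notin> N m \<Longrightarrow> ((\<lambda>t. integral {0..t} g) has_vector_derivative g t) (at t)"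
    by metis
  have "(\<Union>m. N m) \<in> null_sets lebesgue"
    using N(1) by (intro null_sets_UN) (simp flip: negligible_iff_null_sets)
  then have "AE t in lebesgue. t \<notin> (\<Union>m. N m)" by (rule AE_not_in)
  then show ?thesis
  proof eventually_elim
    case (elim t)
    show ?case
    proof
      assume t: "0 < t"
      obtain m where "t < real (Suc m)" using reals_Archimedean2[of t] by (metis less_trans lessI of_nat_less_iff)
      then have "((\<lambda>t. integral {0..t} g) has_vector_derivative g t) (at t)" using N(2)[OF t] elim by blast
      then have "((\<lambda>t. integral {0..t} g) has_real_derivative g t) (at t)"
        by (simp add: has_real_derivative_iff_has_vector_derivative)
      then have "((\<lambda>t. c + integral {0..t} g) has_real_derivative 0 + g t) (at t)"
        by (intro DERIV_add DERIV_const)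
      then have "((\<lambda>t. c + integral {0..t} g) has_real_derivative g t) (at t)" by simp
      then show "(E has_real_derivative g t) (at t)"
        by (rule has_field_derivative_transform_within_open[where S = "{0<..}"]) (use t E in auto)
    qed
  qed
qed

context maximal_dissipative
begin

context
  fixes \<tau> :: "'a \<Rightarrow> complex" and C :: real
  assumes \<tau>_diff: "\<And>u v. u \<in> D \<Longrightarrow> v \<in> D \<Longrightarrow> \<tau> (u - v) = \<tau> u - \<tau> v"
    and \<tau>_bound: "\<And>u. u \<in> D \<Longrightarrow> (cmod (\<tau> u))\<^sup>2 \<le> - C * (A u \<bullet> u)"
    and C_pos: "0 < C"
begin

text \<open>\<open>\<tau>_bound\<close> at a difference shows that the trace is continuous for the graph norm.\<close>

lemma trace_continuous:
  assumes u: "u \<in> D"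
  shows "continuous_on {0..} (\<lambda>t. \<tau> (S t u))"
  unfolding continuous_on_def
proof
  fix t :: real assume t: "t \<in> {0..}"
  let ?b = "\<lambda>s. sqrt (C * (norm (S s (A u) - S t (A u)) * norm (S s u - S t u)))"
  show "((\<lambda>t. \<tau> (S t u)) \<longlongrightarrow> \<tau> (S t u)) (at t within {0..})"
  proof (rule LIM_zero_cancel, rule Lim_null_comparison)
    have "norm (\<tau> (S s u) - \<tau> (S t u)) \<le> ?b s" if s: "s \<in> {0..}" for s
    proof (rule real_le_rsqrt)
      have D: "S s u \<in> D" "S t u \<in> D" using S_in_D(1) u s t by auto
      have "(norm (\<tau> (S s u) - \<tau> (S t u)))\<^sup>2 \<le> C * (- (A (S s u - S t u) \<bullet> (S s u - S t u)))"
        using \<tau>_bound[OF D_intros(2)[OF D]] unfolding \<tau>_diff[OF D] by simp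
      also have "\<dots> \<le> C * (norm (A (S s u - S t u)) * norm (S s u - S t u))"
        using norm_cauchy_schwarz[of "- A (S s u - S t u)" "S s u - S t u"] C_pos by (intro mult_left_mono) auto
      also have "A (S s u - S t u) = S s (A u) - S t (A u)"
        using A_diff[OF D] S_in_D(2) u s t by simp
      finally show "(norm (\<tau> (S s u) - \<tau> (S t u)))\<^sup>2 \<le> C * (norm (S s (A u) - S t (A u)) * norm (S s u - S t u))" .
    qed
    then show "\<forall>\<^sub>F s in at t within {0..}. norm (\<tau> (S s u) - \<tau> (S t u)) \<le> ?b s"
      by (auto simp: eventually_at_filter)
    have "((\<lambda>s. S s v) \<longlongrightarrow> S t v) (at t within {0..})" if "v \<in> X" for v
      using continuous_on_S[OF that] t unfolding continuous_on_def by blast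
    note l = this[OF D_in_X[OF u]] this[OF A_in[OF u]]
    have "(?b \<longlongrightarrow> sqrt (C * (norm (S t (A u) - S t (A u)) * norm (S t u - S t u)))) (at t within {0..})"
      by (intro tendsto_intros l)
    then show "(?b \<longlongrightarrow> 0) (at t within {0..})" by simp
  qed
qed

text \<open>Integrate \<open>\<tau>_bound\<close> in time along a classical solution: \<open>A u \<bullet> u\<close> is the derivative of half the squared norm.\<close>

lemma trace_energy_le:
  assumes u: "u \<in> D" and T: "0 \<le> T"
  shows "integral {0..T} (\<lambda>t. (cmod (\<tau> (S t u)))\<^sup>2) \<le> C / 2 * (norm u)\<^sup>2"
proof -
  have "integral {0..T} (\<lambda>t. (cmod (\<tau> (S t u)))\<^sup>2) \<le> - C * ((norm (S T u))\<^sup>2 / 2 - (norm u)\<^sup>2 / 2)"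
  proof (rule has_integral_le)
    have "continuous_on {0..T} (\<lambda>t. \<tau> (S t u))"
      by (rule continuous_on_subset[OF trace_continuous[OF u]]) auto
    then show "((\<lambda>t. (cmod (\<tau> (S t u)))\<^sup>2) has_integral integral {0..T} (\<lambda>t. (cmod (\<tau> (S t u)))\<^sup>2)) {0..T}"
      by (intro integrable_integral integrable_continuous_real continuous_intros)
    show "((\<lambda>t. - C * (A (S t u) \<bullet> S t u)) has_integral - C * ((norm (S T u))\<^sup>2 / 2 - (norm u)\<^sup>2 / 2)) {0..T}"
      by (intro has_integral_mult_right dissipation_has_integral T u)
    show "(cmod (\<tau> (S t u)))\<^sup>2 \<le> - C * (A (S t u) \<bullet> S t u)" if "t \<in> {0..T}" for t
      using that by (intro \<tau>_bound S_in_D u) auto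
  qed
  also have "\<dots> = C / 2 * (norm u)\<^sup>2 - C / 2 * (norm (S T u))\<^sup>2" by (simp add: algebra_simps)
  also have "\<dots> \<le> C / 2 * (norm u)\<^sup>2" using C_pos by simp
  finally show ?thesis .
qed

text \<open>Extended by 0 to negative times, so that the trace of a classical solution becomes an element of \<^typ>\<open>L2\<close>.\<close>

definition trace_fun :: "'a \<Rightarrow> real \<Rightarrow> complex" where
  "trace_fun u t = (if 0 \<le> t then \<tau> (S t u) else 0)"

lemma trace_fun_measurable:
  assumes "u \<in> D" shows "trace_fun u \<in> borel_measurable lebesgue"
proof -
  have "(\<lambda>t. indicator {0..} t *\<^sub>R \<tau> (S t u)) \<in> borel_measurable borel"
    by (rule borel_measurable_continuous_on_indicator[OF _ trace_continuous[OF assms]]) auto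
  moreover have "(\<lambda>t. indicator {0..} t *\<^sub>R \<tau> (S t u)) = trace_fun u"
    by (auto simp: trace_fun_def indicator_def)
  ultimately show ?thesis by (intro measurable_completion) simp
qed

lemma trace_fun_square_integrable:
  assumes u: "u \<in> D"
  shows "square_integrable (trace_fun u)" "(LINT t|lebesgue. (cmod (trace_fun u t))\<^sup>2) \<le> C / 2 * (norm u)\<^sup>2"
proof -
  note m = trace_fun_measurable[OF u]
  have m2: "(\<lambda>t. (cmod (trace_fun u t))\<^sup>2) \<in> borel_measurable lebesgue"
    using m by measurable
  let ?f = "\<lambda>n t. ennreal (indicat_real {0..real n} t * (cmod (trace_fun u t))\<^sup>2)"
  have fn: "(\<integral>\<^sup>+t. ?f n t \<partial>lebesgue) \<le> ennreal (C / 2 * (norm u)\<^sup>2)" for n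
  proof -
    have "continuous_on {0..real n} (\<lambda>t. (cmod (\<tau> (S t u)))\<^sup>2)"
      by (intro continuous_intros continuous_on_subset[OF trace_continuous[OF u]]) auto
    then have ai: "(\<lambda>t. (cmod (\<tau> (S t u)))\<^sup>2) absolutely_integrable_on {0..real n}"
      by (rule absolutely_integrable_continuous_real)
    have eq: "indicat_real {0..real n} t * (cmod (trace_fun u t))\<^sup>2 = indicat_real {0..real n} t *\<^sub>R (cmod (\<tau> (S t u)))\<^sup>2" for t
      by (auto simp: indicator_def trace_fun_def)
    have "(\<integral>\<^sup>+t. ?f n t \<partial>lebesgue) = ennreal (LINT t:{0..real n}|lebesgue. (cmod (\<tau> (S t u)))\<^sup>2)"
      unfolding eq set_lebesgue_integral_def using ai
      by (intro nn_integral_eq_integral) (auto simp: set_integrable_def)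
    also have "\<dots> = ennreal (integral {0..real n} (\<lambda>t. (cmod (\<tau> (S t u)))\<^sup>2))"
      by (simp only: set_lebesgue_integral_eq_integral(2)[OF ai])
    also have "\<dots> \<le> ennreal (C / 2 * (norm u)\<^sup>2)"
      by (intro ennreal_leI trace_energy_le u) simp
    finally show ?thesis .
  qed
  have "(\<integral>\<^sup>+t. ennreal ((cmod (trace_fun u t))\<^sup>2) \<partial>lebesgue) = (\<integral>\<^sup>+t. liminf (\<lambda>n. ?f n t) \<partial>lebesgue)"
  proof (rule nn_integral_cong)
    fix t :: real
    obtain N where N: "t \<le> real N" using real_arch_simple by blast
    have "?f n t = ennreal ((cmod (trace_fun u t))\<^sup>2)" if "N \<le> n" for n
      using N that by (auto simp: indicator_def trace_fun_def)
    then have "(\<lambda>n. ?f n t) \<longlonglongrightarrow> ennreal ((cmod (trace_fun u t))\<^sup>2)"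
      by (intro tendsto_eventually eventually_sequentiallyI[of N])
    then show "ennreal ((cmod (trace_fun u t))\<^sup>2) = liminf (\<lambda>n. ?f n t)"
      by (rule lim_imp_Liminf[OF sequentially_bot, symmetric])
  qed
  also have "\<dots> \<le> liminf (\<lambda>n. \<integral>\<^sup>+t. ?f n t \<partial>lebesgue)"
  proof (rule nn_integral_liminf)
    have i: "indicat_real {0..real n} \<in> borel_measurable lebesgue" for n
      by (rule borel_measurable_indicator) auto
    show "?f n \<in> borel_measurable lebesgue" for n
      using borel_measurable_times[OF i m2] by (rule measurable_compose) simp
  qed
  also have "\<dots> \<le> ennreal (C / 2 * (norm u)\<^sup>2)"
  proof -
    have "\<forall>\<^sub>F n in sequentially. (\<integral>\<^sup>+t. ?f n t \<partial>lebesgue) \<le> ennreal (C / 2 * (norm u)\<^sup>2)"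
      using fn by (intro always_eventually allI)
    from Liminf_mono[OF this] show ?thesis by (simp add: Liminf_const)
  qed
  finally have le: "(\<integral>\<^sup>+t. ennreal ((cmod (trace_fun u t))\<^sup>2) \<partial>lebesgue) \<le> ennreal (C / 2 * (norm u)\<^sup>2)" .
  have int: "integrable lebesgue (\<lambda>t. (cmod (trace_fun u t))\<^sup>2)"
    by (rule integrableI_nonneg[OF m2]) (use le in \<open>auto simp: order.strict_trans1\<close>)
  then show "square_integrable (trace_fun u)" using m unfolding square_integrable_def by blast
  have "ennreal (LINT t|lebesgue. (cmod (trace_fun u t))\<^sup>2) \<le> ennreal (C / 2 * (norm u)\<^sup>2)"
    using le by (subst (asm) nn_integral_eq_integral[OF int]) auto
  then show "(LINT t|lebesgue. (cmod (trace_fun u t))\<^sup>2) \<le> C / 2 * (norm u)\<^sup>2"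
    using C_pos by (subst (asm) ennreal_le_iff) auto
qed

lemma trace_fun_diff:
  assumes "u \<in> D" "v \<in> D"
  shows "trace_fun u t - trace_fun v t = trace_fun (u - v) t"
  unfolding trace_fun_def using assms S_in_D(1) D_in_X by (simp add: S_diff \<tau>_diff)

lemma norm_trace_diff_le:
  assumes "u \<in> D" "v \<in> D"
  shows "norm (abs_L2 (trace_fun u) - abs_L2 (trace_fun v)) \<le> sqrt (C / 2) * norm (u - v)"
proof (rule power2_le_imp_le)
  note d = D_intros(2)[OF assms]
  have "abs_L2 (trace_fun u) - abs_L2 (trace_fun v) = abs_L2 (trace_fun (u - v))"
    using abs_L2_diff[OF trace_fun_square_integrable(1)[OF assms(1)] trace_fun_square_integrable(1)[OF assms(2)]]
    unfolding trace_fun_diff[OF assms] .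
  then show "(norm (abs_L2 (trace_fun u) - abs_L2 (trace_fun v)))\<^sup>2 \<le> (sqrt (C / 2) * norm (u - v))\<^sup>2"
    using trace_fun_square_integrable[OF d] C_pos by (simp add: norm_abs_L2_sq power_mult_distrib)
qed (use C_pos in auto)

text \<open>By \<open>norm_trace_diff_le\<close> the trace map is Lipschitz from the norm of the initial datum to \<open>L\<^sup>2\<close> of the half-line,
  so the limit exists in the complete space \<^typ>\<open>L2\<close> and does not depend on the approximating sequence.\<close>

lemma traces_exist:
  assumes u0: "u0 \<in> X"
  shows "\<exists>p. \<forall>v. (\<forall>n. v n \<in> D) \<and> v \<longlonglongrightarrow> u0 \<longrightarrow> L2_loc_tendsto (\<lambda>n t. \<tau> (S t (v n))) p"
proof -
  define e where "e u = abs_L2 (trace_fun u)" for u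
  define w where "w n = J (1 / real (Suc n)) u0" for n
  have w: "w n \<in> D" for n unfolding w_def by (rule J_props(1)[OF _ u0]) simp
  have wl: "w \<longlonglongrightarrow> u0" unfolding w_def by (rule J_tendsto[OF u0])
  define K where "K = sqrt (C / 2)"
  have K: "0 < K" unfolding K_def using C_pos by simp
  have e: "norm (e u - e v) \<le> K * norm (u - v)" if "u \<in> D" "v \<in> D" for u v
    unfolding e_def K_def by (rule norm_trace_diff_le[OF that])
  have "Cauchy (\<lambda>n. e (w n))"
  proof (rule CauchyI)
    fix r :: real assume r: "0 < r"
    then have "0 < r / K" using K by simp
    from CauchyD[OF LIMSEQ_imp_Cauchy[OF wl] this]
    obtain M where M: "\<forall>m\<ge>M. \<forall>n\<ge>M. norm (w m - w n) < r / K" by blast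
    have "norm (e (w m) - e (w n)) < r" if "M \<le> m" "M \<le> n" for m n
    proof -
      have "norm (w m - w n) < r / K" using M that by blast
      then have "K * norm (w m - w n) < r" using K by (simp add: pos_less_divide_eq mult.commute)
      then show ?thesis using e[OF w w, of m n] by linarith
    qed
    then show "\<exists>M. \<forall>m\<ge>M. \<forall>n\<ge>M. norm (e (w m) - e (w n)) < r" by blast
  qed
  then obtain P where P: "(\<lambda>n. e (w n)) \<longlonglongrightarrow> P" using Cauchy_convergent_iff convergent_def by blast
  have loc: "L2_loc f" if "square_integrable g" "\<And>t. 0 \<le> t \<Longrightarrow> f t = g t" for f g
    unfolding L2_loc_def
  proof (intro allI impI conjI)
    fix T :: real
    have eq: "(\<lambda>t. indicat_real {0..T} t *\<^sub>R f t) = (\<lambda>t. indicat_real {0..T} t *\<^sub>R g t)"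
      "(\<lambda>t. indicat_real {0..T} t *\<^sub>R (cmod (f t))\<^sup>2) = (\<lambda>t. indicat_real {0..T} t *\<^sub>R (cmod (g t))\<^sup>2)"
      using that(2) by (auto simp: indicator_def fun_eq_iff)
    have i: "indicat_real {0..T} \<in> borel_measurable lebesgue" by (rule borel_measurable_indicator) auto
    show "set_borel_measurable lebesgue {0..T} f"
      unfolding set_borel_measurable_def eq
      by (rule borel_measurable_scaleR[OF i]) (use that(1) in \<open>simp add: square_integrable_def\<close>)
    show "set_integrable lebesgue {0..T} (\<lambda>t. (cmod (f t))\<^sup>2)"
      unfolding set_integrable_def eq
      by (rule integrable_mult_indicator) (use that(1) in \<open>auto simp: square_integrable_def\<close>)
  qed
  show ?thesis
  proof (intro exI[of _ "rep_L2 P"] allI impI)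
    fix v assume v: "(\<forall>n. v n \<in> D) \<and> v \<longlonglongrightarrow> u0"
    have "(\<lambda>n. norm (e (v n) - P)) \<longlonglongrightarrow> 0"
    proof (rule Lim_null_comparison)
      have "norm (e (v n) - P) \<le> K * norm (v n - w n) + norm (e (w n) - P)" for n
        using norm_triangle_ineq[of "e (v n) - e (w n)" "e (w n) - P"] e[of "v n" "w n"] v w by simp
      then show "\<forall>\<^sub>F n in sequentially. norm (norm (e (v n) - P)) \<le> K * norm (v n - w n) + norm (e (w n) - P)"
        by simp
      have "(\<lambda>n. K * norm (v n - w n) + norm (e (w n) - P)) \<longlonglongrightarrow> K * norm (u0 - u0) + norm (P - P)"
        using v wl P by (intro tendsto_intros) auto
      then show "(\<lambda>n. K * norm (v n - w n) + norm (e (w n) - P)) \<longlonglongrightarrow> 0" by simp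
    qed
    then have lim: "(\<lambda>n. (norm (e (v n) - P))\<^sup>2) \<longlonglongrightarrow> 0"
      using tendsto_power[of _ 0 sequentially 2] by fastforce
    show "L2_loc_tendsto (\<lambda>n t. \<tau> (S t (v n))) (rep_L2 P)"
      unfolding L2_loc_tendsto_def
    proof (intro conjI allI impI)
      show "L2_loc (\<lambda>t. \<tau> (S t (v n)))" for n
        using v by (intro loc[OF trace_fun_square_integrable(1)[of "v n"]]) (auto simp: trace_fun_def)
      show "L2_loc (rep_L2 P)" by (rule loc[OF square_integrable_rep refl])
      fix T :: real assume T: "0 < T"
      show "(\<lambda>n. LINT t:{0..T}|lebesgue. (cmod (\<tau> (S t (v n)) - rep_L2 P t))\<^sup>2) \<longlonglongrightarrow> 0"
      proof (rule Lim_null_comparison[OF _ lim], intro always_eventually allI)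
        fix n
        have vn: "v n \<in> D" using v by blast
        note sq = trace_fun_square_integrable(1)[OF vn]
        have sqd: "square_integrable (\<lambda>t. trace_fun (v n) t - rep_L2 P t)"
          by (rule square_integrable_diff[OF sq square_integrable_rep])
        have "e (v n) - P = abs_L2 (\<lambda>t. trace_fun (v n) t - rep_L2 P t)"
          using abs_L2_diff[OF sq square_integrable_rep, of P] unfolding e_def abs_rep_L2 .
        then have nrm: "(norm (e (v n) - P))\<^sup>2 = (LINT t|lebesgue. (cmod (trace_fun (v n) t - rep_L2 P t))\<^sup>2)"
          by (simp only: norm_abs_L2_sq[OF sqd])
        have eq: "indicat_real {0..T} t *\<^sub>R (cmod (\<tau> (S t (v n)) - rep_L2 P t))\<^sup>2
            = indicat_real {0..T} t *\<^sub>R (cmod (trace_fun (v n) t - rep_L2 P t))\<^sup>2" for t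
          by (auto simp: indicator_def trace_fun_def)
        have I: "integrable lebesgue (\<lambda>t. (cmod (trace_fun (v n) t - rep_L2 P t))\<^sup>2)"
          using sqd unfolding square_integrable_def by blast
        have "(LINT t:{0..T}|lebesgue. (cmod (\<tau> (S t (v n)) - rep_L2 P t))\<^sup>2) \<le> (norm (e (v n) - P))\<^sup>2"
          unfolding nrm set_lebesgue_integral_def eq
        proof (rule integral_mono[OF _ I])
          show "integrable lebesgue (\<lambda>t. indicat_real {0..T} t *\<^sub>R (cmod (trace_fun (v n) t - rep_L2 P t))\<^sup>2)"
            by (rule integrable_mult_indicator[OF _ I]) auto
        qed (auto simp: indicator_def)
        moreover have "0 \<le> (LINT t:{0..T}|lebesgue. (cmod (\<tau> (S t (v n)) - rep_L2 P t))\<^sup>2)"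
          unfolding set_lebesgue_integral_def by (intro integral_nonneg_AE) (auto intro!: AE_I2)
        ultimately show "norm (LINT t:{0..T}|lebesgue. (cmod (\<tau> (S t (v n)) - rep_L2 P t))\<^sup>2) \<le> (norm (e (v n) - P))\<^sup>2"
          by simp
      qed
    qed
  qed
qed

end

end

section \<open>Primitives of integrable functions\<close>

definition eq_ae :: "real \<Rightarrow> (real \<Rightarrow> 'a) \<Rightarrow> (real \<Rightarrow> 'a) \<Rightarrow> bool" where
  "eq_ae l f g \<longleftrightarrow> (AE y in lebesgue. y \<in> {0<..<l} \<longrightarrow> f y = g y)"

text \<open>\<open>U\<close> is absolutely continuous on \<open>[0,l]\<close> with derivative \<open>g\<close> almost everywhere, in integrated form.\<close>

definition primitive :: "real \<Rightarrow> (real \<Rightarrow> 'a::euclidean_space) \<Rightarrow> (real \<Rightarrow> 'a) \<Rightarrow> bool" where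
  "primitive l U g \<longleftrightarrow> g absolutely_integrable_on {0..l} \<and> (\<forall>x\<in>{0..l}. U x = U 0 + integral {0..x} g)"

lemma eq_ae_refl: "eq_ae l f f" by (simp add: eq_ae_def)
lemma eq_ae_sym: "eq_ae l f g \<Longrightarrow> eq_ae l g f" by (simp add: eq_ae_def eq_commute)
lemma eq_ae_trans:
  assumes "eq_ae l f g" "eq_ae l g h" shows "eq_ae l f h"
  using assms unfolding eq_ae_def by eventually_elim auto

lemma eq_ae_obtain:
  assumes "eq_ae l f g"
  obtains N where "negligible N" "\<And>x. x \<in> {0..l} - N \<Longrightarrow> g x = f x"
proof -
  from AE_E3[OF assms[unfolded eq_ae_def]] obtain N where
    N: "\<And>x. x \<in> space lebesgue - N \<Longrightarrow> x \<in> {0<..<l} \<longrightarrow> f x = g x" "N \<in> null_sets lebesgue" by blast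
  show thesis
  proof (rule that)
    show "negligible (N \<union> {0, l})" using N(2) by (auto simp: negligible_iff_null_sets[symmetric])
    show "g x = f x" if "x \<in> {0..l} - (N \<union> {0, l})" for x
      using N(1)[of x] that by auto
  qed
qed

lemma absolutely_integrable_eq_ae:
  fixes f :: "real \<Rightarrow> 'a::euclidean_space"
  assumes "eq_ae l f g" "f absolutely_integrable_on {0..l}"
  shows "g absolutely_integrable_on {0..l}"
proof -
  obtain N where N: "negligible N" "\<And>x. x \<in> {0..l} - N \<Longrightarrow> g x = f x"
    using eq_ae_obtain[OF assms(1)] by blast
  show ?thesis by (rule absolutely_integrable_spike[OF assms(2) N])
qed

lemma integral_eq_ae:
  fixes f :: "real \<Rightarrow> 'a::euclidean_space"
  assumes "eq_ae l f g" "x \<le> l"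
  shows "integral {0..x} f = integral {0..x} g"
proof -
  obtain N where N: "negligible N" "\<And>x. x \<in> {0..l} - N \<Longrightarrow> g x = f x"
    using eq_ae_obtain[OF assms(1)] by blast
  show ?thesis by (rule integral_spike[OF N(1)]) (use N(2) assms(2) in auto)
qed

lemma primitive_cong_ae:
  assumes "eq_ae l f g" "primitive l U f" shows "primitive l U g"
  unfolding primitive_def
proof (intro conjI ballI)
  show "g absolutely_integrable_on {0..l}"
    by (rule absolutely_integrable_eq_ae[OF assms(1)]) (use assms(2) in \<open>unfold primitive_def, blast\<close>)
  fix x assume x: "x \<in> {0..l}"
  have "U x = U 0 + integral {0..x} f" using assms(2) x unfolding primitive_def by blast
  then show "U x = U 0 + integral {0..x} g" using integral_eq_ae[OF assms(1), of x] x by simp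
qed

lemma primitive_absint: "primitive l U g \<Longrightarrow> g absolutely_integrable_on {0..l}"
  unfolding primitive_def by blast

lemma primitive_eq: "primitive l U g \<Longrightarrow> x \<in> {0..l} \<Longrightarrow> U x = U 0 + integral {0..x} g"
  unfolding primitive_def by blast

lemma absolutely_integrable_sub:
  fixes g :: "real \<Rightarrow> 'a::euclidean_space"
  assumes "g absolutely_integrable_on {0..l}" "0 \<le> x" "y \<le> l"
  shows "g absolutely_integrable_on {x..y}" "g integrable_on {x..y}"
proof -
  show "g absolutely_integrable_on {x..y}"
    by (rule set_integrable_subset[OF assms(1)]) (use assms in auto)
  then show "g integrable_on {x..y}" by (rule set_lebesgue_integral_eq_integral(1))
qed

lemma primitive_increment:
  assumes "primitive l U g" "0 \<le> x" "x \<le> y" "y \<le> l"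
  shows "U y - U x = integral {x..y} g"
proof -
  have "integral {0..x} g + integral {x..y} g = integral {0..y} g"
    by (rule Henstock_Kurzweil_Integration.integral_combine[OF assms(2,3)])
       (use absolutely_integrable_sub(2)[OF primitive_absint[OF assms(1)], of 0 y] assms in auto)
  moreover have "U y = U 0 + integral {0..y} g" "U x = U 0 + integral {0..x} g"
    using assms by (intro primitive_eq[OF assms(1)]; simp)+
  ultimately show ?thesis by (simp add: algebra_simps)
qed

lemma primitiveI:
  assumes "g absolutely_integrable_on {0..l}" "\<And>x. 0 \<le> x \<Longrightarrow> x \<le> l \<Longrightarrow> U x - U 0 = integral {0..x} g"
  shows "primitive l U g"
  unfolding primitive_def
proof (intro conjI ballI)
  show "U x = U 0 + integral {0..x} g" if "x \<in> {0..l}" for x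
    using assms(2)[of x, symmetric] that by simp
qed (rule assms(1))

lemma primitive_continuous:
  assumes "primitive l U g" shows "continuous_on {0..l} U"
proof -
  have "g integrable_on {0..l}" using absolutely_integrable_sub(2)[OF primitive_absint[OF assms]] by simp
  then have "continuous_on {0..l} (\<lambda>x. U 0 + integral {0..x} g)"
    by (intro continuous_intros indefinite_integral_continuous_1)
  then show ?thesis by (rule continuous_on_eq) (rule primitive_eq[OF assms, symmetric])
qed

lemma continuous_absint:
  fixes f :: "real \<Rightarrow> 'a::euclidean_space"
  shows "continuous_on {a..b} f \<Longrightarrow> f absolutely_integrable_on {a..b}"
  by (rule absolutely_integrable_continuous_real)

lemma primitive_C1:
  fixes U :: "real \<Rightarrow> 'a::euclidean_space"
  assumes "\<And>x. 0 \<le> x \<Longrightarrow> x \<le> l \<Longrightarrow> (U has_vector_derivative g x) (at x within {0..l})" "continuous_on {0..l} g"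
  shows "primitive l U g"
proof (rule primitiveI)
  show "U x - U 0 = integral {0..x} g" if "0 \<le> x" "x \<le> l" for x
  proof -
    have "(g has_integral (U x - U 0)) {0..x}"
      using that by (intro fundamental_theorem_of_calculus has_vector_derivative_within_subset[OF assms(1)]) auto
    then show ?thesis by (simp add: integral_unique)
  qed
qed (use continuous_absint assms in auto)

lemma primitive_linear:
  fixes U :: "real \<Rightarrow> 'a::euclidean_space" and T :: "'a \<Rightarrow> 'b::euclidean_space"
  assumes "primitive l U g" "bounded_linear T"
  shows "primitive l (\<lambda>x. T (U x)) (\<lambda>x. T (g x))"
proof (rule primitiveI)
  interpret bounded_linear T by fact
  show "(\<lambda>x. T (g x)) absolutely_integrable_on {0..l}"
    using absolutely_integrable_linear[OF primitive_absint[OF assms(1)] assms(2)] by (simp add: o_def)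
  fix x assume x: "0 \<le> x" "x \<le> l"
  have "T (U x) - T (U 0) = T (integral {0..x} g)"
    using primitive_increment[OF assms(1) order_refl x] diff by metis
  also have "\<dots> = integral {0..x} (\<lambda>x. T (g x))"
    using integral_linear[OF absolutely_integrable_sub(2)[OF primitive_absint[OF assms(1)] order_refl x(2)] assms(2)] by (simp add: o_def)
  finally show "T (U x) - T (U 0) = integral {0..x} (\<lambda>x. T (g x))" .
qed

lemma primitive_add:
  assumes "primitive l U g" "primitive l V h"
  shows "primitive l (\<lambda>x. U x + V x) (\<lambda>x. g x + h x)"
proof (rule primitiveI)
  show "(\<lambda>x. g x + h x) absolutely_integrable_on {0..l}"
    by (intro set_integral_add primitive_absint[OF assms(1)] primitive_absint[OF assms(2)])
  fix x assume x: "0 \<le> x" "x \<le> l"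
  have "integral {0..x} (\<lambda>x. g x + h x) = integral {0..x} g + integral {0..x} h"
    using absolutely_integrable_sub(2)[OF primitive_absint _ x(2)] assms by (intro Henstock_Kurzweil_Integration.integral_add) auto
  then show "U x + V x - (U 0 + V 0) = integral {0..x} (\<lambda>x. g x + h x)"
    using primitive_increment[OF assms(1) order_refl x] primitive_increment[OF assms(2) order_refl x]
    by (simp add: algebra_simps)
qed

lemma primitive_exists:
  assumes "g absolutely_integrable_on {0..l}"
  shows "primitive l (\<lambda>x. c + integral {0..x} g) g"
  by (rule primitiveI) (use assms in auto)

text \<open>Summed over a partition into short intervals, the increments of \<open>H\<close> are at most \<open>e\<close> times the total increment
  of \<open>M\<close>. In the application to products, \<open>M\<close> is the integral of the norms of the derivatives, which need
  not be bounded.\<close>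

lemma constant_if_small_increments:
  fixes H :: "real \<Rightarrow> 'a::real_normed_vector" and M :: "real \<Rightarrow> real"
  assumes "0 \<le> b"
    and small: "\<And>e. 0 < e \<Longrightarrow> \<exists>d>0. \<forall>x y. 0 \<le> x \<longrightarrow> x \<le> y \<longrightarrow> y \<le> b \<longrightarrow> y - x < d \<longrightarrow> norm (H y - H x) \<le> e * (M y - M x)"
  shows "H b = H 0"
proof -
  have le: "norm (H b - H 0) \<le> e * (M b - M 0)" if e: "0 < e" for e
  proof -
    obtain d where d: "0 < d" "\<And>x y. 0 \<le> x \<Longrightarrow> x \<le> y \<Longrightarrow> y \<le> b \<Longrightarrow> y - x < d \<Longrightarrow> norm (H y - H x) \<le> e * (M y - M x)"
      using small[OF e] by blast
    obtain n where n: "b / d < real n" using reals_Archimedean2 by blast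
    have n0: "0 < n" using n d(1) assms(1) by (cases n) (auto simp: divide_less_0_iff)
    define p where "p i = real i * (b / real n)" for i
    have p0: "p 0 = 0" "p n = b" unfolding p_def using n0 by auto
    have step: "p (Suc i) - p i = b / real n" for i unfolding p_def by (simp add: algebra_simps add_divide_distrib)
    have bn: "0 \<le> b / real n" "b / real n < d" using n n0 d(1) assms(1) by (auto simp: field_simps)
    have "norm (H b - H 0) = norm (\<Sum>i<n. H (p (Suc i)) - H (p i))"
      by (simp add: sum_lessThan_telescope[of "\<lambda>i. H (p i)"] p0)
    also have "\<dots> \<le> (\<Sum>i<n. norm (H (p (Suc i)) - H (p i)))" by (rule norm_sum)
    also have "\<dots> \<le> (\<Sum>i<n. e * (M (p (Suc i)) - M (p i)))"
    proof (rule sum_mono)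
      fix i assume "i \<in> {..<n}"
      then have "p (Suc i) \<le> p n"
        unfolding p_def using bn by (intro mult_right_mono) auto
      moreover have "0 \<le> p i" unfolding p_def using bn(1) by (intro mult_nonneg_nonneg) auto
      ultimately show "norm (H (p (Suc i)) - H (p i)) \<le> e * (M (p (Suc i)) - M (p i))"
        using step[of i] bn p0 by (intro d(2)) auto
    qed
    also have "\<dots> = e * (\<Sum>i<n. M (p (Suc i)) - M (p i))" by (simp only: sum_distrib_left)
    also have "\<dots> = e * (M b - M 0)" by (simp only: sum_lessThan_telescope[of "\<lambda>i. M (p i)"] p0)
    finally show ?thesis .
  qed
  have "norm (H b - H 0) \<le> 0"
  proof (rule field_le_epsilon)
    fix e :: real assume e: "0 < e"
    have "norm (H b - H 0) \<le> e / (\<bar>M b - M 0\<bar> + 1) * (M b - M 0)"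
      by (rule le) (use e in \<open>simp add: add_nonneg_pos\<close>)
    also have "\<dots> \<le> e / (\<bar>M b - M 0\<bar> + 1) * (\<bar>M b - M 0\<bar> + 1)"
      using e by (intro mult_left_mono) auto
    also have "\<dots> = e"
    proof -
      have "\<bar>M b - M 0\<bar> + 1 \<noteq> 0" by linarith
      then show ?thesis by simp
    qed
    finally show "norm (H b - H 0) \<le> 0 + e" by simp
  qed
  then show ?thesis by simp
qed

lemma absint_product_continuous:
  fixes p :: "'a::euclidean_space \<Rightarrow> 'b::euclidean_space \<Rightarrow> 'c::euclidean_space" and a b :: real
  assumes "bounded_bilinear p" "continuous_on {a..b} U" "g absolutely_integrable_on {a..b}"
  shows "(\<lambda>x. p (U x) (g x)) absolutely_integrable_on {a..b}"
proof (rule absolutely_integrable_bounded_measurable_product[where h = p])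
  show "bilinear p" using assms(1) by (simp add: bilinear_conv_bounded_bilinear)
  show "U \<in> borel_measurable (lebesgue_on {a..b})"
    by (rule continuous_imp_measurable_on_sets_lebesgue[OF assms(2)]) auto
  show "bounded (U ` {a..b})"
    by (intro compact_imp_bounded compact_continuous_image assms) simp
  show "{a..b} \<in> sets lebesgue" by auto
qed (rule assms(3))

text \<open>The difference \<open>H\<close> between the product and the claimed integral has an increment over \<open>[x,y]\<close> equal to the
  integral of \<open>p (g s) (V y - V s) + p (U x - U s) (h s)\<close>, which is small relative to the integral of the norms of \<open>g\<close> and \<open>h\<close>
  by uniform continuity of \<open>U\<close> and \<open>V\<close>.\<close>

lemma primitive_product:
  fixes p :: "'a::euclidean_space \<Rightarrow> 'b::euclidean_space \<Rightarrow> 'c::euclidean_space"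
  assumes p: "bounded_bilinear p" and U: "primitive l U g" and V: "primitive l V h"
  shows "primitive l (\<lambda>x. p (U x) (V x)) (\<lambda>x. p (g x) (V x) + p (U x) (h x))"
proof (rule primitiveI)
  interpret p: bounded_bilinear p by fact
  note cU = primitive_continuous[OF U] and cV = primitive_continuous[OF V]
  have i1: "(\<lambda>x. p (U x) (h x)) absolutely_integrable_on {0..l}"
    by (rule absint_product_continuous[OF p cU primitive_absint[OF V]])
  have i2: "(\<lambda>x. p (g x) (V x)) absolutely_integrable_on {0..l}"
    by (rule absint_product_continuous[OF bounded_bilinear.flip[OF p] cV primitive_absint[OF U]])
  let ?k = "\<lambda>x. p (g x) (V x) + p (U x) (h x)"
  show k: "?k absolutely_integrable_on {0..l}" by (intro set_integral_add i1 i2)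
  have ng: "(\<lambda>s. norm (g s) + norm (h s)) absolutely_integrable_on {0..l}"
    by (intro set_integral_add absolutely_integrable_norm[unfolded o_def] primitive_absint[OF U] primitive_absint[OF V])
  fix b assume b: "0 \<le> b" "b \<le> l"
  let ?H = "\<lambda>x. p (U x) (V x) - integral {0..x} ?k"
  let ?M = "\<lambda>x. integral {0..x} (\<lambda>s. norm (g s) + norm (h s))"
  have "?H b = ?H 0"
  proof (rule constant_if_small_increments[OF b(1), where M = ?M])
    fix e :: real assume e: "0 < e"
    obtain K where K: "0 < K" "\<And>a b. norm (p a b) \<le> norm a * norm b * K" using p.pos_bounded by blast
    have eK: "0 < e / K" using e K by simp
    have uU: "uniformly_continuous_on {0..l} U" and uV: "uniformly_continuous_on {0..l} V"
      using cU cV by (simp_all add: compact_uniformly_continuous)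
    obtain d1 where d1: "0 < d1" "\<And>x y. x \<in> {0..l} \<Longrightarrow> y \<in> {0..l} \<Longrightarrow> dist y x < d1 \<Longrightarrow> dist (U y) (U x) < e / K"
      using uU[unfolded uniformly_continuous_on_def] eK by blast
    obtain d2 where d2: "0 < d2" "\<And>x y. x \<in> {0..l} \<Longrightarrow> y \<in> {0..l} \<Longrightarrow> dist y x < d2 \<Longrightarrow> dist (V y) (V x) < e / K"
      using uV[unfolded uniformly_continuous_on_def] eK by blast
    have "norm (?H y - ?H x) \<le> e * (?M y - ?M x)"
      if xy: "0 \<le> x" "x \<le> y" "y \<le> b" "y - x < min d1 d2" for x y
    proof -
      have yl: "y \<le> l" "0 \<le> y" "x \<le> l" using xy b by auto
      have gi: "g integrable_on {x..y}" "h integrable_on {x..y}"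
        using absolutely_integrable_sub(2)[OF primitive_absint] U V xy yl by blast+
      have ki: "?k integrable_on {x..y}" using absolutely_integrable_sub(2)[OF k xy(1) yl(1)] .
      have inc: "integral {0..y} f - integral {0..x} f = integral {x..y} f"
        if "f absolutely_integrable_on {0..l}" for f :: "real \<Rightarrow> 'd::euclidean_space"
        using primitive_increment[OF primitive_exists[OF that, of 0] xy(1,2) yl(1)] by simp
      have a: "p (U y - U x) (V y) = integral {x..y} (\<lambda>s. p (g s) (V y))"
        unfolding primitive_increment[OF U xy(1,2) yl(1)]
        using integral_linear[OF gi(1) p.bounded_linear_left] by (simp add: o_def)
      have c: "p (U x) (V y - V x) = integral {x..y} (\<lambda>s. p (U x) (h s))"
        unfolding primitive_increment[OF V xy(1,2) yl(1)]
        using integral_linear[OF gi(2) p.bounded_linear_right] by (simp add: o_def)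
      have ai: "(\<lambda>s. p (g s) (V y)) integrable_on {x..y}" "(\<lambda>s. p (U x) (h s)) integrable_on {x..y}"
        using integrable_linear[OF gi(1) p.bounded_linear_left] integrable_linear[OF gi(2) p.bounded_linear_right]
        by (simp_all add: o_def)
      have "?H y - ?H x = p (U y - U x) (V y) + p (U x) (V y - V x) - integral {x..y} ?k"
        using inc[OF k] by (simp add: p.diff_left p.diff_right algebra_simps)
      also have "\<dots> = integral {x..y} (\<lambda>s. p (g s) (V y) + p (U x) (h s) - ?k s)"
        unfolding a c using ai ki
        by (simp only: Henstock_Kurzweil_Integration.integral_diff Henstock_Kurzweil_Integration.integral_add integrable_add)
      also have "norm \<dots> \<le> integral {x..y} (\<lambda>s. e * (norm (g s) + norm (h s)))"
      proof (rule Henstock_Kurzweil_Integration.integral_norm_bound_integral)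
        show "(\<lambda>s. p (g s) (V y) + p (U x) (h s) - ?k s) integrable_on {x..y}"
          by (intro integrable_diff integrable_add ai ki)
        show "(\<lambda>s. e * (norm (g s) + norm (h s))) integrable_on {x..y}"
          by (intro integrable_on_mult_right absolutely_integrable_sub(2)[OF ng xy(1) yl(1)])
        fix s assume s: "s \<in> {x..y}"
        have "norm (V y - V s) \<le> e / K" "norm (U x - U s) \<le> e / K"
          using d1(2)[of s x] d2(2)[of s y] s xy yl b by (auto simp: dist_norm)
        then have "norm (p (g s) (V y - V s)) \<le> e * norm (g s)" "norm (p (U x - U s) (h s)) \<le> e * norm (h s)"
        proof -
          assume *: "norm (V y - V s) \<le> e / K" "norm (U x - U s) \<le> e / K"
          have "norm (p (g s) (V y - V s)) \<le> norm (g s) * norm (V y - V s) * K" by (rule K(2))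
          also have "\<dots> \<le> norm (g s) * (e / K) * K" using * K(1) by (intro mult_right_mono mult_left_mono) auto
          finally show "norm (p (g s) (V y - V s)) \<le> e * norm (g s)" using K(1) by (simp add: mult.commute)
          have "norm (p (U x - U s) (h s)) \<le> norm (U x - U s) * norm (h s) * K" by (rule K(2))
          also have "\<dots> \<le> (e / K) * norm (h s) * K" using * K(1) by (intro mult_right_mono) auto
          finally show "norm (p (U x - U s) (h s)) \<le> e * norm (h s)" using K(1) by simp
        qed
        moreover have "p (g s) (V y) + p (U x) (h s) - ?k s = p (g s) (V y - V s) + p (U x - U s) (h s)"
          by (simp add: p.diff_left p.diff_right)
        ultimately show "norm (p (g s) (V y) + p (U x) (h s) - ?k s) \<le> e * (norm (g s) + norm (h s))"
          using norm_triangle_ineq[of "p (g s) (V y - V s)" "p (U x - U s) (h s)"] by (simp add: algebra_simps)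
      qed
      also have "\<dots> = e * (?M y - ?M x)" using inc[OF ng] by simp
      finally show ?thesis .
    qed
    then show "\<exists>d>0. \<forall>x y. 0 \<le> x \<longrightarrow> x \<le> y \<longrightarrow> y \<le> b \<longrightarrow> y - x < d \<longrightarrow> norm (?H y - ?H x) \<le> e * (?M y - ?M x)"
      using d1(1) d2(1) by (intro exI[of _ "min d1 d2"]) auto
  qed
  then show "p (U b) (V b) - p (U 0) (V 0) = integral {0..b} ?k" by (simp add: algebra_simps)
qed

lemma primitive_by_parts:
  fixes p :: "'a::euclidean_space \<Rightarrow> 'b::euclidean_space \<Rightarrow> 'c::euclidean_space"
  assumes p: "bounded_bilinear p" and U: "primitive l U g" and V: "primitive l V h" and l: "0 \<le> l"
  shows "integral {0..l} (\<lambda>x. p (g x) (V x)) + integral {0..l} (\<lambda>x. p (U x) (h x)) = p (U l) (V l) - p (U 0) (V 0)"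
proof -
  have "(\<lambda>x. p (U x) (h x)) absolutely_integrable_on {0..l}" "(\<lambda>x. p (g x) (V x)) absolutely_integrable_on {0..l}"
    using absint_product_continuous[OF p primitive_continuous[OF U] primitive_absint[OF V]]
      absint_product_continuous[OF bounded_bilinear.flip[OF p] primitive_continuous[OF V] primitive_absint[OF U]] .
  then have "integral {0..l} (\<lambda>x. p (g x) (V x)) + integral {0..l} (\<lambda>x. p (U x) (h x))
      = integral {0..l} (\<lambda>x. p (g x) (V x) + p (U x) (h x))"
    using absolutely_integrable_sub(2)[OF _ order_refl order_refl] by (subst Henstock_Kurzweil_Integration.integral_add) auto
  then show ?thesis using primitive_increment[OF primitive_product[OF p U V] order_refl l order_refl] by simp
qed

lemma primitive_deriv_ae:
  fixes U :: "real \<Rightarrow> 'a::euclidean_space"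
  assumes "primitive l U g"
  obtains N where "negligible N" "\<And>x. 0 < x \<Longrightarrow> x < l \<Longrightarrow> x \<notin> N \<Longrightarrow> (U has_vector_derivative g x) (at x)"
proof -
  have "g integrable_on {0..l}" using absolutely_integrable_sub(2)[OF primitive_absint[OF assms]] by simp
  then obtain N where N: "negligible N"
    "\<And>x. 0 < x \<Longrightarrow> x < l \<Longrightarrow> x \<notin> N \<Longrightarrow> ((\<lambda>x. integral {0..x} g) has_vector_derivative g x) (at x)"
    using indefinite_integral_ae_differentiable by blast
  show thesis
  proof (rule that[OF N(1)])
    fix x assume x: "0 < x" "x < l" "x \<notin> N"
    have d: "((\<lambda>x. U 0 + integral {0..x} g) has_vector_derivative 0 + g x) (at x)"
      by (intro has_vector_derivative_add has_vector_derivative_const N(2) x)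
    show "(U has_vector_derivative g x) (at x)"
      by (rule has_vector_derivative_transform_within_open[of "\<lambda>x. U 0 + integral {0..x} g" _ _ "{0<..<l}"])
         (use d x primitive_eq[OF assms, symmetric] in auto)
  qed
qed

lemma primitive_unique:
  fixes U :: "real \<Rightarrow> 'a::euclidean_space"
  assumes "primitive l U g" "primitive l U h"
  shows "eq_ae l g h"
proof -
  obtain N1 where N1: "negligible N1" "\<And>x. 0 < x \<Longrightarrow> x < l \<Longrightarrow> x \<notin> N1 \<Longrightarrow> (U has_vector_derivative g x) (at x)"
    using primitive_deriv_ae[OF assms(1)] by blast
  obtain N2 where N2: "negligible N2" "\<And>x. 0 < x \<Longrightarrow> x < l \<Longrightarrow> x \<notin> N2 \<Longrightarrow> (U has_vector_derivative h x) (at x)"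
    using primitive_deriv_ae[OF assms(2)] by blast
  have "N1 \<union> N2 \<in> null_sets lebesgue" using N1(1) N2(1) by (simp flip: negligible_iff_null_sets)
  then have "AE x in lebesgue. x \<notin> N1 \<union> N2" by (rule AE_not_in)
  then show ?thesis unfolding eq_ae_def
  proof eventually_elim
    case (elim x)
    then show ?case using vector_derivative_unique_at[OF N1(2) N2(2)] by auto
  qed
qed

lemma primitive_cong_left:
  assumes "\<And>x. x \<in> {0..l} \<Longrightarrow> U x = V x" "primitive l U g" "0 \<le> l"
  shows "primitive l V g"
proof (rule primitiveI[OF primitive_absint[OF assms(2)]])
  fix x assume "0 \<le> x" "x \<le> l"
  then show "V x - V 0 = integral {0..x} g"
    using primitive_increment[OF assms(2) order_refl, of x] assms(1)[of x] assms(1)[of 0] by simp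
qed

lemma eq_ae_continuous_imp_eq:
  fixes f g :: "real \<Rightarrow> 'a::real_normed_vector"
  assumes l: "0 < l" and c: "continuous_on {0..l} f" "continuous_on {0..l} g" and ae: "eq_ae l f g"
    and x: "x \<in> {0..l}"
  shows "f x = g x"
proof -
  let ?S = "{y \<in> {0<..<l}. f y - g y \<in> - {0}}"
  have "open ?S"
  proof -
    have "continuous_on {0<..<l} (\<lambda>y. f y - g y)"
      by (intro continuous_intros continuous_on_subset[OF c(1)] continuous_on_subset[OF c(2)]) auto
    then have "open ({0<..<l} \<inter> (\<lambda>y. f y - g y) -` (- {0}))"
      by (rule continuous_open_preimage) auto
    moreover have "{0<..<l} \<inter> (\<lambda>y. f y - g y) -` (- {0}) = ?S" by auto
    ultimately show ?thesis by simp
  qed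
  moreover have "negligible ?S"
  proof -
    obtain N where N: "negligible N" "\<And>x. x \<in> {0..l} - N \<Longrightarrow> g x = f x" using eq_ae_obtain[OF ae] by blast
    have "?S \<subseteq> N" using N(2) by force
    then show ?thesis using N(1) negligible_subset by blast
  qed
  ultimately have "?S = {}" using open_not_negligible by blast
  then have z: "f y - g y = 0" if "y \<in> {0<..<l}" for y using that by blast
  have "f x - g x = 0"
  proof (rule continuous_constant_on_closure[of "{0<..<l}"])
    show "continuous_on (closure {0<..<l}) (\<lambda>x. f x - g x)"
      using l c by (simp add: continuous_on_diff)
    show "x \<in> closure {0<..<l}" using l x by simp
  qed (use z in auto)
  then show ?thesis by simp
qed

section \<open>Weak derivatives on an interval\<close>

lemma rep_absint: "rep_L2 u absolutely_integrable_on {a..b}"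
  unfolding set_integrable_def
proof (rule Bochner_Integration.integrable_bound)
  have "integrable lebesgue (indicat_real {a..b})"
    by (rule integrable_real_indicator) (auto simp: emeasure_lborel_Icc_eq)
  then show "integrable lebesgue (\<lambda>x. indicat_real {a..b} x + (cmod (rep_L2 u x))\<^sup>2)"
    using square_integrable_rep[of u] by (auto simp: square_integrable_def)
  show "AE x in lebesgue. norm (indicat_real {a..b} x *\<^sub>R rep_L2 u x)
      \<le> norm (indicat_real {a..b} x + (cmod (rep_L2 u x))\<^sup>2)"
  proof (rule AE_I2)
    fix x
    have "cmod (rep_L2 u x) \<le> 1 + (cmod (rep_L2 u x))\<^sup>2"
      using sum_squares_bound[of 1 "cmod (rep_L2 u x)"] by (simp add: power2_eq_square) (smt (verit) norm_ge_zero)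
    then show "norm (indicat_real {a..b} x *\<^sub>R rep_L2 u x) \<le> norm (indicat_real {a..b} x + (cmod (rep_L2 u x))\<^sup>2)"
      by (auto simp: indicator_def)
  qed
  show "(\<lambda>x. indicat_real {a..b} x *\<^sub>R rep_L2 u x) \<in> borel_measurable lebesgue"
    by (intro borel_measurable_scaleR borel_measurable_indicator measurable_rep) auto
qed

lemma LINT_Ioo:
  fixes f :: "real \<Rightarrow> 'a::euclidean_space"
  assumes "f absolutely_integrable_on {a..b}"
  shows "(LINT x:{a<..<b}|lebesgue. f x) = integral {a..b} f"
proof -
  have "(LINT x:{a<..<b}|lebesgue. f x) = integral {a<..<b} f"
    using assms by (intro set_lebesgue_integral_eq_integral(2)) (simp add: absolutely_integrable_on_Icc_iff_Ioo)
  also have "\<dots> = integral {a..b} f"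
  proof (rule integral_spike_set)
    show "negligible {x \<in> {a<..<b} - {a..b}. f x \<noteq> 0}" by (rule negligible_subset[of "{}"]) auto
    show "negligible {x \<in> {a..b} - {a<..<b}. f x \<noteq> 0}" by (rule negligible_subset[of "{a, b}"]) auto
  qed
  finally show ?thesis .
qed

lemma test_functionD:
  assumes "test_function l \<phi> \<phi>'"
  shows "primitive l \<phi> \<phi>'" "\<phi> 0 = 0" "\<phi> l = 0" "continuous_on {0..l} \<phi>" "continuous_on {0..l} \<phi>'"
proof -
  have d: "(\<phi> has_real_derivative \<phi>' x) (at x)" for x using assms unfolding test_function_def by blast
  show c': "continuous_on {0..l} \<phi>'" using assms continuous_on_subset unfolding test_function_def by blast
  show "primitive l \<phi> \<phi>'"
  proof (rule primitive_C1[OF _ c'])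
    show "(\<phi> has_vector_derivative \<phi>' x) (at x within {0..l})" for x
      using d[of x] by (simp add: has_real_derivative_iff_has_vector_derivative has_vector_derivative_at_within)
  qed
  then show "continuous_on {0..l} \<phi>" by (rule primitive_continuous)
  obtain a b where ab: "0 < a" "b < l" "\<And>x. x \<notin> {a..b} \<Longrightarrow> \<phi> x = 0"
    using assms unfolding test_function_def by blast
  show "\<phi> 0 = 0" "\<phi> l = 0" using ab(1,2) by (auto intro: ab(3))
qed

lemma has_weak_deriv_iff_integral:
  "has_weak_deriv l u w \<longleftrightarrow> (\<forall>\<phi> \<phi>'. test_function l \<phi> \<phi>' \<longrightarrow>
     integral {0..l} (\<lambda>x. \<phi>' x *\<^sub>R rep_L2 u x) = - integral {0..l} (\<lambda>x. \<phi> x *\<^sub>R rep_L2 w x))"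
proof -
  have "(LINT x:{0<..<l}|lebesgue. \<phi>' x *\<^sub>R rep_L2 u x) = integral {0..l} (\<lambda>x. \<phi>' x *\<^sub>R rep_L2 u x)"
    "(LINT x:{0<..<l}|lebesgue. \<phi> x *\<^sub>R rep_L2 w x) = integral {0..l} (\<lambda>x. \<phi> x *\<^sub>R rep_L2 w x)"
    if "test_function l \<phi> \<phi>'" for \<phi> \<phi>'
    by (intro LINT_Ioo absint_product_continuous[OF bounded_bilinear_scaleR] rep_absint test_functionD[OF that])+
  then show ?thesis unfolding has_weak_deriv_def by simp
qed

text \<open>A test function vanishes at both end points, so integrating by parts leaves no boundary term.\<close>

lemma has_weak_derivI:
  assumes l: "0 < l" and U: "primitive l U (rep_L2 w)" and ae: "eq_ae l (rep_L2 u) U"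
  shows "has_weak_deriv l u w"
  unfolding has_weak_deriv_iff_integral
proof (intro allI impI)
  fix \<phi> \<phi>' assume t: "test_function l \<phi> \<phi>'"
  note t = test_functionD[OF t]
  have "eq_ae l (\<lambda>x. \<phi>' x *\<^sub>R rep_L2 u x) (\<lambda>x. \<phi>' x *\<^sub>R U x)"
    using ae unfolding eq_ae_def by eventually_elim simp
  then have "integral {0..l} (\<lambda>x. \<phi>' x *\<^sub>R rep_L2 u x) = integral {0..l} (\<lambda>x. \<phi>' x *\<^sub>R U x)"
    by (rule integral_eq_ae) simp
  then show "integral {0..l} (\<lambda>x. \<phi>' x *\<^sub>R rep_L2 u x) = - integral {0..l} (\<lambda>x. \<phi> x *\<^sub>R rep_L2 w x)"
    using primitive_by_parts[OF bounded_bilinear_scaleR t(1) U less_imp_le[OF l]] t(2,3)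
    by (simp add: eq_neg_iff_add_eq_0)
qed

text \<open>Rises linearly from 0 to 1 on \<open>[s, s + e]\<close>.\<close>

definition ramp :: "real \<Rightarrow> real \<Rightarrow> real \<Rightarrow> real" where
  "ramp s e x = (max 0 (x - s) - max 0 (x - s - e)) / e"

text \<open>The primitive of \<open>ramp s e\<close> that vanishes to the left of \<open>s\<close>; to the right of \<open>s + e\<close> it is affine with slope 1.\<close>

definition ramp_int :: "real \<Rightarrow> real \<Rightarrow> real \<Rightarrow> real" where
  "ramp_int s e x = ((max 0 (x - s))\<^sup>2 - (max 0 (x - s - e))\<^sup>2) / (2 * e)"

lemma square_pos_part_taylor:
  "\<bar>(max 0 v)\<^sup>2 - (max 0 u)\<^sup>2 - 2 * max 0 u * (v - u)\<bar> \<le> (v - u)\<^sup>2" for u v :: real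
proof -
  consider "0 \<le> u" "0 \<le> v" | "0 \<le> u" "v < 0" | "u < 0" "0 \<le> v" | "u < 0" "v < 0" by linarith
  then show ?thesis
  proof cases
    case 1
    then have "(max 0 v)\<^sup>2 - (max 0 u)\<^sup>2 - 2 * max 0 u * (v - u) = (v - u)\<^sup>2"
      by (simp add: power2_eq_square algebra_simps)
    then show ?thesis by simp
  next
    case 2
    then have eq: "(max 0 v)\<^sup>2 - (max 0 u)\<^sup>2 - 2 * max 0 u * (v - u) = (v - u)\<^sup>2 - v\<^sup>2"
      by (simp add: power2_eq_square algebra_simps)
    have "0 \<le> u * (u - 2 * v)" using 2 by (intro mult_nonneg_nonneg) auto
    then have "v\<^sup>2 \<le> (v - u)\<^sup>2" by (simp add: power2_eq_square algebra_simps)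
    then show ?thesis unfolding eq using zero_le_power2[of v] by linarith
  next
    case 3
    then have eq: "(max 0 v)\<^sup>2 - (max 0 u)\<^sup>2 - 2 * max 0 u * (v - u) = v\<^sup>2" by simp
    have "v\<^sup>2 \<le> (v - u)\<^sup>2" using 3 by (intro power_mono) auto
    then show ?thesis unfolding eq by simp
  next
    case 4
    then show ?thesis by simp
  qed
qed

lemma has_derivative_square_pos_part:
  "((\<lambda>x. (max 0 (x - s))\<^sup>2) has_real_derivative 2 * max 0 (x - s)) (at (x::real))"
  unfolding has_field_derivative_iff
proof (rule LIM_zero_cancel, rule Lim_null_comparison)
  show "\<forall>\<^sub>F y in at x. norm (((max 0 (y - s))\<^sup>2 - (max 0 (x - s))\<^sup>2) / (y - x) - 2 * max 0 (x - s)) \<le> \<bar>y - x\<bar>"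
  proof (rule eventually_mono[OF eventually_neq_at_within[of x]])
    fix y assume y: "y \<noteq> x"
    have "((max 0 (y - s))\<^sup>2 - (max 0 (x - s))\<^sup>2) / (y - x) - 2 * max 0 (x - s)
        = ((max 0 (y - s))\<^sup>2 - (max 0 (x - s))\<^sup>2 - 2 * max 0 (x - s) * (y - x)) / (y - x)"
      using y by (simp add: diff_divide_distrib)
    also have "norm \<dots> \<le> (y - x)\<^sup>2 / \<bar>y - x\<bar>"
      using square_pos_part_taylor[of "y - s" "x - s"] unfolding real_norm_def abs_divide
      by (intro divide_right_mono) auto
    also have "(y - x)\<^sup>2 / \<bar>y - x\<bar> = \<bar>y - x\<bar>"
    proof -
      have "(y - x)\<^sup>2 = \<bar>y - x\<bar> * \<bar>y - x\<bar>" using power2_abs[of "y - x"] by (simp only: power2_eq_square)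
      then show ?thesis by (simp only:) (rule nonzero_mult_div_cancel_right, use y in simp)
    qed
    finally show "norm (((max 0 (y - s))\<^sup>2 - (max 0 (x - s))\<^sup>2) / (y - x) - 2 * max 0 (x - s)) \<le> \<bar>y - x\<bar>" .
  qed
  show "((\<lambda>y. \<bar>y - x\<bar>) \<longlongrightarrow> 0) (at x)"
    using tendsto_rabs[OF tendsto_diff[OF tendsto_ident_at tendsto_const[of x]], of x UNIV] by simp
qed

lemma ramp_int_deriv:
  assumes "0 < e" shows "(ramp_int s e has_real_derivative ramp s e x) (at x)"
proof -
  have "((\<lambda>x. ((max 0 (x - s))\<^sup>2 - (max 0 (x - (s + e)))\<^sup>2) / (2 * e)) has_real_derivative
      (2 * max 0 (x - s) - 2 * max 0 (x - (s + e))) / (2 * e)) (at x)"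
    by (intro DERIV_cdivide DERIV_diff has_derivative_square_pos_part)
  moreover have "(2 * max 0 (x - s) - 2 * max 0 (x - (s + e))) / (2 * e) = ramp s e x"
    unfolding ramp_def using assms by (simp add: field_simps)
  ultimately show ?thesis
    unfolding ramp_int_def[abs_def] by (simp add: diff_diff_eq)
qed

lemma continuous_ramp: "continuous_on S (ramp s e)"
  unfolding ramp_def divide_inverse by (intro continuous_intros)

lemma ramp_bounds:
  assumes "0 < e"
  shows "0 \<le> ramp s e x" "ramp s e x \<le> 1" "x \<le> s \<Longrightarrow> ramp s e x = 0" "s + e \<le> x \<Longrightarrow> ramp s e x = 1"
  unfolding ramp_def using assms by (auto simp: max_def divide_simps)

lemma ramp_int_outside:
  assumes "0 < e"
  shows "x \<le> s \<Longrightarrow> ramp_int s e x = 0" "s + e \<le> x \<Longrightarrow> ramp_int s e x = x - s - e / 2"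
  unfolding ramp_int_def using assms by (auto simp: max_def power2_eq_square field_simps)

text \<open>A combination of four shifted ramps whose derivative approximates the indicator of \<open>[a, a + d]\<close> minus that of
  \<open>[b, b + d]\<close>; to the right of all ramps the affine parts cancel.\<close>

lemma ramp_test_function:
  assumes "0 < a" "0 < b" "0 < d" "0 < e" "a + d + e < l" "b + d + e < l"
  shows "test_function l (\<lambda>x. ramp_int a e x - ramp_int (a + d) e x - ramp_int b e x + ramp_int (b + d) e x)
     (\<lambda>x. ramp a e x - ramp (a + d) e x - ramp b e x + ramp (b + d) e x)"
  unfolding test_function_def
proof (intro conjI allI)
  show "((\<lambda>x. ramp_int a e x - ramp_int (a + d) e x - ramp_int b e x + ramp_int (b + d) e x) has_real_derivative
      ramp a e x - ramp (a + d) e x - ramp b e x + ramp (b + d) e x) (at x)" for x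
    by (intro DERIV_add DERIV_diff ramp_int_deriv assms)
  show "continuous_on UNIV (\<lambda>x. ramp a e x - ramp (a + d) e x - ramp b e x + ramp (b + d) e x)"
    by (intro continuous_intros continuous_ramp)
  show "\<exists>p q. 0 < p \<and> q < l \<and> (\<forall>x. x \<notin> {p..q} \<longrightarrow>
      ramp_int a e x - ramp_int (a + d) e x - ramp_int b e x + ramp_int (b + d) e x = 0)"
  proof (rule exI[of _ "min a b"], rule exI[of _ "max a b + d + e"], intro conjI allI impI)
    fix x assume "x \<notin> {min a b..max a b + d + e}"
    then consider "x < min a b" | "max a b + d + e < x" by force
    then show "ramp_int a e x - ramp_int (a + d) e x - ramp_int b e x + ramp_int (b + d) e x = 0"
    proof cases
      case 1
      then show ?thesis using assms by (simp add: ramp_int_outside)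
    next
      case 2
      then show ?thesis using assms by (simp add: ramp_int_outside)
    qed
  qed (use assms in auto)
qed

lemma ramp_integral_tendsto:
  fixes h :: "real \<Rightarrow> 'a::euclidean_space"
  assumes h: "h absolutely_integrable_on {0..l}" and s: "0 \<le> s" "s \<le> l"
  shows "(\<lambda>n. integral {0..l} (\<lambda>x. ramp s (1 / real (Suc n)) x *\<^sub>R h x)) \<longlonglongrightarrow> integral {s..l} h"
proof -
  have "(\<lambda>n. integral {0..l} (\<lambda>x. ramp s (1 / real (Suc n)) x *\<^sub>R h x))
      \<longlonglongrightarrow> integral {0..l} (\<lambda>x. if s < x then h x else 0)"
  proof (rule dominated_convergence(2))
    show "(\<lambda>x. ramp s (1 / real (Suc n)) x *\<^sub>R h x) integrable_on {0..l}" for n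
      using absint_product_continuous[OF bounded_bilinear_scaleR continuous_ramp h]
      by (rule set_lebesgue_integral_eq_integral(1))
    show "(\<lambda>x. norm (h x)) integrable_on {0..l}"
      using h unfolding absolutely_integrable_on_def by blast
    show "norm (ramp s (1 / real (Suc n)) x *\<^sub>R h x) \<le> norm (h x)" for n x
    proof -
      have "\<bar>ramp s (1 / real (Suc n)) x\<bar> \<le> 1"
        using ramp_bounds(1,2)[of "1 / real (Suc n)" s x] by simp
      then show ?thesis using mult_right_mono[of _ 1 "norm (h x)"] by fastforce
    qed
    show "(\<lambda>n. ramp s (1 / real (Suc n)) x *\<^sub>R h x) \<longlonglongrightarrow> (if s < x then h x else 0)" for x
    proof (cases "s < x")
      case True
      then obtain N where N: "1 / real (Suc N) < x - s" using reals_Archimedean[of "x - s"] by (auto simp: inverse_eq_divide)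
      have "ramp s (1 / real (Suc n)) x = 1" if "N \<le> n" for n
      proof -
        have "1 / real (Suc n) \<le> 1 / real (Suc N)" using that by (intro divide_left_mono) auto
        then show ?thesis using N by (intro ramp_bounds(4)) auto
      qed
      then have "\<forall>\<^sub>F n in sequentially. ramp s (1 / real (Suc n)) x *\<^sub>R h x = h x"
        using eventually_sequentiallyI[of N] by (metis (mono_tags, lifting) scaleR_one)
      then show ?thesis using True by (simp add: tendsto_eventually)
    next
      case False
      then show ?thesis using ramp_bounds(3)[of _ x s] by simp
    qed
  qed
  moreover have "integral {0..l} (\<lambda>x. if s < x then h x else 0) = integral {s..l} h"
  proof -
    have "integral {0..l} (\<lambda>x. if s < x then h x else 0) = integral {0..l} (\<lambda>x. if x \<in> {s..l} then h x else 0)"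
      by (rule integral_spike[of "{s}"]) auto
    also have "\<dots> = integral {s..l} h"
    proof (rule integral_unique)
      have "(h has_integral integral {s..l} h) {s..l}"
        using absolutely_integrable_sub(2)[OF h s(1) order_refl] by (rule integrable_integral)
      moreover have "{s..l} \<subseteq> {0..l}" using s(1) by auto
      ultimately show "((\<lambda>x. if x \<in> {s..l} then h x else 0) has_integral integral {s..l} h) {0..l}"
        by (simp only: has_integral_restrict)
    qed
    finally show ?thesis .
  qed
  ultimately show ?thesis by simp
qed

text \<open>Testing with \<open>ramp_test_function\<close> and letting the ramps steepen, the integrals of \<open>h\<close> over \<open>[a, a + d]\<close> and
  \<open>[b, b + d]\<close> agree. Dividing by \<open>d\<close> and letting it tend to 0 at points of differentiability of the primitive
  gives equal values of \<open>h\<close>.\<close>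

lemma du_Bois_Reymond:
  fixes h :: "real \<Rightarrow> 'a::euclidean_space"
  assumes l: "0 < l" and h: "h absolutely_integrable_on {0..l}"
    and orth: "\<And>\<phi> \<phi>'. test_function l \<phi> \<phi>' \<Longrightarrow> integral {0..l} (\<lambda>x. \<phi>' x *\<^sub>R h x) = 0"
  shows "\<exists>c. eq_ae l h (\<lambda>_. c)"
proof -
  define P where "P x = integral {0..x} h" for x
  have P: "primitive l P h" unfolding P_def using primitive_exists[OF h, of 0] by simp
  have tail: "integral {s..l} h = P l - P s" if "0 \<le> s" "s \<le> l" for s
    using primitive_increment[OF P that order_refl] by simp
  have shift: "P (a + d) - P a = P (b + d) - P b"
    if ab: "0 < a" "0 < b" "0 < d" "a + d < l" "b + d < l" for a b d
  proof -
    define I where "I s n = integral {0..l} (\<lambda>x. ramp s (1 / real (Suc n)) x *\<^sub>R h x)" for s n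
    have I: "(\<lambda>n. I s n) \<longlonglongrightarrow> P l - P s" if "0 \<le> s" "s \<le> l" for s
      unfolding I_def tail[OF that, symmetric] by (rule ramp_integral_tendsto[OF h that])
    have lim: "(\<lambda>n. I a n - I (a + d) n - I b n + I (b + d) n)
        \<longlonglongrightarrow> (P l - P a) - (P l - P (a + d)) - (P l - P b) + (P l - P (b + d))"
      using ab by (intro tendsto_add tendsto_diff I) auto
    obtain N where N: "1 / real (Suc N) < min (l - (a + d)) (l - (b + d))"
      using reals_Archimedean[of "min (l - (a + d)) (l - (b + d))"] ab by (auto simp: inverse_eq_divide)
    have "I a n - I (a + d) n - I b n + I (b + d) n = 0" if n: "N \<le> n" for n
    proof -
      let ?e = "1 / real (Suc n)"
      have "?e \<le> 1 / real (Suc N)" using n by (intro divide_left_mono) auto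
      then have e: "0 < ?e" "a + d + ?e < l" "b + d + ?e < l" using N by auto
      have i: "(\<lambda>x. ramp s ?e x *\<^sub>R h x) integrable_on {0..l}" for s
        using absint_product_continuous[OF bounded_bilinear_scaleR continuous_ramp h]
        by (rule set_lebesgue_integral_eq_integral(1))
      have "I a n - I (a + d) n - I b n + I (b + d) n
        = integral {0..l} (\<lambda>x. ramp a ?e x *\<^sub>R h x - ramp (a + d) ?e x *\<^sub>R h x - ramp b ?e x *\<^sub>R h x + ramp (b + d) ?e x *\<^sub>R h x)"
        unfolding I_def using i
        by (simp only: Henstock_Kurzweil_Integration.integral_diff Henstock_Kurzweil_Integration.integral_add integrable_diff)
      also have "\<dots> = integral {0..l} (\<lambda>x. (ramp a ?e x - ramp (a + d) ?e x - ramp b ?e x + ramp (b + d) ?e x) *\<^sub>R h x)"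
        by (simp only: scaleR_left_diff_distrib scaleR_left_distrib)
      also have "\<dots> = 0" by (rule orth[OF ramp_test_function[OF ab(1,2,3) e]])
      finally show ?thesis .
    qed
    then have "(\<lambda>n. I a n - I (a + d) n - I b n + I (b + d) n) \<longlonglongrightarrow> 0"
      by (intro tendsto_eventually eventually_sequentiallyI[of N])
    from LIMSEQ_unique[OF lim this] show ?thesis by (simp add: algebra_simps)
  qed
  obtain N where N: "negligible N" "\<And>x. 0 < x \<Longrightarrow> x < l \<Longrightarrow> x \<notin> N \<Longrightarrow> (P has_vector_derivative h x) (at x)"
    using primitive_deriv_ae[OF P] by blast
  have eq: "h x = h y" if x: "0 < x" "x < l" "x \<notin> N" and y: "0 < y" "y < l" "y \<notin> N" for x y
  proof -
    define \<delta> where "\<delta> = min (l - x) (l - y)"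
    have \<delta>: "0 < \<delta>" using x y by (simp add: \<delta>_def)
    have d: "((\<lambda>d. P (z + d)) has_vector_derivative h z) (at 0 within {0..<\<delta>})"
      if "0 < z" "z < l" "z \<notin> N" for z
    proof -
      have "(P has_vector_derivative h z) (at (z + 0))" using N(2)[OF that] by simp
      then have "(((\<lambda>d. P (z + d))) has_vector_derivative h z) (at 0)"
        using vector_diff_chain_at[of "\<lambda>d. z + d" 1 0 P "h z"]
        by (simp add: o_def has_vector_derivative_add_const add.commute[of z] has_vector_derivative_id)
      then show ?thesis by (rule has_vector_derivative_at_within)
    qed
    have "((\<lambda>d. P (x + d) - P (y + d)) has_vector_derivative h x - h y) (at 0 within {0..<\<delta>})"
      by (intro has_vector_derivative_diff d x y)
    moreover have "P (x + d) - P (y + d) = P x - P y" if "d \<in> {0..<\<delta>}" for d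
      using shift[of x y d] that x y unfolding \<delta>_def by (cases "d = 0") (auto simp: algebra_simps)
    then have "((\<lambda>d. P (x + d) - P (y + d)) has_vector_derivative 0) (at 0 within {0..<\<delta>})"
      using \<delta> by (intro has_vector_derivative_transform[OF _ _ has_vector_derivative_const[of "P x - P y"]]) auto
    moreover have "at 0 within {0..<\<delta>} \<noteq> bot"
    proof -
      have "{0..<\<delta>} - {0} = {0<..<\<delta>}" by auto
      then show ?thesis using \<delta> by (simp add: at_within_eq_bot_iff)
    qed
    ultimately have "h x - h y = 0" using vector_derivative_unique_within by blast
    then show ?thesis by simp
  qed
  have "\<not> negligible {0<..<l}" using l open_not_negligible[of "{0<..<l}"] by auto
  then have "\<not> {0<..<l} \<subseteq> N" using N(1) negligible_subset by blast
  then obtain y where "y \<in> {0<..<l}" "y \<notin> N" by (meson subsetI)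
  then have y: "0 < y" "y < l" "y \<notin> N" by auto
  have "AE x in lebesgue. x \<notin> N" using N(1) by (intro AE_not_in) (simp flip: negligible_iff_null_sets)
  then have "eq_ae l h (\<lambda>_. h y)" unfolding eq_ae_def
  proof eventually_elim
    case (elim x)
    show ?case using eq[OF _ _ elim y] by simp
  qed
  then show ?thesis by blast
qed

lemma has_weak_derivE:
  assumes l: "0 < l" and wd: "has_weak_deriv l u w"
  obtains U where "primitive l U (rep_L2 w)" "eq_ae l (rep_L2 u) U"
proof -
  define G where "G x = integral {0..x} (rep_L2 w)" for x
  have G: "primitive l G (rep_L2 w)" unfolding G_def using primitive_exists[OF rep_absint, of l 0 w] by simp
  have Ga: "G absolutely_integrable_on {0..l}" by (rule continuous_absint[OF primitive_continuous[OF G]])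
  have "\<exists>c. eq_ae l (\<lambda>x. rep_L2 u x - G x) (\<lambda>_. c)"
  proof (rule du_Bois_Reymond[OF l])
    show "(\<lambda>x. rep_L2 u x - G x) absolutely_integrable_on {0..l}"
      by (intro set_integral_diff rep_absint Ga)
    fix \<phi> \<phi>' assume t: "test_function l \<phi> \<phi>'"
    note t' = test_functionD[OF t]
    have i: "(\<lambda>x. \<phi>' x *\<^sub>R rep_L2 u x) integrable_on {0..l}" "(\<lambda>x. \<phi>' x *\<^sub>R G x) integrable_on {0..l}"
      using absint_product_continuous[OF bounded_bilinear_scaleR t'(5)] rep_absint Ga
      by (blast intro: set_lebesgue_integral_eq_integral(1))+
    have "integral {0..l} (\<lambda>x. \<phi>' x *\<^sub>R G x) = - integral {0..l} (\<lambda>x. \<phi> x *\<^sub>R rep_L2 w x)"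
      using primitive_by_parts[OF bounded_bilinear_scaleR t'(1) G less_imp_le[OF l]] t'(2,3)
      by (simp add: eq_neg_iff_add_eq_0)
    also have "\<dots> = integral {0..l} (\<lambda>x. \<phi>' x *\<^sub>R rep_L2 u x)"
      using wd t unfolding has_weak_deriv_iff_integral by metis
    finally show "integral {0..l} (\<lambda>x. \<phi>' x *\<^sub>R (rep_L2 u x - G x)) = 0"
      using i by (simp add: scaleR_diff_right Henstock_Kurzweil_Integration.integral_diff)
  qed
  then obtain c where c: "eq_ae l (\<lambda>x. rep_L2 u x - G x) (\<lambda>_. c)" by blast
  have "primitive l (\<lambda>x. c + G x) (rep_L2 w)" unfolding G_def by (rule primitive_exists[OF rep_absint])
  moreover have "eq_ae l (rep_L2 u) (\<lambda>x. c + G x)"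
    using c unfolding eq_ae_def by eventually_elim (auto simp: algebra_simps)
  ultimately show thesis by (rule that)
qed

section \<open>Classical representatives of functions of class H3\<close>

lemma L2_onD: "u \<in> L2_on l \<Longrightarrow> AE x in lebesgue. x \<notin> {0<..<l} \<longrightarrow> rep_L2 u x = 0"
  unfolding L2_on_def by simp

lemma L2_on_eqI:
  assumes "u \<in> L2_on l" "v \<in> L2_on l" "eq_ae l (rep_L2 u) (rep_L2 v)"
  shows "u = v"
proof (rule L2_eqI)
  show "AE x in lebesgue. rep_L2 u x = rep_L2 v x"
    using L2_onD[OF assms(1)] L2_onD[OF assms(2)] assms(3)[unfolded eq_ae_def]
    by eventually_elim auto
qed

lemma L2_on_add: "u \<in> L2_on l \<Longrightarrow> v \<in> L2_on l \<Longrightarrow> u + v \<in> L2_on l"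
proof -
  assume "u \<in> L2_on l" "v \<in> L2_on l"
  from L2_onD[OF this(1)] L2_onD[OF this(2)] rep_plus[of u v]
  have "AE x in lebesgue. x \<notin> {0<..<l} \<longrightarrow> rep_L2 (u + v) x = 0" by eventually_elim auto
  then show ?thesis unfolding L2_on_def by simp
qed

lemma L2_on_scaleC: "u \<in> L2_on l \<Longrightarrow> scaleC c u \<in> L2_on l"
proof -
  assume "u \<in> L2_on l"
  from L2_onD[OF this] rep_scaleC[of c u]
  have "AE x in lebesgue. x \<notin> {0<..<l} \<longrightarrow> rep_L2 (scaleC c u) x = 0" by eventually_elim auto
  then show ?thesis unfolding L2_on_def by simp
qed

lemma L2_on_uminus: "u \<in> L2_on l \<Longrightarrow> - u \<in> L2_on l"
  unfolding uminus_scaleC by (rule L2_on_scaleC)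

lemma L2_on_diff: "u \<in> L2_on l \<Longrightarrow> v \<in> L2_on l \<Longrightarrow> u - v \<in> L2_on l"
  using L2_on_add[OF _ L2_on_uminus] by simp

lemma L2_on_zero: "0 \<in> L2_on l"
  unfolding L2_on_def mem_Collect_eq by (rule eventually_mono[OF rep_zero]) simp

lemma eq_ae_plus: "eq_ae l (rep_L2 (u + v)) (\<lambda>x. rep_L2 u x + rep_L2 v x)"
  unfolding eq_ae_def using rep_plus[of u v] by eventually_elim simp

lemma eq_ae_scaleC: "eq_ae l (rep_L2 (scaleC c u)) (\<lambda>x. c * rep_L2 u x)"
  unfolding eq_ae_def using rep_scaleC[of c u] by eventually_elim simp

definition zero_extension :: "real \<Rightarrow> (real \<Rightarrow> complex) \<Rightarrow> L2" where
  "zero_extension l U = abs_L2 (\<lambda>x. if x \<in> {0<..<l} then U x else 0)"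

lemma zero_extension_props:
  assumes "continuous_on {0..l} U"
  shows "zero_extension l U \<in> L2_on l" "eq_ae l (rep_L2 (zero_extension l U)) U"
proof -
  let ?f = "\<lambda>x. if x \<in> {0<..<l} then U x else 0"
  have sq: "square_integrable ?f"
    unfolding square_integrable_def
  proof
    have cc: "continuous_on {0<..<l} U" by (rule continuous_on_subset[OF assms]) auto
    have "(\<lambda>x. indicator {0<..<l} x *\<^sub>R U x) \<in> borel_measurable borel"
      by (rule borel_measurable_continuous_on_indicator[OF _ cc]) auto
    moreover have "(\<lambda>x. indicator {0<..<l} x *\<^sub>R U x) = ?f" by (auto simp: indicator_def)
    ultimately have mb: "?f \<in> borel_measurable borel" by simp
    then show "?f \<in> borel_measurable lebesgue"
      by (intro measurable_completion) simp
    have "(\<lambda>x. (cmod (U x))\<^sup>2) absolutely_integrable_on {0..l}"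
      by (intro continuous_absint continuous_intros assms)
    then have "integrable lebesgue (\<lambda>x. indicat_real {0<..<l} x *\<^sub>R (cmod (U x))\<^sup>2)"
      unfolding absolutely_integrable_on_Icc_iff_Ioo by (simp add: set_integrable_def)
    then show "integrable lebesgue (\<lambda>x. (cmod (?f x))\<^sup>2)"
      by (rule Bochner_Integration.integrable_cong[THEN iffD1, rotated -1]) (auto simp: indicator_def)
  qed
  from rep_abs_L2[OF sq] show "zero_extension l U \<in> L2_on l" "eq_ae l (rep_L2 (zero_extension l U)) U"
    unfolding zero_extension_def L2_on_def eq_ae_def mem_Collect_eq
    by (eventually_elim, auto)+
qed

lemma pt_value_eq:
  assumes l: "0 < l" and c: "continuous_on {0..l} U" and ae: "eq_ae l (rep_L2 u) U" and x: "x \<in> {0..l}"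
  shows "pt_value l u x = U x"
  unfolding pt_value_def
proof (rule the_equality)
  show "\<exists>g. continuous_on {0..l} g \<and> (AE y in lebesgue. y \<in> {0<..<l} \<longrightarrow> rep_L2 u y = g y) \<and> U x = g x"
    using c ae unfolding eq_ae_def by blast
  fix z assume "\<exists>g. continuous_on {0..l} g \<and> (AE y in lebesgue. y \<in> {0<..<l} \<longrightarrow> rep_L2 u y = g y) \<and> z = g x"
  then obtain g where g: "continuous_on {0..l} g" "eq_ae l (rep_L2 u) g" "z = g x"
    unfolding eq_ae_def by blast
  have "eq_ae l g U" by (rule eq_ae_trans[OF eq_ae_sym[OF g(2)] ae])
  then show "z = U x" unfolding g(3) by (rule eq_ae_continuous_imp_eq[OF l g(1) c _ x])
qed

lemma weak_deriv_eq:
  assumes l: "0 < l" and w: "w \<in> L2_on l" "has_weak_deriv l u w"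
  shows "weak_deriv l u = w"
  unfolding weak_deriv_def
proof (rule the_equality)
  fix v assume v: "v \<in> L2_on l \<and> has_weak_deriv l u v"
  obtain U where U: "primitive l U (rep_L2 w)" "eq_ae l (rep_L2 u) U" by (rule has_weak_derivE[OF l w(2)])
  obtain V where V: "primitive l V (rep_L2 v)" "eq_ae l (rep_L2 u) V" using v has_weak_derivE[OF l] by blast
  have "eq_ae l V U" by (rule eq_ae_trans[OF eq_ae_sym[OF V(2)] U(2)])
  then have "V x = U x" if "x \<in> {0..l}" for x
    by (rule eq_ae_continuous_imp_eq[OF l primitive_continuous[OF V(1)] primitive_continuous[OF U(1)] _ that])
  then have "primitive l U (rep_L2 v)" by (rule primitive_cong_left[OF _ V(1)]) (use l in auto)
  then have "eq_ae l (rep_L2 v) (rep_L2 w)" by (rule primitive_unique[OF _ U(1)])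
  then show "v = w" using L2_on_eqI v w(1) by blast
qed (use w in blast)

text \<open>\<open>U\<close>, \<open>U'\<close> and \<open>U''\<close> are the continuous representatives of \<open>u\<close> and of its first two weak derivatives; the
  third one, \<open>w\<close>, stays an element of \<^typ>\<open>L2\<close>. The primes belong to the names.\<close>

definition H3_rep :: "real \<Rightarrow> L2 \<Rightarrow> (real \<Rightarrow> complex) \<Rightarrow> (real \<Rightarrow> complex) \<Rightarrow> (real \<Rightarrow> complex) \<Rightarrow> L2 \<Rightarrow> bool" where
  "H3_rep l u U U' U'' w \<longleftrightarrow> u \<in> L2_on l \<and> w \<in> L2_on l \<and> eq_ae l (rep_L2 u) U \<and>
     primitive l U U' \<and> primitive l U' U'' \<and> primitive l U'' (rep_L2 w)"

lemma H3_repD: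
  assumes "H3_rep l u U U' U'' w"
  shows "u \<in> L2_on l" "w \<in> L2_on l" "eq_ae l (rep_L2 u) U" "primitive l U U'" "primitive l U' U''" "primitive l U'' (rep_L2 w)"
  using assms unfolding H3_rep_def by blast+

lemma weak_deriv_primitive:
  assumes l: "0 < l" and U: "primitive l U U'" and ae: "eq_ae l (rep_L2 u) U" and w: "w \<in> L2_on l" "eq_ae l (rep_L2 w) U'"
  shows "has_weak_deriv l u w" "weak_deriv l u = w"
proof -
  show "has_weak_deriv l u w"
    by (rule has_weak_derivI[OF l primitive_cong_ae[OF eq_ae_sym[OF w(2)] U] ae])
  then show "weak_deriv l u = w" by (rule weak_deriv_eq[OF l w(1)])
qed

lemma H3_rep_facts:
  assumes l: "0 < l" and H: "H3_rep l u U U' U'' w"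
  shows "u \<in> sobolev 2 l" "u \<in> sobolev 3 l"
    "weak_deriv l u = zero_extension l U'" "weak_deriv l (weak_deriv l u) = zero_extension l U''"
    "weak_deriv l (weak_deriv l (weak_deriv l u)) = w"
    "x \<in> {0..l} \<Longrightarrow> pt_value l u x = U x"
    "x \<in> {0..l} \<Longrightarrow> pt_value l (weak_deriv l u) x = U' x"
    "x \<in> {0..l} \<Longrightarrow> pt_value l (weak_deriv l (weak_deriv l u)) x = U'' x"
proof -
  note H = H3_repD[OF H]
  note c = primitive_continuous[OF H(4)] primitive_continuous[OF H(5)] primitive_continuous[OF H(6)]
  note e1 = zero_extension_props[OF c(2)] and e2 = zero_extension_props[OF c(3)]
  note d1 = weak_deriv_primitive[OF l H(4,3) e1] and d2 = weak_deriv_primitive[OF l H(5) e1(2) e2]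
    and d3 = weak_deriv_primitive[OF l H(6) e2(2) H(2) eq_ae_refl]
  have s: "w \<in> sobolev 0 l" "zero_extension l U'' \<in> sobolev 1 l" "zero_extension l U'' \<in> sobolev 0 l"
    using H(2) e2(1) d3(1) by auto
  have s2: "zero_extension l U' \<in> sobolev (Suc 1) l" "zero_extension l U' \<in> sobolev (Suc 0) l"
    using e1(1) s(2,3) d2(1) by (auto simp del: sobolev.simps(1))
  show "u \<in> sobolev 2 l" "u \<in> sobolev 3 l"
    unfolding numeral_2_eq_2 numeral_3_eq_3
    using H(1) s2 d1(1) by (auto simp del: sobolev.simps(1))
  show "weak_deriv l u = zero_extension l U'" by (rule d1)
  show "weak_deriv l (weak_deriv l u) = zero_extension l U''" unfolding d1(2) by (rule d2)
  show "weak_deriv l (weak_deriv l (weak_deriv l u)) = w" unfolding d1(2) d2(2) by (rule d3)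
  show "pt_value l u x = U x" if "x \<in> {0..l}" by (rule pt_value_eq[OF l c(1) H(3) that])
  show "pt_value l (weak_deriv l u) x = U' x" if "x \<in> {0..l}"
    unfolding d1(2) by (rule pt_value_eq[OF l c(2) e1(2) that])
  show "pt_value l (weak_deriv l (weak_deriv l u)) x = U'' x" if "x \<in> {0..l}"
    unfolding d1(2) d2(2) by (rule pt_value_eq[OF l c(3) e2(2) that])
qed

lemma sobolev_3_imp_H3_rep:
  assumes l: "0 < l" and u: "u \<in> sobolev 3 l"
  obtains U U' U'' w where "H3_rep l u U U' U'' w"
proof -
  from u obtain v1 v2 w where *: "u \<in> L2_on l" "w \<in> L2_on l"
      "has_weak_deriv l u v1" "has_weak_deriv l v1 v2" "has_weak_deriv l v2 w"
    unfolding numeral_3_eq_3 by auto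
  obtain U where U: "primitive l U (rep_L2 v1)" "eq_ae l (rep_L2 u) U" by (rule has_weak_derivE[OF l *(3)])
  obtain U' where U': "primitive l U' (rep_L2 v2)" "eq_ae l (rep_L2 v1) U'" by (rule has_weak_derivE[OF l *(4)])
  obtain U'' where U'': "primitive l U'' (rep_L2 w)" "eq_ae l (rep_L2 v2) U''" by (rule has_weak_derivE[OF l *(5)])
  have "H3_rep l u U U' U'' w"
    unfolding H3_rep_def using * U(2) primitive_cong_ae[OF U'(2) U(1)] primitive_cong_ae[OF U''(2) U'(1)] U''(1) by blast
  then show thesis by (rule that)
qed

lemma H3_rep_add:
  assumes "H3_rep l u U U' U'' w" "H3_rep l v V V' V'' z"
  shows "H3_rep l (u + v) (\<lambda>x. U x + V x) (\<lambda>x. U' x + V' x) (\<lambda>x. U'' x + V'' x) (w + z)"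
proof -
  note U = H3_repD[OF assms(1)] and V = H3_repD[OF assms(2)]
  have "eq_ae l (\<lambda>x. rep_L2 u x + rep_L2 v x) (\<lambda>x. U x + V x)"
    using U(3) V(3) unfolding eq_ae_def by eventually_elim auto
  from eq_ae_trans[OF eq_ae_plus this]
  have "eq_ae l (rep_L2 (u + v)) (\<lambda>x. U x + V x)" .
  moreover have "primitive l (\<lambda>x. U'' x + V'' x) (rep_L2 (w + z))"
    by (rule primitive_cong_ae[OF eq_ae_sym[OF eq_ae_plus] primitive_add[OF U(6) V(6)]])
  ultimately show ?thesis
    unfolding H3_rep_def using U V L2_on_add primitive_add by blast
qed

lemma H3_rep_scaleC:
  assumes "H3_rep l u U U' U'' w"
  shows "H3_rep l (scaleC c u) (\<lambda>x. c * U x) (\<lambda>x. c * U' x) (\<lambda>x. c * U'' x) (scaleC c w)"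
proof -
  note U = H3_repD[OF assms]
  have "eq_ae l (\<lambda>x. c * rep_L2 u x) (\<lambda>x. c * U x)"
    using U(3) unfolding eq_ae_def by eventually_elim auto
  from eq_ae_trans[OF eq_ae_scaleC this]
  have "eq_ae l (rep_L2 (scaleC c u)) (\<lambda>x. c * U x)" .
  moreover have "primitive l (\<lambda>x. c * U'' x) (rep_L2 (scaleC c w))"
    by (rule primitive_cong_ae[OF eq_ae_sym[OF eq_ae_scaleC] primitive_linear[OF U(6) bounded_linear_mult_right]])
  ultimately show ?thesis
    unfolding H3_rep_def
    using U L2_on_scaleC[OF U(1)] L2_on_scaleC[OF U(2)]
      primitive_linear[OF U(4) bounded_linear_mult_right[of c]] primitive_linear[OF U(5) bounded_linear_mult_right[of c]]
    by blast
qed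

lemma inner_L2_on:
  assumes "v \<in> L2_on l" "eq_ae l (rep_L2 u) F" "eq_ae l (rep_L2 v) G"
    "(\<lambda>x. F x \<bullet> G x) absolutely_integrable_on {0..l}"
  shows "u \<bullet> v = integral {0..l} (\<lambda>x. F x \<bullet> G x)"
proof -
  have FG: "(\<lambda>x. F x \<bullet> G x) absolutely_integrable_on {0<..<l}"
    using assms(4) by (simp add: absolutely_integrable_on_Icc_iff_Ioo)
  have "u \<bullet> v = (LINT x|lebesgue. indicat_real {0<..<l} x *\<^sub>R (F x \<bullet> G x))"
    unfolding inner_L2_eq
  proof (rule integral_cong_AE)
    show "(\<lambda>x. rep_L2 u x \<bullet> rep_L2 v x) \<in> borel_measurable lebesgue"
      by (intro borel_measurable_inner measurable_rep)
    show "(\<lambda>x. indicat_real {0<..<l} x *\<^sub>R (F x \<bullet> G x)) \<in> borel_measurable lebesgue"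
      using FG unfolding set_integrable_def by (rule borel_measurable_integrable)
    show "AE x in lebesgue. rep_L2 u x \<bullet> rep_L2 v x = indicat_real {0<..<l} x *\<^sub>R (F x \<bullet> G x)"
      using L2_onD[OF assms(1)] assms(2,3)[unfolded eq_ae_def]
      by eventually_elim (auto simp: indicator_def)
  qed
  also have "\<dots> = integral {0..l} (\<lambda>x. F x \<bullet> G x)"
    using LINT_Ioo[OF assms(4)] by (simp add: set_lebesgue_integral_def)
  finally show ?thesis .
qed

text \<open>Restriction to the complement of the interval does not increase the norm, so for a limit of functions vanishing
  there this restriction has norm 0.\<close>

lemma closed_L2_on: "closed (L2_on l)"
  unfolding closed_sequential_limits
proof (intro allI impI)
  fix X u assume X: "(\<forall>n. X n \<in> L2_on l) \<and> X \<longlonglongrightarrow> u"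
  define P where "P v = abs_L2 (\<lambda>x. if x \<in> {0<..<l} then 0 else rep_L2 v x)" for v
  have m: "(\<lambda>x. if x \<in> {0<..<l} then 0 else rep_L2 v x) = (\<lambda>x. indicat_real (- {0<..<l}) x *\<^sub>R rep_L2 v x)" for v
    by (auto simp: indicator_def)
  have sq: "square_integrable (\<lambda>x. if x \<in> {0<..<l} then 0 else rep_L2 v x)" for v
    unfolding square_integrable_def
  proof
    show 1: "(\<lambda>x. if x \<in> {0<..<l} then 0 else rep_L2 v x) \<in> borel_measurable lebesgue"
      unfolding m by (intro borel_measurable_scaleR borel_measurable_indicator measurable_rep) auto
    have "(\<lambda>x. cmod (if x \<in> {0<..<l} then 0 else rep_L2 v x)) \<in> borel_measurable lebesgue"
      using 1 by measurable
    then have 2: "(\<lambda>x. (cmod (if x \<in> {0<..<l} then 0 else rep_L2 v x))\<^sup>2) \<in> borel_measurable lebesgue"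
      by (rule borel_measurable_power)
    show "integrable lebesgue (\<lambda>x. (cmod (if x \<in> {0<..<l} then 0 else rep_L2 v x))\<^sup>2)"
      by (rule Bochner_Integration.integrable_bound[OF conjunct2[OF square_integrable_rep[of v, unfolded square_integrable_def]] 2])
         (auto intro!: AE_I2)
  qed
  have est: "norm (P u) \<le> norm (u - X n)" for n
  proof -
    have "(norm (P u))\<^sup>2 = (LINT x|lebesgue. (cmod (if x \<in> {0<..<l} then 0 else rep_L2 u x))\<^sup>2)"
      unfolding P_def by (rule norm_abs_L2_sq[OF sq])
    also have "\<dots> \<le> (LINT x|lebesgue. (cmod (rep_L2 (u - X n) x))\<^sup>2)"
    proof (rule integral_mono_AE)
      show "integrable lebesgue (\<lambda>x. (cmod (if x \<in> {0<..<l} then 0 else rep_L2 u x))\<^sup>2)"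
        "integrable lebesgue (\<lambda>x. (cmod (rep_L2 (u - X n) x))\<^sup>2)"
        using sq[of u] square_integrable_rep[of "u - X n"] unfolding square_integrable_def by blast+
      have "X n \<in> L2_on l" using X by blast
      from L2_onD[OF this] rep_minus[of u "X n"]
      show "AE x in lebesgue. (cmod (if x \<in> {0<..<l} then 0 else rep_L2 u x))\<^sup>2 \<le> (cmod (rep_L2 (u - X n) x))\<^sup>2"
        by eventually_elim auto
    qed
    also have "\<dots> = (norm (u - X n))\<^sup>2" by (rule norm_L2_sq[symmetric])
    finally show ?thesis by (rule power2_le_imp_le) simp
  qed
  have "(\<lambda>n. norm (u - X n)) \<longlonglongrightarrow> norm (u - u)"
    using X by (intro tendsto_intros) auto
  then have "norm (P u) \<le> norm (u - u)"
    by (rule LIMSEQ_le_const) (use est in auto)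
  then have "P u = 0" by simp
  have "AE x in lebesgue. rep_L2 (P u) x = 0" unfolding \<open>P u = 0\<close> by (rule rep_zero)
  with rep_abs_L2[OF sq[of u], folded P_def]
  have "AE x in lebesgue. (if x \<in> {0<..<l} then 0 else rep_L2 u x) = 0" by eventually_elim simp
  then show "u \<in> L2_on l"
    unfolding L2_on_def mem_Collect_eq by eventually_elim auto
qed

section \<open>The resolvent equation on one edge\<close>

text \<open>Integration by parts for the pairs \<open>(U, U)\<close>, \<open>(U'', U)\<close> and \<open>(U', U')\<close>; the first and the last are half the increments of
  squares. Applied to the operator, and also to homogeneous solutions of the resolvent equation.\<close>

lemma edge_dissipation:
  fixes U :: "real \<Rightarrow> complex"
  assumes l: "0 < l" and U: "primitive l U U'" "primitive l U' U''" "primitive l U'' g" and bc: "U l = 0" "U' l = 0"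
  shows "(\<lambda>x. (- U' x - g x) \<bullet> U x) absolutely_integrable_on {0..l}"
    "integral {0..l} (\<lambda>x. (- U' x - g x) \<bullet> U x) = (cmod (U 0))\<^sup>2 / 2 + U'' 0 \<bullet> U 0 - (cmod (U' 0))\<^sup>2 / 2"
proof -
  note c = primitive_continuous[OF U(1)] primitive_continuous[OF U(2)] primitive_continuous[OF U(3)]
  note p = primitive_by_parts[OF bounded_bilinear_inner _ _ less_imp_le[OF l]]
  have i1: "(\<lambda>x. U' x \<bullet> U x) absolutely_integrable_on {0..l}"
    by (intro continuous_absint continuous_intros c)
  have i2: "(\<lambda>x. g x \<bullet> U x) absolutely_integrable_on {0..l}"
    using absint_product_continuous[OF bounded_bilinear_inner c(1) primitive_absint[OF U(3)]]
    by (simp add: inner_commute)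
  have eq: "(\<lambda>x. (- U' x - g x) \<bullet> U x) = (\<lambda>x. - (U' x \<bullet> U x) - g x \<bullet> U x)"
    by (simp add: inner_diff_left)
  show "(\<lambda>x. (- U' x - g x) \<bullet> U x) absolutely_integrable_on {0..l}"
    unfolding eq by (intro set_integral_diff i2 continuous_absint continuous_intros c)
  have "(\<lambda>x. U' x \<bullet> U x) integrable_on {0..l}" "(\<lambda>x. g x \<bullet> U x) integrable_on {0..l}"
    using i1 i2 by (auto intro: set_lebesgue_integral_eq_integral(1))
  then have "integral {0..l} (\<lambda>x. (- U' x - g x) \<bullet> U x)
      = - integral {0..l} (\<lambda>x. U' x \<bullet> U x) - integral {0..l} (\<lambda>x. g x \<bullet> U x)"
    unfolding eq by (simp add: Henstock_Kurzweil_Integration.integral_diff integrable_neg)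
  moreover have "2 * integral {0..l} (\<lambda>x. U' x \<bullet> U x) = - (U 0 \<bullet> U 0)"
    using p[OF U(1) U(1)] bc by (simp add: inner_commute)
  moreover have "integral {0..l} (\<lambda>x. g x \<bullet> U x) + integral {0..l} (\<lambda>x. U'' x \<bullet> U' x) = - (U'' 0 \<bullet> U 0)"
    using p[OF U(3) U(1)] bc by simp
  moreover have "2 * integral {0..l} (\<lambda>x. U'' x \<bullet> U' x) = - (U' 0 \<bullet> U' 0)"
    using p[OF U(2) U(2)] bc by (simp add: inner_commute)
  ultimately show "integral {0..l} (\<lambda>x. (- U' x - g x) \<bullet> U x)
      = (cmod (U 0))\<^sup>2 / 2 + U'' 0 \<bullet> U 0 - (cmod (U' 0))\<^sup>2 / 2"
    by (simp add: power2_norm_eq_inner)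
qed

text \<open>Integrating factor \<open>exp (- r x)\<close>.\<close>

lemma first_order_solution:
  fixes r c :: complex
  assumes l: "0 \<le> l" and f: "f absolutely_integrable_on {0..l}"
  shows "\<exists>U. primitive l U (\<lambda>x. r * U x + f x) \<and> U l = c"
proof -
  define E where "E x = exp (r * of_real x)" for x
  define E' where "E' x = exp (- r * of_real x)" for x
  have EE': "E x * E' x = 1" for x
    unfolding E_def E'_def by (simp flip: exp_add)
  have cE: "continuous_on S E" "continuous_on S E'" for S
    unfolding E_def E'_def by (intro continuous_intros)+
  have "(E has_vector_derivative r * E x) (at x within {0..l})" for x
  proof -
    have "((\<lambda>z. exp (r * z)) has_field_derivative r * exp (r * of_real x)) (at (of_real x))"
      by (auto intro!: derivative_eq_intros)
    from has_vector_derivative_real_field[OF this, of "{0..l}"]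
    show ?thesis unfolding E_def .
  qed
  then have E: "primitive l E (\<lambda>x. r * E x)"
    by (intro primitive_C1 continuous_intros cE)
  have g: "(\<lambda>x. E' x * f x) absolutely_integrable_on {0..l}"
    by (rule absint_product_continuous[OF bounded_bilinear_mult cE(2) f])
  \<comment> \<open>Normalised so that \<open>V l = E' l * c\<close>, hence \<open>E l * V l = c\<close>.\<close>
  define V where "V x = (E' l * c - integral {0..l} (\<lambda>x. E' x * f x)) + integral {0..x} (\<lambda>x. E' x * f x)" for x
  have V: "primitive l V (\<lambda>x. E' x * f x)" unfolding V_def by (rule primitive_exists[OF g])
  have "(\<lambda>x. (r * E x) * V x + E x * (E' x * f x)) = (\<lambda>x. r * (E x * V x) + f x)"
  proof
    show "(r * E x) * V x + E x * (E' x * f x) = r * (E x * V x) + f x" for x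
      using arg_cong[OF EE'[of x], of "\<lambda>z. z * f x"] by (simp add: mult.assoc)
  qed
  then have "primitive l (\<lambda>x. E x * V x) (\<lambda>x. r * (E x * V x) + f x)"
    using primitive_product[OF bounded_bilinear_mult E V] by metis
  moreover have "E l * V l = c" using EE'[of l] unfolding V_def by (simp flip: mult.assoc)
  ultimately show ?thesis by blast
qed

text \<open>Starting from a real root \<open>-a\<close>, that is \<open>a\<^sup>3 + a = m\<close>, the polynomial \<open>r\<^sup>3 + r + m\<close> splits as
  \<open>(r + a) (r\<^sup>2 - a r + a\<^sup>2 + 1)\<close>, and the quadratic factor has the roots \<open>a/2 \<plusminus> i (3 a\<^sup>2/4 + 1)\<^sup>1\<^sup>/\<^sup>2\<close>.\<close>

lemma characteristic_roots:
  fixes m :: real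
  assumes "0 < m"
  obtains r1 r2 r3 :: complex where "r1 + r2 + r3 = 0" "r1 * r2 + r1 * r3 + r2 * r3 = 1" "r1 * r2 * r3 = - of_real m"
proof -
  have "\<exists>a. 0 \<le> a \<and> a \<le> m \<and> a ^ 3 + a = m"
  proof (rule IVT')
    show "continuous_on {0..m} (\<lambda>a. a ^ 3 + a)" by (intro continuous_intros)
  qed (use assms in auto)
  then obtain a where a: "a ^ 3 + a = m" by blast
  define w where "w = sqrt (3 * a\<^sup>2 / 4 + 1)"
  have w: "w\<^sup>2 = 3 * a\<^sup>2 / 4 + 1" unfolding w_def by (simp add: add_nonneg_nonneg)
  have prod: "Complex (a / 2) w * Complex (a / 2) (- w) = of_real (a\<^sup>2 + 1)"
    using w by (simp add: complex_eq_iff power2_eq_square)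
  show thesis
  proof (rule that[of "- of_real a" "Complex (a / 2) w" "Complex (a / 2) (- w)"])
    show "- complex_of_real a + Complex (a / 2) w + Complex (a / 2) (- w) = 0"
      by (simp add: complex_eq_iff)
    show "- complex_of_real a * Complex (a / 2) w + - complex_of_real a * Complex (a / 2) (- w)
        + Complex (a / 2) w * Complex (a / 2) (- w) = 1"
      unfolding prod by (simp add: complex_eq_iff power2_eq_square)
    show "- complex_of_real a * Complex (a / 2) w * Complex (a / 2) (- w) = - complex_of_real m"
      unfolding mult.assoc prod using a by (simp add: power3_eq_cube power2_eq_square algebra_simps flip: of_real_mult of_real_add)
  qed
qed

text \<open>The differential operator of \<open>U''' + U' + m U = f\<close> is the product of three first-order factors; solving them one
  after the other with end values \<open>c\<close>, 0, 0 prescribes all the data at \<open>l\<close>.\<close>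

lemma third_order_solution:
  fixes c :: complex and m :: real
  assumes l: "0 \<le> l" and m: "0 < m" and f: "f absolutely_integrable_on {0..l}"
  obtains U U' U'' where "primitive l U U'" "primitive l U' U''" "primitive l U'' (\<lambda>x. f x - U' x - of_real m * U x)"
    "U l = 0" "U' l = 0" "U'' l = c"
proof -
  obtain r1 r2 r3 :: complex where
    r: "r1 + r2 + r3 = 0" "r1 * r2 + r1 * r3 + r2 * r3 = 1" "r1 * r2 * r3 = - of_real m"
    by (rule characteristic_roots[OF m])
  obtain a where a: "primitive l a (\<lambda>x. r1 * a x + f x)" "a l = c"
    using first_order_solution[OF l f] by blast
  obtain b where b: "primitive l b (\<lambda>x. r2 * b x + a x)" "b l = 0"
    using first_order_solution[OF l continuous_absint[OF primitive_continuous[OF a(1)]]] by blast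
  obtain U where U: "primitive l U (\<lambda>x. r3 * U x + b x)" "U l = 0"
    using first_order_solution[OF l continuous_absint[OF primitive_continuous[OF b(1)]]] by blast
  have lin: "primitive l (\<lambda>x. s * V x) (\<lambda>x. s * V' x)" if "primitive l V V'" for s :: complex and V V'
    by (rule primitive_linear[OF that bounded_linear_mult_right])
  define U' where "U' x = r3 * U x + b x" for x
  have U': "primitive l U' (\<lambda>x. r3 * U' x + (r2 * b x + a x))"
    unfolding U'_def by (intro primitive_add lin U b)
  define U'' where "U'' x = r3 * U' x + (r2 * b x + a x)" for x
  have U'': "primitive l U'' (\<lambda>x. r3 * U'' x + (r2 * (r2 * b x + a x) + (r1 * a x + f x)))"
    unfolding U''_def by (intro primitive_add lin U'[unfolded U''_def[symmetric]] b a U')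
  have "r3 * U'' x + (r2 * (r2 * b x + a x) + (r1 * a x + f x)) = f x - U' x - of_real m * U x" for x
  proof -
    have b': "b x = U' x - r3 * U x" unfolding U'_def by simp
    have a': "a x = U'' x - r3 * U' x - r2 * b x" unfolding U''_def by simp
    have "r3 * U'' x + (r2 * (r2 * b x + a x) + (r1 * a x + f x))
       = (r1 + r2 + r3) * U'' x - (r1 * r2 + r1 * r3 + r2 * r3) * U' x + (r1 * r2 * r3) * U x + f x"
      unfolding a' b' by (simp add: algebra_simps)
    then show ?thesis unfolding r by simp
  qed
  then have "primitive l U'' (\<lambda>x. f x - U' x - of_real m * U x)" using U'' by (simp only:)
  moreover have "U' l = 0" "U'' l = c" using U(2) b(2) a(2) unfolding U''_def U'_def by auto
  moreover have "primitive l U U'" "primitive l U' U''" using U(1) U' unfolding U'_def[abs_def, symmetric] U''_def[abs_def, symmetric]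
    by (simp_all add: U'_def[abs_def] U''_def[abs_def])
  ultimately show thesis using that U(2) by blast
qed

lemma primitive_of_zero:
  fixes V :: "real \<Rightarrow> complex"
  assumes l: "0 < l" and U: "primitive l U V" "continuous_on {0..l} V" "\<And>x. x \<in> {0..l} \<Longrightarrow> U x = 0" and x: "x \<in> {0..l}"
  shows "V x = 0"
proof -
  have "primitive l U (\<lambda>_. 0)"
  proof (rule primitiveI)
    show "(\<lambda>_. 0 :: complex) absolutely_integrable_on {0..l}" by (rule continuous_absint) simp
    show "U x - U 0 = integral {0..x} (\<lambda>_. 0)" if "0 \<le> x" "x \<le> l" for x
      using U(3)[of x] U(3)[of 0] that by simp
  qed
  then have "eq_ae l V (\<lambda>_. 0)" by (rule primitive_unique[OF U(1)])
  then show ?thesis by (rule eq_ae_continuous_imp_eq[OF l U(2) continuous_on_const _ x])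
qed

text \<open>For the solution with \<open>U''(l) = 1\<close>, \<open>edge_dissipation\<close> equates \<open>m\<close> times the squared \<open>L\<^sup>2\<close> norm of \<open>U\<close> with
  boundary terms at 0. If \<open>U 0\<close> were 0, these would be nonpositive and \<open>U\<close> would vanish, against \<open>U''(l) = 1\<close>; in general they bound the real
  part of \<open>U''(0)/U(0)\<close> from below.\<close>

lemma homogeneous_solution:
  fixes m :: real
  assumes l: "0 < l" and m: "0 < m"
  obtains U U' U'' :: "real \<Rightarrow> complex" where "primitive l U U'" "primitive l U' U''" "primitive l U'' (\<lambda>x. - U' x - of_real m * U x)"
    "U l = 0" "U' l = 0" "U 0 \<noteq> 0" "- 1 / 2 \<le> Re (U'' 0 / U 0)"
proof -
  have zero: "(\<lambda>_::real. 0::complex) absolutely_integrable_on {0..l}"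
    by (rule continuous_absint) simp
  obtain U U' U'' :: "real \<Rightarrow> complex"
    where U: "primitive l U U'" "primitive l U' U''" "primitive l U'' (\<lambda>x. 0 - U' x - of_real m * U x)"
    and bc: "U l = 0" "U' l = 0" "U'' l = 1"
    by (rule third_order_solution[OF less_imp_le[OF l] m zero, of 1])
  note c = primitive_continuous[OF U(1)] primitive_continuous[OF U(2)] primitive_continuous[OF U(3)]
  have eq: "(\<lambda>x. (- U' x - (0 - U' x - of_real m * U x)) \<bullet> U x) = (\<lambda>x. m * (cmod (U x))\<^sup>2)"
    by (simp add: power2_norm_eq_inner inner_complex_def algebra_simps)
  have id: "m * integral {0..l} (\<lambda>x. (cmod (U x))\<^sup>2) = (cmod (U 0))\<^sup>2 / 2 + U'' 0 \<bullet> U 0 - (cmod (U' 0))\<^sup>2 / 2"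
    using edge_dissipation(2)[OF l U bc(1,2)] unfolding eq by simp
  have nn: "0 \<le> integral {0..l} (\<lambda>x. (cmod (U x))\<^sup>2)"
    by (rule Henstock_Kurzweil_Integration.integral_nonneg)
       (auto intro!: integrable_continuous_real continuous_intros c)
  have U0: "U 0 \<noteq> 0"
  proof
    assume "U 0 = 0"
    then have "m * integral {0..l} (\<lambda>x. (cmod (U x))\<^sup>2) \<le> 0" using id by simp
    then have z: "integral {0..l} (\<lambda>x. (cmod (U x))\<^sup>2) = 0"
      using nn m by (simp add: mult_le_0_iff)
    have Uz: "U x = 0" if "x \<in> {0..l}" for x
    proof -
      have "continuous_on {0..l} (\<lambda>x. (cmod (U x))\<^sup>2)" by (intro continuous_intros c)
      from integral_eq_0_iff[OF this _ ] z l that show ?thesis by auto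
    qed
    have U'z: "U' x = 0" if "x \<in> {0..l}" for x by (rule primitive_of_zero[OF l U(1) c(2) Uz that])
    have "U'' x = 0" if "x \<in> {0..l}" for x by (rule primitive_of_zero[OF l U(2) c(3) U'z that])
    then show False using bc(3) l by simp
  qed
  have "0 \<le> m * integral {0..l} (\<lambda>x. (cmod (U x))\<^sup>2)" using nn m by simp
  then have "- ((cmod (U 0))\<^sup>2 / 2) \<le> U'' 0 \<bullet> U 0" unfolding id using zero_le_power2[of "cmod (U' 0)"] by linarith
  moreover have "U'' 0 \<bullet> U 0 = Re (U'' 0 / U 0) * (cmod (U 0))\<^sup>2"
  proof -
    have "(z * y) \<bullet> y = Re z * (cmod y)\<^sup>2" for z y :: complex
      unfolding cmod_power2 by (simp add: inner_complex_def power2_eq_square algebra_simps)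
    from this[of "U'' 0 / U 0" "U 0"] show ?thesis using U0 by simp
  qed
  ultimately have "(- 1 / 2) * (cmod (U 0))\<^sup>2 \<le> Re (U'' 0 / U 0) * (cmod (U 0))\<^sup>2" by simp
  then have "- 1 / 2 \<le> Re (U'' 0 / U 0)"
    using U0 by (simp only: mult_le_cancel_right) (auto simp: not_less)
  then show thesis using that[OF U(1,2) _ bc(1,2) U0] U(3) by simp
qed

section \<open>The operator on the network\<close>

lemma zero_extension_add:
  assumes "continuous_on {0..l} U" "continuous_on {0..l} V"
  shows "zero_extension l (\<lambda>x. U x + V x) = zero_extension l U + zero_extension l V"
proof (rule L2_on_eqI)
  note e = zero_extension_props[OF assms(1)] zero_extension_props[OF assms(2)] zero_extension_props[OF continuous_on_add[OF assms]]
  show "zero_extension l (\<lambda>x. U x + V x) \<in> L2_on l" "zero_extension l U + zero_extension l V \<in> L2_on l"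
    using e L2_on_add by auto
  show "eq_ae l (rep_L2 (zero_extension l (\<lambda>x. U x + V x))) (rep_L2 (zero_extension l U + zero_extension l V))"
    using e(2,4,6) eq_ae_plus[of l "zero_extension l U" "zero_extension l V"] unfolding eq_ae_def
    by eventually_elim simp
qed

lemma zero_extension_scaleC:
  assumes "continuous_on {0..l} U"
  shows "zero_extension l (\<lambda>x. c * U x) = scaleC c (zero_extension l U)"
proof (rule L2_on_eqI)
  note e = zero_extension_props[OF assms] zero_extension_props[OF continuous_on_mult_left[OF assms, of c]]
  show "zero_extension l (\<lambda>x. c * U x) \<in> L2_on l" "scaleC c (zero_extension l U) \<in> L2_on l"
    using e L2_on_scaleC by auto
  show "eq_ae l (rep_L2 (zero_extension l (\<lambda>x. c * U x))) (rep_L2 (scaleC c (zero_extension l U)))"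
    using e(2,4) eq_ae_scaleC[of l c "zero_extension l U"] unfolding eq_ae_def
    by eventually_elim simp
qed

lemma scaleC_add: "scaleC c (u + v) = scaleC c u + scaleC c v"
proof (rule L2_eqI)
  show "AE x in lebesgue. rep_L2 (scaleC c (u + v)) x = rep_L2 (scaleC c u + scaleC c v) x"
    using rep_scaleC[of c "u + v"] rep_plus[of u v] rep_plus[of "scaleC c u" "scaleC c v"] rep_scaleC[of c u] rep_scaleC[of c v]
    by eventually_elim (simp add: algebra_simps)
qed

lemma scaleC_scaleC: "scaleC c (scaleC d u) = scaleC (c * d) u"
proof (rule L2_eqI)
  show "AE x in lebesgue. rep_L2 (scaleC c (scaleC d u)) x = rep_L2 (scaleC (c * d) u) x"
    using rep_scaleC[of c "scaleC d u"] rep_scaleC[of d u] rep_scaleC[of "c * d" u]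
    by eventually_elim (simp add: algebra_simps)
qed

lemma scaleC_minus: "scaleC c (- u) = - scaleC c u"
  unfolding uminus_scaleC scaleC_scaleC by (simp add: mult.commute)

lemma scaleC_diff: "scaleC c (u - v) = scaleC c u - scaleC c v"
  using scaleC_add[of c u "- v"] by (simp add: scaleC_minus)

lemma scaleC_scaleR: "scaleC c (r *\<^sub>R u) = r *\<^sub>R scaleC c u"
  unfolding scaleR_scaleC scaleC_scaleC by (simp add: mult.commute)

lemma norm_scaleC: "norm (scaleC c u) = cmod c * norm u"
proof -
  have "(norm (scaleC c u))\<^sup>2 = (LINT x|lebesgue. (cmod c)\<^sup>2 * (cmod (rep_L2 u x))\<^sup>2)"
    unfolding norm_L2_sq
  proof (rule integral_cong_AE)
    have "(\<lambda>x. (cmod (rep_L2 v x))\<^sup>2) \<in> borel_measurable lebesgue" for v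
      using square_integrable_rep[of v] unfolding square_integrable_def by (blast intro: borel_measurable_integrable)
    then show "(\<lambda>x. (cmod (rep_L2 (scaleC c u) x))\<^sup>2) \<in> borel_measurable lebesgue"
      "(\<lambda>x. (cmod c)\<^sup>2 * (cmod (rep_L2 u x))\<^sup>2) \<in> borel_measurable lebesgue" by auto
    show "AE x in lebesgue. (cmod (rep_L2 (scaleC c u) x))\<^sup>2 = (cmod c)\<^sup>2 * (cmod (rep_L2 u x))\<^sup>2"
      using rep_scaleC[of c u] by eventually_elim (simp add: norm_mult power_mult_distrib)
  qed
  also have "\<dots> = (cmod c * norm u)\<^sup>2" unfolding power_mult_distrib norm_L2_sq by simp
  finally show ?thesis by (rule power2_eq_imp_eq) auto
qed

lemma norm_vec_sq: "(norm u)\<^sup>2 = (\<Sum>j\<in>UNIV. (norm (u $ j))\<^sup>2)" for u :: "L2 ^ 'n::finite"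
  unfolding power2_norm_eq_inner inner_vec_def by (simp add: power2_norm_eq_inner)

lemma energy_eq_norm:
  assumes "u \<in> L2_net \<ll>"
  shows "energy \<ll> u = (norm u)\<^sup>2 / 2"
proof -
  have "(LINT x:{0<..<\<ll> j}|lebesgue. (cmod (rep_L2 (u $ j) x))\<^sup>2) = (norm (u $ j))\<^sup>2" for j
    unfolding norm_L2_sq set_lebesgue_integral_def
  proof (rule integral_cong_AE)
    have m: "(\<lambda>x. (cmod (rep_L2 (u $ j) x))\<^sup>2) \<in> borel_measurable lebesgue"
      using square_integrable_rep[of "u $ j"] unfolding square_integrable_def by (blast intro: borel_measurable_integrable)
    then show "(\<lambda>x. (cmod (rep_L2 (u $ j) x))\<^sup>2) \<in> borel_measurable lebesgue" .
    show "(\<lambda>x. indicat_real {0<..<\<ll> j} x *\<^sub>R (cmod (rep_L2 (u $ j) x))\<^sup>2) \<in> borel_measurable lebesgue"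
      by (intro borel_measurable_scaleR borel_measurable_indicator m) auto
    have "u $ j \<in> L2_on (\<ll> j)" using assms unfolding L2_net_def by blast
    from L2_onD[OF this]
    show "AE x in lebesgue. indicat_real {0<..<\<ll> j} x *\<^sub>R (cmod (rep_L2 (u $ j) x))\<^sup>2 = (cmod (rep_L2 (u $ j) x))\<^sup>2"
      by eventually_elim (auto simp: indicator_def)
  qed
  then show ?thesis unfolding energy_def norm_vec_sq by simp
qed

lemma L2_netD: "u \<in> L2_net \<ll> \<Longrightarrow> u $ j \<in> L2_on (\<ll> j)"
  unfolding L2_net_def by blast

lemma L2_on_scaleR: "u \<in> L2_on l \<Longrightarrow> r *\<^sub>R u \<in> L2_on l"
  unfolding scaleR_scaleC by (rule L2_on_scaleC)

lemma subspace_L2_net: "subspace (L2_net \<ll>)"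
  unfolding subspace_def L2_net_def by (simp add: L2_on_zero L2_on_add L2_on_scaleR)

lemma closed_L2_net: "closed (L2_net (\<ll> :: 'n::finite \<Rightarrow> real))"
proof -
  have "closed ((\<lambda>u :: L2 ^ 'n. u $ j) -` L2_on (\<ll> j))" for j
    by (intro continuous_closed_vimage closed_L2_on continuous_intros)
  then have "closed (\<Inter>j. (\<lambda>u :: L2 ^ 'n. u $ j) -` L2_on (\<ll> j))" by (intro closed_INT ballI)
  moreover have "(\<Inter>j. (\<lambda>u :: L2 ^ 'n. u $ j) -` L2_on (\<ll> j)) = L2_net \<ll>" unfolding L2_net_def by auto
  ultimately show ?thesis by simp
qed

text \<open>Membership in the domain of the operator, stated for the classical representatives on the edges.\<close>

definition net_rep where
  "net_rep \<ll> e1 \<alpha> u U U' U'' w \<longleftrightarrow> (\<forall>j. H3_rep (\<ll> j) (u $ j) (U j) (U' j) (U'' j) (w j)) \<and>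
     (\<forall>j. U j (\<ll> j) = 0 \<and> U' j (\<ll> j) = 0) \<and> (\<forall>j k. U j 0 = U k 0) \<and>
     (\<Sum>j\<in>UNIV. U'' j 0) = - complex_of_real \<alpha> * U e1 0"

lemma scaleR_scaleC_net: "r *\<^sub>R u = scaleC_net (complex_of_real r) u"
  unfolding scaleC_net_def by (simp add: vec_eq_iff scaleR_scaleC)

lemma H3_rep_continuous: "H3_rep l u U U' U'' w \<Longrightarrow> continuous_on {0..l} U'"
  using H3_repD(5) primitive_continuous by blast

lemma net_repD:
  assumes "net_rep \<ll> e1 \<alpha> u U U' U'' w"
  shows "H3_rep (\<ll> j) (u $ j) (U j) (U' j) (U'' j) (w j)" "U j (\<ll> j) = 0" "U' j (\<ll> j) = 0" "U j 0 = U k 0"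
    "(\<Sum>j\<in>UNIV. U'' j 0) = - complex_of_real \<alpha> * U e1 0"
  using assms unfolding net_rep_def by blast+

lemma net_rep_add:
  assumes "net_rep \<ll> e1 \<alpha> u U U' U'' w" "net_rep \<ll> e1 \<alpha> v V V' V'' z"
  shows "net_rep \<ll> e1 \<alpha> (u + v) (\<lambda>j x. U j x + V j x) (\<lambda>j x. U' j x + V' j x) (\<lambda>j x. U'' j x + V'' j x) (\<lambda>j. w j + z j)"
  unfolding net_rep_def
proof (intro conjI allI)
  note U = net_repD[OF assms(1)] and V = net_repD[OF assms(2)]
  show "H3_rep (\<ll> j) ((u + v) $ j) (\<lambda>x. U j x + V j x) (\<lambda>x. U' j x + V' j x) (\<lambda>x. U'' j x + V'' j x) (w j + z j)" for j
    unfolding vector_add_component by (rule H3_rep_add[OF U(1) V(1)])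
  show "U j (\<ll> j) + V j (\<ll> j) = 0" "U' j (\<ll> j) + V' j (\<ll> j) = 0" for j
    unfolding U(2,3) V(2,3) by simp_all
  show "U j 0 + V j 0 = U k 0 + V k 0" for j k using U(4)[of j k] V(4)[of j k] by simp
  show "(\<Sum>j\<in>UNIV. U'' j 0 + V'' j 0) = - complex_of_real \<alpha> * (U e1 0 + V e1 0)"
    unfolding sum.distrib U(5) V(5) by (simp add: algebra_simps)
qed

lemma net_rep_scaleC:
  assumes "net_rep \<ll> e1 \<alpha> u U U' U'' w"
  shows "net_rep \<ll> e1 \<alpha> (scaleC_net c u) (\<lambda>j x. c * U j x) (\<lambda>j x. c * U' j x) (\<lambda>j x. c * U'' j x) (\<lambda>j. scaleC c (w j))"
  unfolding net_rep_def
proof (intro conjI allI)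
  note U = net_repD[OF assms]
  show "H3_rep (\<ll> j) (scaleC_net c u $ j) (\<lambda>x. c * U j x) (\<lambda>x. c * U' j x) (\<lambda>x. c * U'' j x) (scaleC c (w j))" for j
    unfolding scaleC_net_def vec_lambda_beta by (rule H3_rep_scaleC[OF U(1)])
  show "c * U j (\<ll> j) = 0" "c * U' j (\<ll> j) = 0" for j unfolding U(2,3) by simp_all
  show "c * U j 0 = c * U k 0" for j k using U(4)[of j k] by simp
  show "(\<Sum>j\<in>UNIV. c * U'' j 0) = - complex_of_real \<alpha> * (c * U e1 0)"
    unfolding sum_distrib_left[symmetric] U(5) by (simp add: algebra_simps)
qed

context
  fixes \<ll> :: "'n::finite \<Rightarrow> real"
  assumes pos: "\<And>j. 0 < \<ll> j"
begin

lemma net_rep_facts: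
  assumes "net_rep \<ll> e1 \<alpha> u U U' U'' w"
  shows "u \<in> dom_A \<ll> e1 \<alpha>" "op_A \<ll> u = (\<chi> j. - zero_extension (\<ll> j) (U' j) - w j)"
    "pt_value (\<ll> j) (u $ j) 0 = U j 0" "pt_value (\<ll> j) (weak_deriv (\<ll> j) (u $ j)) 0 = U' j 0"
proof -
  have H: "H3_rep (\<ll> j) (u $ j) (U j) (U' j) (U'' j) (w j)" for j
    using assms unfolding net_rep_def by blast
  note f = H3_rep_facts[OF pos H]
  have z: "0 \<in> {0..\<ll> j}" "\<ll> j \<in> {0..\<ll> j}" for j using pos[of j] by auto
  show "u \<in> dom_A \<ll> e1 \<alpha>"
    unfolding dom_A_def H2e_def mem_Collect_eq f(6)[OF z(1)] f(6)[OF z(2)] f(7)[OF z(2)] f(8)[OF z(1)]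
    using f(1,2) assms unfolding net_rep_def by blast
  show "op_A \<ll> u = (\<chi> j. - zero_extension (\<ll> j) (U' j) - w j)"
    unfolding op_A_def f(5) unfolding f(3) ..
  show "pt_value (\<ll> j) (u $ j) 0 = U j 0" "pt_value (\<ll> j) (weak_deriv (\<ll> j) (u $ j)) 0 = U' j 0"
    using f(6,7) z by auto
qed

lemma dom_A_imp_net_rep:
  assumes "u \<in> dom_A \<ll> e1 \<alpha>"
  obtains U U' U'' w where "net_rep \<ll> e1 \<alpha> u U U' U'' w"
proof -
  have "\<exists>U U' U'' w. H3_rep (\<ll> j) (u $ j) U U' U'' w" for j
  proof -
    have "u $ j \<in> sobolev 3 (\<ll> j)" using assms unfolding dom_A_def by blast
    from sobolev_3_imp_H3_rep[OF pos this] show ?thesis by metis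
  qed
  then obtain U U' U'' w where H: "\<And>j. H3_rep (\<ll> j) (u $ j) (U j) (U' j) (U'' j) (w j)" by metis
  note f = H3_rep_facts[OF pos H]
  have z: "0 \<in> {0..\<ll> j}" "\<ll> j \<in> {0..\<ll> j}" for j using pos[of j] by auto
  have "net_rep \<ll> e1 \<alpha> u U U' U'' w"
    using assms unfolding dom_A_def H2e_def mem_Collect_eq f(6)[OF z(1)] f(6)[OF z(2)] f(7)[OF z(2)] f(8)[OF z(1)] net_rep_def
    using H by blast
  then show thesis by (rule that)
qed

lemma op_A_add:
  assumes "u \<in> dom_A \<ll> e1 \<alpha>" "v \<in> dom_A \<ll> e1 \<alpha>"
  shows "u + v \<in> dom_A \<ll> e1 \<alpha>" "op_A \<ll> (u + v) = op_A \<ll> u + op_A \<ll> v"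
proof -
  obtain U U' U'' w where U: "net_rep \<ll> e1 \<alpha> u U U' U'' w" by (rule dom_A_imp_net_rep[OF assms(1)])
  obtain V V' V'' z where V: "net_rep \<ll> e1 \<alpha> v V V' V'' z" by (rule dom_A_imp_net_rep[OF assms(2)])
  note UV = net_rep_add[OF U V]
  show "u + v \<in> dom_A \<ll> e1 \<alpha>" by (rule net_rep_facts(1)[OF UV])
  have c: "continuous_on {0..\<ll> j} (U' j)" "continuous_on {0..\<ll> j} (V' j)" for j
    using U V H3_rep_continuous unfolding net_rep_def by blast+
  show "op_A \<ll> (u + v) = op_A \<ll> u + op_A \<ll> v"
    unfolding net_rep_facts(2)[OF UV] net_rep_facts(2)[OF U] net_rep_facts(2)[OF V]
    by (simp add: vec_eq_iff zero_extension_add[OF c])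
qed

lemma op_A_scaleC:
  assumes "u \<in> dom_A \<ll> e1 \<alpha>"
  shows "scaleC_net c u \<in> dom_A \<ll> e1 \<alpha>" "op_A \<ll> (scaleC_net c u) = scaleC_net c (op_A \<ll> u)"
proof -
  obtain U U' U'' w where U: "net_rep \<ll> e1 \<alpha> u U U' U'' w" by (rule dom_A_imp_net_rep[OF assms(1)])
  note cU = net_rep_scaleC[OF U]
  show "scaleC_net c u \<in> dom_A \<ll> e1 \<alpha>" by (rule net_rep_facts(1)[OF cU])
  have c: "continuous_on {0..\<ll> j} (U' j)" for j
    using U H3_rep_continuous unfolding net_rep_def by blast
  show "op_A \<ll> (scaleC_net c u) = scaleC_net c (op_A \<ll> u)"
    unfolding net_rep_facts(2)[OF cU] net_rep_facts(2)[OF U]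
    by (simp add: vec_eq_iff scaleC_net_def zero_extension_scaleC[OF c] scaleC_diff scaleC_minus)
qed

lemma op_A_in_L2_net:
  assumes "u \<in> dom_A \<ll> e1 \<alpha>"
  shows "u \<in> L2_net \<ll>" "op_A \<ll> u \<in> L2_net \<ll>"
proof -
  obtain U U' U'' w where U: "net_rep \<ll> e1 \<alpha> u U U' U'' w" by (rule dom_A_imp_net_rep[OF assms(1)])
  then have H: "H3_rep (\<ll> j) (u $ j) (U j) (U' j) (U'' j) (w j)" for j unfolding net_rep_def by blast
  show "u \<in> L2_net \<ll>" using H3_repD(1)[OF H] unfolding L2_net_def by blast
  have "- zero_extension (\<ll> j) (U' j) - w j \<in> L2_on (\<ll> j)" for j
    by (intro L2_on_diff L2_on_uminus zero_extension_props(1) H3_rep_continuous[OF H] H3_repD(2)[OF H])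
  then show "op_A \<ll> u \<in> L2_net \<ll>" unfolding net_rep_facts(2)[OF U] L2_net_def by simp
qed

lemma subspace_dom_A: "subspace (dom_A \<ll> e1 \<alpha>)"
  unfolding subspace_def
proof (intro conjI ballI allI)
  have e: "zero_extension l (\<lambda>_. 0) \<in> L2_on l" "eq_ae l (rep_L2 0) (\<lambda>_. 0)" for l
    using zero_extension_props[of l "\<lambda>_. 0"] rep_zero unfolding eq_ae_def by (auto elim: eventually_mono)
  have "primitive l (\<lambda>_. 0 :: complex) (\<lambda>_. 0)" for l
    by (rule primitiveI) (auto intro: continuous_absint[OF continuous_on_const])
  moreover from this have "primitive l (\<lambda>_. 0) (rep_L2 0)" for l
    by (rule primitive_cong_ae[OF eq_ae_sym[OF e(2)]])
  ultimately have "H3_rep l 0 (\<lambda>_. 0) (\<lambda>_. 0) (\<lambda>_. 0) 0" for l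
    unfolding H3_rep_def using L2_on_zero e(2) by blast
  then have "net_rep \<ll> e1 \<alpha> 0 (\<lambda>_ _. 0) (\<lambda>_ _. 0) (\<lambda>_ _. 0) (\<lambda>_. 0)"
    unfolding net_rep_def by simp
  then show "0 \<in> dom_A \<ll> e1 \<alpha>" by (rule net_rep_facts(1))
  show "u + v \<in> dom_A \<ll> e1 \<alpha>" if "u \<in> dom_A \<ll> e1 \<alpha>" "v \<in> dom_A \<ll> e1 \<alpha>" for u v
    by (rule op_A_add(1)[OF that])
  show "r *\<^sub>R u \<in> dom_A \<ll> e1 \<alpha>" if "u \<in> dom_A \<ll> e1 \<alpha>" for r u
    unfolding scaleR_scaleC_net by (rule op_A_scaleC(1)[OF that])
qed

text \<open>The real inner product is the real part of the Hermitian one, so this is the formula for \<open>Re (A u, u)\<close>. The node condition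
  turns the sum of the terms \<open>U'' j 0 \<bullet> U j 0\<close> into \<open>- \<alpha>\<close> times the squared modulus of the common value.\<close>

lemma op_A_dissipation:
  assumes "u \<in> dom_A \<ll> e1 \<alpha>"
  shows "op_A \<ll> u \<bullet> u = dissipation e1 \<alpha> (\<lambda>j. pt_value (\<ll> j) (u $ j) 0)
    (\<lambda>j. pt_value (\<ll> j) (weak_deriv (\<ll> j) (u $ j)) 0)"
proof -
  obtain U U' U'' w where U: "net_rep \<ll> e1 \<alpha> u U U' U'' w" by (rule dom_A_imp_net_rep[OF assms(1)])
  then have H: "H3_rep (\<ll> j) (u $ j) (U j) (U' j) (U'' j) (w j)" for j unfolding net_rep_def by blast
  have bc: "U j (\<ll> j) = 0" "U' j (\<ll> j) = 0" "U j 0 = U e1 0" for j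
    using U unfolding net_rep_def by blast+
  have node: "(\<Sum>j\<in>UNIV. U'' j 0) = - complex_of_real \<alpha> * U e1 0"
    using U unfolding net_rep_def by blast
  have edge: "(- zero_extension (\<ll> j) (U' j) - w j) \<bullet> (u $ j)
      = (cmod (U e1 0))\<^sup>2 / 2 + U'' j 0 \<bullet> U e1 0 - (cmod (U' j 0))\<^sup>2 / 2" for j
  proof -
    note h = H3_repD[OF H[of j]]
    note ed = edge_dissipation[OF pos h(4,5,6) bc(1,2)]
    have "eq_ae (\<ll> j) (rep_L2 (- zero_extension (\<ll> j) (U' j) - w j)) (\<lambda>x. - U' j x - rep_L2 (w j) x)"
      using zero_extension_props(2)[OF H3_rep_continuous[OF H[of j]]] rep_minus[of "- zero_extension (\<ll> j) (U' j)" "w j"]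
        rep_uminus[of "zero_extension (\<ll> j) (U' j)"] unfolding eq_ae_def
      by eventually_elim simp
    from inner_L2_on[OF h(1) this h(3) ed(1)] ed(2) bc(3)[of j] show ?thesis by simp
  qed
  have "op_A \<ll> u \<bullet> u = (\<Sum>j\<in>UNIV. (cmod (U e1 0))\<^sup>2 / 2 + U'' j 0 \<bullet> U e1 0 - (cmod (U' j 0))\<^sup>2 / 2)"
    unfolding net_rep_facts(2)[OF U] inner_vec_def by (simp add: edge)
  also have "\<dots> = real CARD('n) / 2 * (cmod (U e1 0))\<^sup>2 + (\<Sum>j\<in>UNIV. U'' j 0) \<bullet> U e1 0 - 1/2 * (\<Sum>j\<in>UNIV. (cmod (U' j 0))\<^sup>2)"
    by (simp add: sum.distrib sum_subtractf inner_sum_left sum_divide_distrib)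
  also have "(\<Sum>j\<in>UNIV. U'' j 0) \<bullet> U e1 0 = - \<alpha> * (cmod (U e1 0))\<^sup>2"
    unfolding node cmod_power2 by (simp add: inner_complex_def power2_eq_square algebra_simps)
  finally show ?thesis
    unfolding dissipation_def net_rep_facts(3,4)[OF U] by (simp add: algebra_simps)
qed

text \<open>On the edge \<open>j\<close> take a particular solution \<open>P j\<close> and a homogeneous solution \<open>Q j\<close>, both compatible with the conditions
  at the outer end. Prescribing the value \<open>d\<close> at the node fixes the multiple \<open>s j\<close> of \<open>Q j\<close>, and the condition on the second
  derivatives becomes \<open>d * K\<close> equal to a known number.\<close>

lemma op_A_range:
  assumes \<alpha>: "\<alpha> > real CARD('n) / 2" and h: "0 < h" and f: "f \<in> L2_net \<ll>"
  shows "\<exists>u\<in>dom_A \<ll> e1 \<alpha>. u - h *\<^sub>R op_A \<ll> u = f"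
proof -
  define m where "m = 1 / h"
  have m: "0 < m" "h * m = 1" unfolding m_def using h by auto
  define part where "part j P P' P'' \<longleftrightarrow> primitive (\<ll> j) P P' \<and> primitive (\<ll> j) P' P'' \<and>
    primitive (\<ll> j) P'' (\<lambda>x. of_real m * rep_L2 (f $ j) x - P' x - of_real m * P x) \<and> P (\<ll> j) = 0 \<and> P' (\<ll> j) = 0"
    for j P P' P''
  have "\<exists>P P' P''. part j P P' P''" for j
  proof -
    have "(\<lambda>x. of_real m * rep_L2 (f $ j) x) absolutely_integrable_on {0..\<ll> j}"
      by (intro absint_product_continuous[OF bounded_bilinear_mult continuous_on_const rep_absint])
    then obtain P P' P'' where *: "primitive (\<ll> j) P P'" "primitive (\<ll> j) P' P''"
      "primitive (\<ll> j) P'' (\<lambda>x. of_real m * rep_L2 (f $ j) x - P' x - of_real m * P x)" "P (\<ll> j) = 0" "P' (\<ll> j) = 0"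
      by (rule third_order_solution[OF less_imp_le[OF pos] m(1), where c = 0])
    have "part j P P' P''" unfolding part_def by (intro conjI *)
    then show ?thesis by blast
  qed
  then obtain P P' P'' where part: "part j (P j) (P' j) (P'' j)" for j by metis
  then have P: "primitive (\<ll> j) (P j) (P' j)" "primitive (\<ll> j) (P' j) (P'' j)"
      "primitive (\<ll> j) (P'' j) (\<lambda>x. of_real m * rep_L2 (f $ j) x - P' j x - of_real m * P j x)"
      "P j (\<ll> j) = 0" "P' j (\<ll> j) = 0" for j
    unfolding part_def by blast+
  define hom where "hom j Q Q' Q'' \<longleftrightarrow> primitive (\<ll> j) Q Q' \<and> primitive (\<ll> j) Q' Q'' \<and>
    primitive (\<ll> j) Q'' (\<lambda>x. - Q' x - of_real m * Q x) \<and> Q (\<ll> j) = 0 \<and> Q' (\<ll> j) = 0 \<and> Q 0 \<noteq> 0 \<and>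
    - 1 / 2 \<le> Re (Q'' 0 / Q 0)" for j Q Q' Q''
  have "\<exists>Q Q' Q''. hom j Q Q' Q''" for j
  proof -
    obtain Q Q' Q'' :: "real \<Rightarrow> complex" where *: "primitive (\<ll> j) Q Q'" "primitive (\<ll> j) Q' Q''"
      "primitive (\<ll> j) Q'' (\<lambda>x. - Q' x - of_real m * Q x)" "Q (\<ll> j) = 0" "Q' (\<ll> j) = 0" "Q 0 \<noteq> 0"
      "- 1 / 2 \<le> Re (Q'' 0 / Q 0)"
      by (rule homogeneous_solution[OF pos m(1)])
    have "hom j Q Q' Q''" unfolding hom_def by (intro conjI *)
    then show ?thesis by blast
  qed
  then obtain Q Q' Q'' where hom: "hom j (Q j) (Q' j) (Q'' j)" for j by metis
  then have Q: "primitive (\<ll> j) (Q j) (Q' j)" "primitive (\<ll> j) (Q' j) (Q'' j)"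
      "primitive (\<ll> j) (Q'' j) (\<lambda>x. - Q' j x - of_real m * Q j x)"
      "Q j (\<ll> j) = 0" "Q' j (\<ll> j) = 0" "Q j 0 \<noteq> 0" "- 1 / 2 \<le> Re (Q'' j 0 / Q j 0)" for j
    unfolding hom_def by blast+
  define \<kappa> where "\<kappa> j = Q'' j 0 / Q j 0" for j
  \<comment> \<open>The coefficient of the unknown node value in the node condition; \<open>\<kappa> j\<close> is its contribution from the edge \<open>j\<close>.\<close>
  define K where "K = complex_of_real \<alpha> + (\<Sum>j\<in>UNIV. \<kappa> j)"
  have "(\<Sum>j\<in>(UNIV::'n set). - 1 / 2) \<le> (\<Sum>j\<in>UNIV. Re (\<kappa> j))"
    unfolding \<kappa>_def by (intro sum_mono Q(7))
  then have "0 < Re K" unfolding K_def using \<alpha> by simp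
  then have K: "K \<noteq> 0" by auto
  define d where "d = (\<Sum>j\<in>UNIV. P j 0 * \<kappa> j - P'' j 0) / K"
  define s where "s j = (d - P j 0) / Q j 0" for j
  define U where "U j x = P j x + s j * Q j x" for j x
  define U' where "U' j x = P' j x + s j * Q' j x" for j x
  define U'' where "U'' j x = P'' j x + s j * Q'' j x" for j x
  have lin: "primitive l (\<lambda>x. c * V x) (\<lambda>x. c * V' x)" if "primitive l V V'" for c :: complex and V V' l
    by (rule primitive_linear[OF that bounded_linear_mult_right])
  have U: "primitive (\<ll> j) (U j) (U' j)" "primitive (\<ll> j) (U' j) (U'' j)" for j
    unfolding U_def U'_def U''_def by (intro primitive_add lin P Q)+
  have U''p: "primitive (\<ll> j) (U'' j) (\<lambda>x. of_real m * rep_L2 (f $ j) x - U' j x - of_real m * U j x)" for j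
  proof -
    have "(\<lambda>x. (of_real m * rep_L2 (f $ j) x - P' j x - of_real m * P j x) + s j * (- Q' j x - of_real m * Q j x))
        = (\<lambda>x. of_real m * rep_L2 (f $ j) x - U' j x - of_real m * U j x)"
      unfolding U_def U'_def by (simp add: algebra_simps)
    with primitive_add[OF P(3) lin[OF Q(3)], of j "s j"] show ?thesis unfolding U''_def by simp
  qed
  define u where "u = (\<chi> j. zero_extension (\<ll> j) (U j))"
  define w where "w j = scaleC (of_real m) (f $ j) - zero_extension (\<ll> j) (U' j) - scaleC (of_real m) (zero_extension (\<ll> j) (U j))" for j
  have c: "continuous_on {0..\<ll> j} (U j)" "continuous_on {0..\<ll> j} (U' j)" for j
    using U primitive_continuous by blast+
  have H: "H3_rep (\<ll> j) (u $ j) (U j) (U' j) (U'' j) (w j)" for j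
    unfolding H3_rep_def
  proof (intro conjI)
    show "u $ j \<in> L2_on (\<ll> j)" "eq_ae (\<ll> j) (rep_L2 (u $ j)) (U j)"
      unfolding u_def using zero_extension_props[OF c(1)[of j]] by auto
    show "w j \<in> L2_on (\<ll> j)" unfolding w_def
      by (intro L2_on_diff L2_on_scaleC L2_netD[OF f] zero_extension_props(1) c)
    have "eq_ae (\<ll> j) (\<lambda>x. of_real m * rep_L2 (f $ j) x - U' j x - of_real m * U j x) (rep_L2 (w j))"
      using zero_extension_props(2)[OF c(1)[of j]] zero_extension_props(2)[OF c(2)[of j]] rep_scaleC[of "of_real m" "f $ j"]
        rep_scaleC[of "of_real m" "zero_extension (\<ll> j) (U j)"]
        rep_minus[of "scaleC (of_real m) (f $ j)" "zero_extension (\<ll> j) (U' j)"]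
        rep_minus[of "scaleC (of_real m) (f $ j) - zero_extension (\<ll> j) (U' j)" "scaleC (of_real m) (zero_extension (\<ll> j) (U j))"]
      unfolding eq_ae_def w_def by eventually_elim simp
    then show "primitive (\<ll> j) (U'' j) (rep_L2 (w j))" by (rule primitive_cong_ae[OF _ U''p])
  qed (rule U)+
  have U0: "U j 0 = d" for j unfolding U_def s_def using Q(6) by simp
  have "(\<Sum>j\<in>UNIV. U'' j 0) = (\<Sum>j\<in>UNIV. P'' j 0 - P j 0 * \<kappa> j + d * \<kappa> j)"
    unfolding U''_def s_def \<kappa>_def using Q(6)
    by (intro sum.cong) (auto simp: diff_divide_distrib algebra_simps)
  also have "\<dots> = - (\<Sum>j\<in>UNIV. P j 0 * \<kappa> j - P'' j 0) + d * (\<Sum>j\<in>UNIV. \<kappa> j)"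
    by (simp add: sum.distrib sum_subtractf sum_distrib_left)
  also have "(\<Sum>j\<in>UNIV. P j 0 * \<kappa> j - P'' j 0) = d * K" unfolding d_def using K by simp
  also have "- (d * K) + d * (\<Sum>j\<in>UNIV. \<kappa> j) = - of_real \<alpha> * d" unfolding K_def by (simp add: algebra_simps)
  finally have node: "(\<Sum>j\<in>UNIV. U'' j 0) = - complex_of_real \<alpha> * U e1 0" unfolding U0 .
  have "net_rep \<ll> e1 \<alpha> u U U' U'' w"
    unfolding net_rep_def using H node U0 P(4,5) Q(4,5) by (simp add: U_def U'_def)
  note N = net_rep_facts[OF this]
  have "u - h *\<^sub>R op_A \<ll> u = f"
    unfolding N(2) vec_eq_iff
  proof
    fix j
    have "zero_extension (\<ll> j) (U j) - h *\<^sub>R (- zero_extension (\<ll> j) (U' j) - w j) = (1 - h * m) *\<^sub>R zero_extension (\<ll> j) (U j) + (h * m) *\<^sub>R (f $ j)"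
      unfolding w_def scaleR_scaleC[symmetric] by (simp add: algebra_simps)
    then show "(u - h *\<^sub>R (\<chi> j. - zero_extension (\<ll> j) (U' j) - w j)) $ j = f $ j"
      unfolding m(2) u_def by simp
  qed
  then show ?thesis using N(1) by blast
qed

end

section \<open>The semigroup of the network\<close>

lemma dissipation_nonpos:
  assumes "\<alpha> > real CARD('n::finite) / 2"
  shows "dissipation (e1 :: 'n) \<alpha> z w \<le> 0"
proof -
  have "0 \<le> (\<alpha> - real CARD('n) / 2) * (cmod (z e1))\<^sup>2" using assms by simp
  moreover have "0 \<le> (\<Sum>j\<in>UNIV. (cmod (w j))\<^sup>2)" by (intro sum_nonneg) simp
  ultimately show ?thesis unfolding dissipation_def by linarith
qed

lemma dissipation_bounds:
  assumes "\<alpha> > real CARD('n::finite) / 2"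
  shows "(\<alpha> - real CARD('n) / 2) * (cmod (z e1))\<^sup>2 \<le> - dissipation (e1 :: 'n) \<alpha> z w"
    "(cmod (w j))\<^sup>2 \<le> - 2 * dissipation e1 \<alpha> z w"
proof -
  have 1: "0 \<le> (\<alpha> - real CARD('n) / 2) * (cmod (z e1))\<^sup>2" using assms by simp
  have 2: "(cmod (w j))\<^sup>2 \<le> (\<Sum>j\<in>UNIV. (cmod (w j))\<^sup>2)" by (rule member_le_sum) auto
  have 3: "0 \<le> (\<Sum>j\<in>UNIV. (cmod (w j))\<^sup>2)" by (intro sum_nonneg) simp
  show "(\<alpha> - real CARD('n) / 2) * (cmod (z e1))\<^sup>2 \<le> - dissipation e1 \<alpha> z w"
    unfolding dissipation_def using 3 by linarith
  show "(cmod (w j))\<^sup>2 \<le> - 2 * dissipation e1 \<alpha> z w"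
  proof -
    have "- 2 * dissipation e1 \<alpha> z w = 2 * ((\<alpha> - real CARD('n) / 2) * (cmod (z e1))\<^sup>2) + (\<Sum>j\<in>UNIV. (cmod (w j))\<^sup>2)"
      unfolding dissipation_def by (simp add: algebra_simps)
    then show ?thesis using 1 2 by linarith
  qed
qed

lemma dissipation_has_integral_split:
  fixes z w :: "'n::finite \<Rightarrow> real \<Rightarrow> complex"
  assumes "\<And>j. (\<lambda>t. (cmod (z j t))\<^sup>2) integrable_on S" "\<And>j. (\<lambda>t. (cmod (w j t))\<^sup>2) integrable_on S"
  shows "((\<lambda>t. dissipation e1 \<alpha> (\<lambda>j. z j t) (\<lambda>j. w j t)) has_integral
    (- (\<alpha> - real CARD('n) / 2) * integral S (\<lambda>t. (cmod (z e1 t))\<^sup>2) - 1/2 * (\<Sum>j\<in>UNIV. integral S (\<lambda>t. (cmod (w j t))\<^sup>2)))) S"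
  unfolding dissipation_def
  by (intro has_integral_diff has_integral_mult_right has_integral_sum integrable_integral assms) simp

lemma norm_scaleC_net: "norm (scaleC_net c u) = cmod c * norm u"
proof -
  have "(norm (scaleC_net c u))\<^sup>2 = (cmod c * norm u)\<^sup>2"
    unfolding power_mult_distrib norm_vec_sq scaleC_net_def
    by (simp add: norm_scaleC power_mult_distrib sum_distrib_left)
  then show ?thesis by (rule power2_eq_imp_eq) auto
qed

lemma scaleC_net_diff: "scaleC_net c (u - v) = scaleC_net c u - scaleC_net c v"
  unfolding scaleC_net_def by (simp add: vec_eq_iff scaleC_diff)

lemma scaleC_net_scaleR: "scaleC_net c (r *\<^sub>R u) = r *\<^sub>R scaleC_net c u"
  unfolding scaleC_net_def by (simp add: vec_eq_iff scaleC_scaleR)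

lemma scaleC_net_in_L2_net: "u \<in> L2_net \<ll> \<Longrightarrow> scaleC_net c u \<in> L2_net \<ll>"
  unfolding L2_net_def scaleC_net_def by (simp add: L2_on_scaleC)

lemma maximal_dissipative_op_A:
  fixes \<ll> :: "'n::finite \<Rightarrow> real"
  assumes pos: "\<And>j. 0 < \<ll> j" and \<alpha>: "\<alpha> > real CARD('n) / 2"
  shows "maximal_dissipative (L2_net \<ll>) (dom_A \<ll> e1 \<alpha>) (op_A \<ll>)"
proof
  show "closed (L2_net \<ll>)" "subspace (L2_net \<ll>)" by (rule closed_L2_net subspace_L2_net)+
  show "dom_A \<ll> e1 \<alpha> \<subseteq> L2_net \<ll>" by (rule subsetI) (rule op_A_in_L2_net(1)[OF pos])
  show "subspace (dom_A \<ll> e1 \<alpha>)" by (rule subspace_dom_A[OF pos])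
  show "op_A \<ll> u \<in> L2_net \<ll>" if "u \<in> dom_A \<ll> e1 \<alpha>" for u by (rule op_A_in_L2_net(2)[OF pos that])
  show "op_A \<ll> (u + v) = op_A \<ll> u + op_A \<ll> v" if "u \<in> dom_A \<ll> e1 \<alpha>" "v \<in> dom_A \<ll> e1 \<alpha>" for u v
    by (rule op_A_add(2)[OF pos that])
  show "op_A \<ll> (c *\<^sub>R u) = c *\<^sub>R op_A \<ll> u" if "u \<in> dom_A \<ll> e1 \<alpha>" for c u
    unfolding scaleR_scaleC_net by (rule op_A_scaleC(2)[OF pos that])
  show "op_A \<ll> u \<bullet> u \<le> 0" if "u \<in> dom_A \<ll> e1 \<alpha>" for u
    unfolding op_A_dissipation[OF pos that] by (rule dissipation_nonpos[OF \<alpha>])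
  show "\<exists>u\<in>dom_A \<ll> e1 \<alpha>. u - h *\<^sub>R op_A \<ll> u = f" if "0 < h" "f \<in> L2_net \<ll>" for h f
    by (rule op_A_range[OF pos \<alpha> that])
qed

lemma node_trace_diff:
  fixes \<ll> :: "'n::finite \<Rightarrow> real"
  assumes pos: "\<And>j. 0 < \<ll> j" and u: "u \<in> dom_A \<ll> e1 \<alpha>" and v: "v \<in> dom_A \<ll> e1 \<alpha>"
  shows "pt_value (\<ll> j) ((u - v) $ j) 0 = pt_value (\<ll> j) (u $ j) 0 - pt_value (\<ll> j) (v $ j) 0"
    "pt_value (\<ll> j) (weak_deriv (\<ll> j) ((u - v) $ j)) 0
      = pt_value (\<ll> j) (weak_deriv (\<ll> j) (u $ j)) 0 - pt_value (\<ll> j) (weak_deriv (\<ll> j) (v $ j)) 0"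
proof -
  obtain U U' U'' w where U: "net_rep \<ll> e1 \<alpha> u U U' U'' w" by (rule dom_A_imp_net_rep[OF pos u])
  obtain V V' V'' z where V: "net_rep \<ll> e1 \<alpha> v V V' V'' z" by (rule dom_A_imp_net_rep[OF pos v])
  have eq: "u - v = u + scaleC_net (- 1) v"
    by (simp add: vec_eq_iff scaleC_net_def flip: uminus_scaleC)
  note UV = net_rep_add[OF U net_rep_scaleC[OF V, of "- 1"], folded eq]
  show "pt_value (\<ll> j) ((u - v) $ j) 0 = pt_value (\<ll> j) (u $ j) 0 - pt_value (\<ll> j) (v $ j) 0"
    unfolding net_rep_facts(3)[OF pos UV] net_rep_facts(3)[OF pos U] net_rep_facts(3)[OF pos V] by simp
  show "pt_value (\<ll> j) (weak_deriv (\<ll> j) ((u - v) $ j)) 0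
      = pt_value (\<ll> j) (weak_deriv (\<ll> j) (u $ j)) 0 - pt_value (\<ll> j) (weak_deriv (\<ll> j) (v $ j)) 0"
    unfolding net_rep_facts(4)[OF pos UV] net_rep_facts(4)[OF pos U] net_rep_facts(4)[OF pos V] by simp
qed

locale star_network =
  fixes \<ll> :: "'n::finite \<Rightarrow> real" and e1 :: 'n and \<alpha> :: real
  assumes lengths_pos: "0 < \<ll> j" and damping: "\<alpha> > real CARD('n) / 2"

sublocale star_network \<subseteq> maximal_dissipative "L2_net \<ll>" "dom_A \<ll> e1 \<alpha>" "op_A \<ll>"
  by (rule maximal_dissipative_op_A[OF lengths_pos damping])

context star_network
begin

abbreviation value_trace where "value_trace j u \<equiv> pt_value (\<ll> j) (u $ j) 0"
abbreviation slope_trace where "slope_trace j u \<equiv> pt_value (\<ll> j) (weak_deriv (\<ll> j) (u $ j)) 0"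

text \<open>The strict inequality \<open>\<alpha> > N/2\<close> is what makes the value at the node controlled by the dissipation.\<close>

lemma value_trace_bound:
  assumes "u \<in> dom_A \<ll> e1 \<alpha>"
  shows "(cmod (value_trace j u))\<^sup>2 \<le> - (1 / (\<alpha> - real CARD('n) / 2)) * (op_A \<ll> u \<bullet> u)"
proof -
  obtain U U' U'' w where U: "net_rep \<ll> e1 \<alpha> u U U' U'' w" by (rule dom_A_imp_net_rep[OF lengths_pos assms])
  have "value_trace j u = value_trace e1 u"
    unfolding net_rep_facts(3)[OF lengths_pos U] by (rule net_repD(4)[OF U])
  moreover have "(\<alpha> - real CARD('n) / 2) * (cmod (value_trace e1 u))\<^sup>2 \<le> - (op_A \<ll> u \<bullet> u)"
    unfolding op_A_dissipation[OF lengths_pos assms]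
    by (rule dissipation_bounds(1)[OF damping, where z = "\<lambda>j. value_trace j u"])
  moreover have a: "0 < \<alpha> - real CARD('n) / 2" using damping by simp
  ultimately have "(cmod (value_trace j u))\<^sup>2 \<le> - (op_A \<ll> u \<bullet> u) / (\<alpha> - real CARD('n) / 2)"
    unfolding pos_le_divide_eq[OF a] by (simp add: mult.commute)
  then show ?thesis by simp
qed

lemma slope_trace_bound:
  assumes "u \<in> dom_A \<ll> e1 \<alpha>"
  shows "(cmod (slope_trace j u))\<^sup>2 \<le> - 2 * (op_A \<ll> u \<bullet> u)"
  unfolding op_A_dissipation[OF lengths_pos assms]
  by (rule dissipation_bounds(2)[OF damping, where w = "\<lambda>j. slope_trace j u"])

lemma S_scaleC:
  assumes "0 \<le> t" "u \<in> L2_net \<ll>" shows "S t (scaleC_net c u) = scaleC_net c (S t u)"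
proof (rule S_commute_operator[where C = "cmod c"])
  fix h :: real and v assume h: "0 < h" and v: "v \<in> L2_net \<ll>"
  note D = J_props(1)[OF h v]
  have "scaleC_net c (J h v) - h *\<^sub>R op_A \<ll> (scaleC_net c (J h v)) = scaleC_net c (J h v - h *\<^sub>R op_A \<ll> (J h v))"
    unfolding op_A_scaleC(2)[OF lengths_pos D] scaleC_net_diff scaleC_net_scaleR ..
  then show "J h (scaleC_net c v) = scaleC_net c (J h v)"
    by (intro J_eqI[OF h op_A_scaleC(1)[OF lengths_pos D]]) (simp only: J_props(2)[OF h v])
qed (use assms in \<open>auto simp: scaleC_net_diff norm_scaleC_net scaleC_net_in_L2_net\<close>)

lemma C0_semigroup_S: "C0_semigroup (L2_net \<ll>) S"
  unfolding C0_semigroup_def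
proof (intro conjI allI ballI impI)
  fix t :: real assume t: "0 \<le> t"
  show "S t u \<in> L2_net \<ll>" if "u \<in> L2_net \<ll>" for u by (rule S_in_X[OF t that])
  show "S t (u + v) = S t u + S t v" if "u \<in> L2_net \<ll>" "v \<in> L2_net \<ll>" for u v by (rule S_add[OF t that])
  show "S t (scaleC_net c u) = scaleC_net c (S t u)" if "u \<in> L2_net \<ll>" for c u by (rule S_scaleC[OF t that])
  show "\<exists>C. \<forall>u\<in>L2_net \<ll>. norm (S t u) \<le> C * norm u"
    by (rule exI[of _ 1]) (simp add: norm_S_le[OF t])
next
  show "S 0 u = u" if "u \<in> L2_net \<ll>" for u by (rule S_zero[OF that])
  show "S (s + t) u = S s (S t u)" if "0 \<le> s" "0 \<le> t" "u \<in> L2_net \<ll>" for s t u by (rule S_semigroup[OF that])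
  show "((\<lambda>t. S t u) \<longlongrightarrow> u) (at_right 0)" if u: "u \<in> L2_net \<ll>" for u
  proof -
    have "((\<lambda>t. S t u) \<longlongrightarrow> S 0 u) (at 0 within {0..})"
      using continuous_on_S[OF u] unfolding continuous_on_def by simp
    then have "((\<lambda>t. S t u) \<longlongrightarrow> S 0 u) (at_right 0)" by (rule tendsto_within_subset) auto
    then show ?thesis unfolding S_zero[OF u] .
  qed
qed

lemma has_generator_S: "has_generator (L2_net \<ll>) S (dom_A \<ll> e1 \<alpha>) (op_A \<ll>)"
  unfolding has_generator_def
proof (intro conjI ballI set_eqI iffI)
  show "u \<in> {u \<in> L2_net \<ll>. \<exists>w. ((\<lambda>h. (S h u - u) /\<^sub>R h) \<longlongrightarrow> w) (at_right 0)}" if "u \<in> dom_A \<ll> e1 \<alpha>" for u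
    using D_in_X[OF that] S_difference_quotient[OF that] by blast
  show "u \<in> dom_A \<ll> e1 \<alpha>" if "u \<in> {u \<in> L2_net \<ll>. \<exists>w. ((\<lambda>h. (S h u - u) /\<^sub>R h) \<longlongrightarrow> w) (at_right 0)}" for u
    using that difference_quotient_imp_D by blast
  show "((\<lambda>h. (S h u - u) /\<^sub>R h) \<longlongrightarrow> op_A \<ll> u) (at_right 0)" if "u \<in> dom_A \<ll> e1 \<alpha>" for u
    by (rule S_difference_quotient[OF that])
qed

lemma mild_solution_S:
  assumes "u0 \<in> L2_net \<ll>"
  shows "mild_solution (L2_net \<ll>) (dom_A \<ll> e1 \<alpha>) (op_A \<ll>) u0 (\<lambda>t. S t u0)"
  unfolding mild_solution_def
  using continuous_on_S[OF assms] S_in_X[OF _ assms] S_mild[OF _ assms] by simp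

lemma classical_solution_S:
  assumes u: "u0 \<in> dom_A \<ll> e1 \<alpha>"
  shows "classical_solution (dom_A \<ll> e1 \<alpha>) (op_A \<ll>) u0 (\<lambda>t. S t u0)"
  unfolding classical_solution_def
proof (intro conjI allI impI)
  show "S 0 u0 = u0" by (rule S_zero[OF D_in_X[OF u]])
  show "continuous_on {0..} (\<lambda>t. op_A \<ll> (S t u0))"
    by (rule continuous_on_eq[OF continuous_on_S[OF A_in[OF u]]]) (simp add: S_in_D(2)[OF _ u])
  show "S t u0 \<in> dom_A \<ll> e1 \<alpha>" if "0 \<le> t" for t by (rule S_in_D(1)[OF that u])
  show "((\<lambda>t. S t u0) has_vector_derivative op_A \<ll> (S t u0)) (at t within {0..})" if "0 \<le> t" for t
    by (rule S_has_vector_derivative[OF that u])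
qed

lemma energy_S: "0 \<le> t \<Longrightarrow> u0 \<in> L2_net \<ll> \<Longrightarrow> energy \<ll> (S t u0) = (norm (S t u0))\<^sup>2 / 2"
  by (rule energy_eq_norm[OF S_in_X])

lemma classical_dissipation_law:
  assumes u: "u0 \<in> dom_A \<ll> e1 \<alpha>" and t: "0 \<le> t"
  shows "((\<lambda>s. energy \<ll> (S s u0)) has_real_derivative
     dissipation e1 \<alpha> (\<lambda>j. value_trace j (S t u0)) (\<lambda>j. slope_trace j (S t u0))) (at t within {0..})"
proof (rule has_field_derivative_transform_within[OF _ zero_less_one])
  show "((\<lambda>s. (norm (S s u0))\<^sup>2 / 2) has_real_derivative
     dissipation e1 \<alpha> (\<lambda>j. value_trace j (S t u0)) (\<lambda>j. slope_trace j (S t u0))) (at t within {0..})"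
    using norm_S_has_derivative[OF t u] unfolding op_A_dissipation[OF lengths_pos S_in_D(1)[OF t u]] .
qed (use t energy_S[OF _ D_in_X[OF u]] in auto)

lemma node_traces_exist:
  assumes u: "u0 \<in> L2_net \<ll>"
  shows "\<exists>p q. node_traces \<ll> (dom_A \<ll> e1 \<alpha>) S u0 p q"
proof -
  have "\<forall>j. \<exists>p. \<forall>v. (\<forall>n. v n \<in> dom_A \<ll> e1 \<alpha>) \<and> v \<longlonglongrightarrow> u0 \<longrightarrow> L2_loc_tendsto (\<lambda>n t. value_trace j (S t (v n))) p"
  proof
    show "\<exists>p. \<forall>v. (\<forall>n. v n \<in> dom_A \<ll> e1 \<alpha>) \<and> v \<longlonglongrightarrow> u0 \<longrightarrow> L2_loc_tendsto (\<lambda>n t. value_trace j (S t (v n))) p" for j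
      by (rule traces_exist[OF node_trace_diff(1)[OF lengths_pos] value_trace_bound _ u]) (use damping in auto)
  qed
  from choice[OF this] obtain p where
    p: "\<forall>j v. (\<forall>n. v n \<in> dom_A \<ll> e1 \<alpha>) \<and> v \<longlonglongrightarrow> u0 \<longrightarrow> L2_loc_tendsto (\<lambda>n t. value_trace j (S t (v n))) (p j)" by blast
  have "\<forall>j. \<exists>q. \<forall>v. (\<forall>n. v n \<in> dom_A \<ll> e1 \<alpha>) \<and> v \<longlonglongrightarrow> u0 \<longrightarrow> L2_loc_tendsto (\<lambda>n t. slope_trace j (S t (v n))) q"
  proof
    show "\<exists>q. \<forall>v. (\<forall>n. v n \<in> dom_A \<ll> e1 \<alpha>) \<and> v \<longlonglongrightarrow> u0 \<longrightarrow> L2_loc_tendsto (\<lambda>n t. slope_trace j (S t (v n))) q" for j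
      by (rule traces_exist[OF node_trace_diff(2)[OF lengths_pos] slope_trace_bound _ u]) auto
  qed
  from choice[OF this] obtain q where
    q: "\<forall>j v. (\<forall>n. v n \<in> dom_A \<ll> e1 \<alpha>) \<and> v \<longlonglongrightarrow> u0 \<longrightarrow> L2_loc_tendsto (\<lambda>n t. slope_trace j (S t (v n))) (q j)" by blast
  have "node_traces \<ll> (dom_A \<ll> e1 \<alpha>) S u0 p q"
    unfolding node_traces_def using p q D_subset_closure u by blast
  then show ?thesis by blast
qed

text \<open>Approximate by classical solutions. Both sides are continuous in the initial datum: the left-hand side by the \<open>L\<^sup>2\<close>
  convergence of the traces, the right-hand side because \<open>S T\<close> is a contraction.\<close>

lemma energy_identity:
  assumes u: "u0 \<in> L2_net \<ll>" and tr: "node_traces \<ll> (dom_A \<ll> e1 \<alpha>) S u0 p q" and T: "0 < T"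
  shows "((\<lambda>t. dissipation e1 \<alpha> (\<lambda>j. p j t) (\<lambda>j. q j t)) has_integral (norm (S T u0))\<^sup>2 / 2 - (norm u0)\<^sup>2 / 2) {0..T}"
proof -
  define v where "v n = J (1 / real (Suc n)) u0" for n
  have vD: "v n \<in> dom_A \<ll> e1 \<alpha>" for n unfolding v_def by (rule J_props(1)[OF _ u]) simp
  have vl: "v \<longlonglongrightarrow> u0" unfolding v_def by (rule J_tendsto[OF u])
  have p: "L2_loc_tendsto (\<lambda>n t. value_trace j (S t (v n))) (p j)"
    and q: "L2_loc_tendsto (\<lambda>n t. slope_trace j (S t (v n))) (q j)" for j
    using tr vD vl unfolding node_traces_def by blast+
  have int: "(\<lambda>t. (cmod (f t))\<^sup>2) integrable_on {0..T}" if "L2_loc f" for f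
    by (rule set_lebesgue_integral_eq_integral(1)[OF L2_loc_absolutely_integrable[OF that T]])
  have loc: "L2_loc (\<lambda>t. value_trace j (S t (v n)))" "L2_loc (\<lambda>t. slope_trace j (S t (v n)))" "L2_loc (p j)" "L2_loc (q j)" for j n
    using p[of j] q[of j] unfolding L2_loc_tendsto_def by blast+
  let ?I = "\<lambda>z w. - (\<alpha> - real CARD('n) / 2) * integral {0..T} (\<lambda>t. (cmod (z e1 t))\<^sup>2)
      - 1/2 * (\<Sum>j\<in>UNIV. integral {0..T} (\<lambda>t. (cmod (w j t))\<^sup>2))"
  have "(norm (S T (v n)))\<^sup>2 / 2 - (norm (v n))\<^sup>2 / 2
      = ?I (\<lambda>j t. value_trace j (S t (v n))) (\<lambda>j t. slope_trace j (S t (v n)))" for n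
  proof (rule has_integral_unique)
    show "((\<lambda>t. op_A \<ll> (S t (v n)) \<bullet> S t (v n)) has_integral ((norm (S T (v n)))\<^sup>2 / 2 - (norm (v n))\<^sup>2 / 2)) {0..T}"
      by (rule dissipation_has_integral[OF less_imp_le[OF T] vD])
    show "((\<lambda>t. op_A \<ll> (S t (v n)) \<bullet> S t (v n)) has_integral
        ?I (\<lambda>j t. value_trace j (S t (v n))) (\<lambda>j t. slope_trace j (S t (v n)))) {0..T}"
    proof (rule has_integral_eq[OF _ dissipation_has_integral_split[where
            z = "\<lambda>j t. value_trace j (S t (v n))" and w = "\<lambda>j t. slope_trace j (S t (v n))"]])
      show "dissipation e1 \<alpha> (\<lambda>j. value_trace j (S t (v n))) (\<lambda>j. slope_trace j (S t (v n)))
          = op_A \<ll> (S t (v n)) \<bullet> S t (v n)" if "t \<in> {0..T}" for t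
        using that by (intro op_A_dissipation[OF lengths_pos, symmetric] S_in_D(1) vD) auto
    qed (intro int loc)+
  qed
  moreover have "(\<lambda>n. ?I (\<lambda>j t. value_trace j (S t (v n))) (\<lambda>j t. slope_trace j (S t (v n)))) \<longlonglongrightarrow> ?I p q"
    by (intro tendsto_diff tendsto_mult tendsto_const tendsto_sum L2_loc_tendsto_imp_energy_tendsto p q T)
  ultimately have 1: "(\<lambda>n. (norm (S T (v n)))\<^sup>2 / 2 - (norm (v n))\<^sup>2 / 2) \<longlonglongrightarrow> ?I p q" by simp
  have "(\<lambda>n. S T (v n)) \<longlonglongrightarrow> S T u0"
  proof (rule LIM_zero_cancel, rule Lim_null_comparison)
    show "\<forall>\<^sub>F n in sequentially. norm (S T (v n) - S T u0) \<le> norm (v n - u0)"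
      by (intro always_eventually allI norm_S_diff_le less_imp_le[OF T] D_in_X[OF vD] u)
    show "(\<lambda>n. norm (v n - u0)) \<longlonglongrightarrow> 0" by (intro tendsto_norm_zero LIM_zero vl)
  qed
  then have "(\<lambda>n. (norm (S T (v n)))\<^sup>2 / 2 - (norm (v n))\<^sup>2 / 2) \<longlonglongrightarrow> (norm (S T u0))\<^sup>2 / 2 - (norm u0)\<^sup>2 / 2"
    by (intro tendsto_intros vl) auto
  then have eq: "(norm (S T u0))\<^sup>2 / 2 - (norm u0)\<^sup>2 / 2 = ?I p q" using LIMSEQ_unique[OF _ 1] by blast
  show ?thesis unfolding eq by (rule dissipation_has_integral_split) (intro int loc)+
qed

lemma dissipation_law_ae:
  assumes u: "u0 \<in> L2_net \<ll>" and tr: "node_traces \<ll> (dom_A \<ll> e1 \<alpha>) S u0 p q"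
  shows "AE t in lebesgue. 0 < t \<longrightarrow> ((\<lambda>s. energy \<ll> (S s u0)) has_real_derivative
     dissipation e1 \<alpha> (\<lambda>j. p j t) (\<lambda>j. q j t)) (at t)"
proof (rule ae_derivative_of_integral)
  let ?g = "\<lambda>t. dissipation e1 \<alpha> (\<lambda>j. p j t) (\<lambda>j. q j t)"
  show "?g integrable_on {0..T}" if "0 < T" for T
    using energy_identity[OF u tr that] by (rule has_integral_integrable)
  show "energy \<ll> (S t u0) = (norm u0)\<^sup>2 / 2 + integral {0..t} ?g" if "0 \<le> t" for t
  proof (cases "t = 0")
    case True
    then show ?thesis using energy_S[OF order_refl u] S_zero[OF u] by simp
  next
    case False
    then show ?thesis
      using energy_S[OF that u] integral_unique[OF energy_identity[OF u tr, of t]] that by simp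
  qed
qed

lemma energy_antimono:
  assumes u: "u0 \<in> L2_net \<ll>"
  shows "antimono_on {0..} (\<lambda>t. energy \<ll> (S t u0))"
proof (rule monotone_onI)
  fix s t :: real assume st: "s \<in> {0..}" "t \<in> {0..}" "s \<le> t"
  then have "(norm (S t u0))\<^sup>2 \<le> (norm (S s u0))\<^sup>2"
    by (intro power_mono norm_S_antimono u) auto
  then show "energy \<ll> (S s u0) \<ge> energy \<ll> (S t u0)"
    using st unfolding energy_S[OF st(1)[unfolded atLeast_iff] u] energy_S[OF st(2)[unfolded atLeast_iff] u] by simp
qed

end

theorem proposition2p1:
  fixes \<l> :: "'n::finite \<Rightarrow> real" and e1 :: 'n and \<alpha> :: real
  assumes "\<forall>j. 0 < \<l> j" and "\<alpha> > real CARD('n) / 2"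
  shows "\<exists>S. C0_semigroup (L2_net \<l>) S \<and>
    has_generator (L2_net \<l>) S (dom_A \<l> e1 \<alpha>) (op_A \<l>) \<and>
    (\<forall>u0 \<in> L2_net \<l>.
      mild_solution (L2_net \<l>) (dom_A \<l> e1 \<alpha>) (op_A \<l>) u0 (\<lambda>t. S t u0) \<and>
      (\<forall>V. mild_solution (L2_net \<l>) (dom_A \<l> e1 \<alpha>) (op_A \<l>) u0 V \<longrightarrow> (\<forall>t\<ge>0. V t = S t u0)) \<and>
      (u0 \<in> dom_A \<l> e1 \<alpha> \<longrightarrow>
        classical_solution (dom_A \<l> e1 \<alpha>) (op_A \<l>) u0 (\<lambda>t. S t u0) \<and>
        (\<forall>t\<ge>0. ((\<lambda>s. energy \<l> (S s u0)) has_real_derivative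
           dissipation e1 \<alpha> (\<lambda>j. pt_value (\<l> j) (S t u0 $ j) 0)
             (\<lambda>j. pt_value (\<l> j) (weak_deriv (\<l> j) (S t u0 $ j)) 0)) (at t within {0..}))) \<and>
      (\<exists>p q. node_traces \<l> (dom_A \<l> e1 \<alpha>) S u0 p q) \<and>
      (\<forall>p q. node_traces \<l> (dom_A \<l> e1 \<alpha>) S u0 p q \<longrightarrow>
        (AE t in lebesgue. 0 < t \<longrightarrow>
          ((\<lambda>s. energy \<l> (S s u0)) has_real_derivative
             dissipation e1 \<alpha> (\<lambda>j. p j t) (\<lambda>j. q j t)) (at t) \<and>
          dissipation e1 \<alpha> (\<lambda>j. p j t) (\<lambda>j. q j t) \<le> 0)) \<and>
      antimono_on {0..} (\<lambda>t. energy \<l> (S t u0)))"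
proof -
  interpret star_network \<l> e1 \<alpha>
    by unfold_locales (use assms in auto)
  show ?thesis
  proof (rule exI[of _ S], intro conjI ballI allI impI)
    show "C0_semigroup (L2_net \<l>) S" by (rule C0_semigroup_S)
    show "has_generator (L2_net \<l>) S (dom_A \<l> e1 \<alpha>) (op_A \<l>)" by (rule has_generator_S)
  next
    fix u0 assume u: "u0 \<in> L2_net \<l>"
    show "mild_solution (L2_net \<l>) (dom_A \<l> e1 \<alpha>) (op_A \<l>) u0 (\<lambda>t. S t u0)" by (rule mild_solution_S[OF u])
    show "V t = S t u0" if "mild_solution (L2_net \<l>) (dom_A \<l> e1 \<alpha>) (op_A \<l>) u0 V" "0 \<le> t" for V t
      using that u unfolding mild_solution_def by (intro mild_unique) auto
    show "\<exists>p q. node_traces \<l> (dom_A \<l> e1 \<alpha>) S u0 p q" by (rule node_traces_exist[OF u])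
    show "antimono_on {0..} (\<lambda>t. energy \<l> (S t u0))" by (rule energy_antimono[OF u])
    show "AE t in lebesgue. 0 < t \<longrightarrow>
          ((\<lambda>s. energy \<l> (S s u0)) has_real_derivative dissipation e1 \<alpha> (\<lambda>j. p j t) (\<lambda>j. q j t)) (at t) \<and>
          dissipation e1 \<alpha> (\<lambda>j. p j t) (\<lambda>j. q j t) \<le> 0"
      if "node_traces \<l> (dom_A \<l> e1 \<alpha>) S u0 p q" for p q
      using dissipation_law_ae[OF u that] by eventually_elim (simp add: dissipation_nonpos[OF damping])
  next
    fix u0 assume u: "u0 \<in> dom_A \<l> e1 \<alpha>"
    show "classical_solution (dom_A \<l> e1 \<alpha>) (op_A \<l>) u0 (\<lambda>t. S t u0)" by (rule classical_solution_S[OF u])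
    show "((\<lambda>s. energy \<l> (S s u0)) has_real_derivative
           dissipation e1 \<alpha> (\<lambda>j. pt_value (\<l> j) (S t u0 $ j) 0)
             (\<lambda>j. pt_value (\<l> j) (weak_deriv (\<l> j) (S t u0 $ j)) 0)) (at t within {0..})" if "0 \<le> t" for t
      by (rule classical_dissipation_law[OF u that])
  qed
qed

end
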